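(* Let $\mathbf{k}$ be a field and let $\mathfrak{g} = \mathfrak{h}\ltimes\mathfrak{k}$ be a finite-dimensional Lie algebra over $\mathbf{k}$ which is a semidirect product of an Abelian subalgebra $\mathfrak{h}$ and an ideal $\mathfrak{k}$. Let $M$ be a $\mathfrak{g}$-module, and suppose that $\mathfrak{h}$ acts torally both on $\mathfrak{g}$ (by the adjoint action) and on $M$. Then there is an isomorphism of graded vector spaces $$H^*(\mathfrak{g},M)\;\cong\;\bigwedge \mathfrak{h}^{\vee}\otimes H^*(\mathfrak{k},M)_{\mathbf 0}\;=\;H^*(\mathfrak{h},\mathbf{k})\otimes H^*(\mathfrak{k},M)_{\mathbf 0},$$ where $H^*(\mathfrak{k},M)_{\mathbf 0}=H^*(\mathfrak{k},M)^{\mathfrak{h}}$ is the weight $\mathbf 0$ part of $H^*(\mathfrak{k},M)$ under the action of $\mathfrak{h}$.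
   Context: A Lie algebra acts torally on a $\mathbf{k}$-vector space if each of its elements acts semisimply, i.e. can be brought into diagonal form over the algebraic closure of $\mathbf{k}$. $H^*(-,-)$ is Chevalley–Eilenberg cohomology, the cohomology of the complex $C^n(\mathfrak{k},M)$ of alternating $n$-linear maps $\mathfrak{k}^n\to M$. The subalgebra $\mathfrak{h}$ acts on $C^n(\mathfrak{k},M)$ by $[h,F](x_1,\dots,x_n)=[h,F(x_1,\dots,x_n)]-\sum_{i=1}^n F(x_1,\dots,[h,x_i],\dots,x_n)$, and this action descends to $H^n(\mathfrak{k},M)$. The weight $\mathbf 0$ part, denoted by the subscript $\mathbf 0$, is the subspace of elements annihilated by all of $\mathfrak{h}$ (the invariants). $\mathfrak{h}^{\vee}$ is the dual space of $\mathfrak{h}$ (with $\bigwedge^r\mathfrak{h}^\vee$ in degree $r$), and $\mathbf{k}$ is the trivial module; the total grading is used on the tensor product. *)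

theory Defs
  imports
    "HOL-Algebra.Algebraic_Closure_Type"
    "HOL-Algebra.Module"
    "HOL-Library.Function_Algebras"
    "HOL-Library.Poly_Mapping"
begin

section \<open>Linear algebra of quotients\<close>

text \<open>
  Given spaces live on whole types (locale \<^locale>\<open>vector_space\<close>); spaces derived from them are
  records of type \<^type>\<open>module\<close> over a type of class \<^class>\<open>field\<close>. Only the
  fields \<^const>\<open>carrier\<close>, \<^const>\<open>zero\<close>, \<^const>\<open>add\<close>, \<^const>\<open>module.smult\<close> of the record are
  meaningful; the two multiplicative fields are left undefined.
\<close>

definition linear_iso :: "('v \<Rightarrow> 'w) \<Rightarrow> ('k, 'v) module \<Rightarrow> ('k, 'w) module \<Rightarrow> bool" where
  "linear_iso f V W \<longleftrightarrow> f \<in> iso (add_monoid V) (add_monoid W) \<and>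
     (\<forall>c. \<forall>x \<in> carrier V. f (c \<odot>\<^bsub>V\<^esub> x) = c \<odot>\<^bsub>W\<^esub> f x)"

definition subspace_module :: "('k \<Rightarrow> 'v \<Rightarrow> 'v) \<Rightarrow> 'v set \<Rightarrow> ('k, 'v::ab_group_add) module" where
  "subspace_module s V =
     \<lparr>carrier = V, monoid.mult = undefined, one = undefined, zero = 0, add = (+), module.smult = s\<rparr>"

definition coset_of :: "'v set \<Rightarrow> 'v \<Rightarrow> 'v::ab_group_add set" where
  "coset_of B v = (\<lambda>b. v + b) ` B"

text \<open>The map of cosets of \<open>B\<close> induced by a map \<open>f\<close> which preserves congruence modulo \<open>B\<close>.\<close>

definition induced :: "'v set \<Rightarrow> ('v \<Rightarrow> 'v) \<Rightarrow> 'v set \<Rightarrow> 'v::ab_group_add set" where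
  "induced B f A = (\<Union>x\<in>A. coset_of B (f x))"

definition quotient_module ::
    "('k \<Rightarrow> 'v \<Rightarrow> 'v) \<Rightarrow> 'v set \<Rightarrow> 'v set \<Rightarrow> ('k, 'v::ab_group_add set) module" where
  "quotient_module s Z B =
     \<lparr>carrier = coset_of B ` Z, monoid.mult = undefined, one = undefined, zero = B,
      add = (\<lambda>A A'. {x + y | x y. x \<in> A \<and> y \<in> A'}), module.smult = (\<lambda>c. induced B (s c))\<rparr>"

definition pointwise :: "('k \<Rightarrow> 'v \<Rightarrow> 'v) \<Rightarrow> 'k \<Rightarrow> ('x \<Rightarrow> 'v) \<Rightarrow> ('x \<Rightarrow> 'v)" where
  "pointwise s c f = (\<lambda>x. s c (f x))"

text \<open>
  The type \<open>'x \<Rightarrow>\<^sub>0 'k\<close> is the free vector space on \<open>'x\<close>; its basis vectors are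
  \<open>Poly_Mapping.single x 1\<close>.
\<close>

definition fscale :: "'k::field \<Rightarrow> ('x \<Rightarrow>\<^sub>0 'k) \<Rightarrow> ('x \<Rightarrow>\<^sub>0 'k)" where
  "fscale c p = Poly_Mapping.map ((*) c) p"

definition free_on :: "'x set \<Rightarrow> ('x \<Rightarrow>\<^sub>0 'k::field) set" where
  "free_on A = {p. Poly_Mapping.keys p \<subseteq> A}"

definition tensor_relations ::
    "('k::field, 'v) module \<Rightarrow> ('k, 'w) module \<Rightarrow> ('v \<times> 'w \<Rightarrow>\<^sub>0 'k) set" where
  "tensor_relations V W =
     {Poly_Mapping.single (v \<oplus>\<^bsub>V\<^esub> v', w) 1 - Poly_Mapping.single (v, w) 1
        - Poly_Mapping.single (v', w) 1
      | v v' w. v \<in> carrier V \<and> v' \<in> carrier V \<and> w \<in> carrier W} \<union>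
     {Poly_Mapping.single (v, w \<oplus>\<^bsub>W\<^esub> w') 1 - Poly_Mapping.single (v, w) 1
        - Poly_Mapping.single (v, w') 1
      | v w w'. v \<in> carrier V \<and> w \<in> carrier W \<and> w' \<in> carrier W} \<union>
     {Poly_Mapping.single (c \<odot>\<^bsub>V\<^esub> v, w) 1 - Poly_Mapping.single (v, w) c
      | c v w. v \<in> carrier V \<and> w \<in> carrier W} \<union>
     {Poly_Mapping.single (v, c \<odot>\<^bsub>W\<^esub> w) 1 - Poly_Mapping.single (v, w) c
      | c v w. v \<in> carrier V \<and> w \<in> carrier W}"

definition tensor ::
    "('k::field, 'v) module \<Rightarrow> ('k, 'w) module \<Rightarrow> ('k, ('v \<times> 'w \<Rightarrow>\<^sub>0 'k) set) module" where
  "tensor V W = quotient_module fscale (free_on (carrier V \<times> carrier W))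
     (module.span fscale (tensor_relations V W))"

definition tuples :: "nat \<Rightarrow> 'x set \<Rightarrow> 'x list set" where
  "tuples n S = {xs. length xs = n \<and> set xs \<subseteq> S}"

definition exterior_relations :: "nat \<Rightarrow> ('k::field, 'v) module \<Rightarrow> ('v list \<Rightarrow>\<^sub>0 'k) set" where
  "exterior_relations r V =
     {Poly_Mapping.single (xs[i := v \<oplus>\<^bsub>V\<^esub> w]) 1 - Poly_Mapping.single (xs[i := v]) 1
        - Poly_Mapping.single (xs[i := w]) 1
      | xs i v w. xs \<in> tuples r (carrier V) \<and> i < r \<and> v \<in> carrier V \<and> w \<in> carrier V} \<union>
     {Poly_Mapping.single (xs[i := c \<odot>\<^bsub>V\<^esub> v]) 1 - Poly_Mapping.single (xs[i := v]) c
      | xs i c v. xs \<in> tuples r (carrier V) \<and> i < r \<and> v \<in> carrier V} \<union>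
     {Poly_Mapping.single xs 1
      | xs i j. xs \<in> tuples r (carrier V) \<and> i < j \<and> j < r \<and> xs ! i = xs ! j}"

text \<open>The class of \<open>Poly_Mapping.single [v\<^sub>1, \<dots>, v\<^sub>r] 1\<close> is \<open>v\<^sub>1 \<and> \<dots> \<and> v\<^sub>r\<close>.\<close>

definition exterior_power ::
    "('k::field, 'v) module \<Rightarrow> nat \<Rightarrow> ('k, ('v list \<Rightarrow>\<^sub>0 'k) set) module" where
  "exterior_power V r = quotient_module fscale (free_on (tuples r (carrier V)))
     (module.span fscale (exterior_relations r V))"

text \<open>
  Maps which are only defined on a subset of a type are represented by their extension by zero,
  here and for cochains below.
\<close>

definition dual_space ::
    "('k::field \<Rightarrow> 'v \<Rightarrow> 'v) \<Rightarrow> 'v::ab_group_add set \<Rightarrow> ('k, 'v \<Rightarrow> 'k) module" where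
  "dual_space s S = subspace_module (pointwise (*))
     {f. (\<forall>x\<in>S. \<forall>y\<in>S. f (x + y) = f x + f y) \<and> (\<forall>c. \<forall>x\<in>S. f (s c x) = c * f x) \<and>
         (\<forall>x. x \<notin> S \<longrightarrow> f x = 0)}"

text \<open>
  A graded vector space is the sequence of its homogeneous components. In the tensor product, degree
  \<open>n\<close> is the (finite) direct sum of the \<open>A\<^sub>i \<otimes> B\<^sub>n\<^sub>-\<^sub>i\<close>.
\<close>

definition graded_tensor ::
    "(nat \<Rightarrow> ('k::field, 'v) module) \<Rightarrow> (nat \<Rightarrow> ('k, 'w) module) \<Rightarrow>
     nat \<Rightarrow> ('k, nat \<Rightarrow> ('v \<times> 'w \<Rightarrow>\<^sub>0 'k) set) module" where
  "graded_tensor A B n = (let T = (\<lambda>i. tensor (A i) (B (n - i))) in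
     \<lparr>carrier = (\<Pi>\<^sub>E i\<in>{..n}. carrier (T i)), monoid.mult = undefined, one = undefined,
      zero = (\<lambda>i\<in>{..n}. \<zero>\<^bsub>T i\<^esub>),
      add = (\<lambda>x y. \<lambda>i\<in>{..n}. x i \<oplus>\<^bsub>T i\<^esub> y i),
      module.smult = (\<lambda>c x. \<lambda>i\<in>{..n}. c \<odot>\<^bsub>T i\<^esub> x i)\<rparr>)"

definition graded_isomorphic ::
    "(nat \<Rightarrow> ('k, 'v) module) \<Rightarrow> (nat \<Rightarrow> ('k, 'w) module) \<Rightarrow> bool" where
  "graded_isomorphic A B \<longleftrightarrow> (\<forall>n. \<exists>f. linear_iso f (A n) (B n))"


section \<open>Semisimple operators\<close>

text \<open>
  Extension of scalars of a space with scalar multiplication \<open>s\<close> to the algebraic closure: the free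
  space over the algebraic closure on all vectors, modulo additivity and homogeneity over the ground
  field.
\<close>

definition closure_relations ::
    "('k::field \<Rightarrow> 'v \<Rightarrow> 'v) \<Rightarrow> ('v::ab_group_add \<Rightarrow>\<^sub>0 'k alg_closure) set" where
  "closure_relations s =
     {Poly_Mapping.single (v + w) 1 - Poly_Mapping.single v 1 - Poly_Mapping.single w 1
      | v w. True} \<union>
     {Poly_Mapping.single (s c v) 1 - Poly_Mapping.single v (to_ac c) | c v. True}"

definition closure_extension ::
    "('k::field \<Rightarrow> 'v \<Rightarrow> 'v) \<Rightarrow>
     ('k alg_closure, ('v::ab_group_add \<Rightarrow>\<^sub>0 'k alg_closure) set) module" where
  "closure_extension s = quotient_module fscale UNIV (module.span fscale (closure_relations s))"

definition closure_map ::
    "('k::field \<Rightarrow> 'v \<Rightarrow> 'v) \<Rightarrow> ('v \<Rightarrow> 'v) \<Rightarrow>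
     ('v::ab_group_add \<Rightarrow>\<^sub>0 'k alg_closure) set \<Rightarrow> ('v \<Rightarrow>\<^sub>0 'k alg_closure) set" where
  "closure_map s f = induced (module.span fscale (closure_relations s))
     (\<lambda>p. \<Sum>v \<in> Poly_Mapping.keys p. Poly_Mapping.single (f v) (Poly_Mapping.lookup p v))"

text \<open>
  An operator is semisimple if, over the algebraic closure, it becomes diagonal in suitable
  coordinates \<open>\<Phi>\<close> indexed by some set \<open>I\<close>, with diagonal entries \<open>a\<close>. The coordinate spaces are
  spaces of finitely supported functions, so infinite-dimensional spaces are allowed. Taking
  \<open>I\<close> in the type of vectors is no restriction: a basis of the extended space is equipotent
  to a basis of the original one.
\<close>

definition semisimple_operator ::
    "('k::field \<Rightarrow> 'v \<Rightarrow> 'v) \<Rightarrow> ('v \<Rightarrow> 'v::ab_group_add) \<Rightarrow> bool" where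
  "semisimple_operator s f \<longleftrightarrow>
     (\<exists>(I :: 'v set) (a :: 'v \<Rightarrow> 'k alg_closure) \<Phi>.
        linear_iso \<Phi> (closure_extension s) (subspace_module fscale (free_on I)) \<and>
        (\<forall>x \<in> carrier (closure_extension s).
           \<Phi> (closure_map s f x) = Poly_Mapping.mapp (\<lambda>i c. a i * c) (\<Phi> x)))"

definition acts_torally ::
    "('k::field \<Rightarrow> 'v \<Rightarrow> 'v) \<Rightarrow> 'g set \<Rightarrow> ('g \<Rightarrow> 'v \<Rightarrow> 'v::ab_group_add) \<Rightarrow> bool" where
  "acts_torally s H act \<longleftrightarrow> (\<forall>h\<in>H. semisimple_operator s (act h))"


section \<open>Lie algebras and modules\<close>

locale lie_algebra = vector_space scale
  for scale :: "'k::field \<Rightarrow> 'g::ab_group_add \<Rightarrow> 'g" +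
  fixes bracket :: "'g \<Rightarrow> 'g \<Rightarrow> 'g"
  assumes bracket_add_left: "bracket (x + y) z = bracket x z + bracket y z"
    and bracket_add_right: "bracket x (y + z) = bracket x y + bracket x z"
    and bracket_scale_left: "bracket (scale c x) y = scale c (bracket x y)"
    and bracket_scale_right: "bracket x (scale c y) = scale c (bracket x y)"
    and bracket_self: "bracket x x = 0"
    and jacobi: "bracket x (bracket y z) + bracket y (bracket z x) + bracket z (bracket x y) = 0"
begin

definition finite_dimensional :: bool where
  "finite_dimensional \<longleftrightarrow> (\<exists>B. finite B \<and> span B = UNIV)"

definition lie_subalgebra :: "'g set \<Rightarrow> bool" where
  "lie_subalgebra S \<longleftrightarrow> subspace S \<and> (\<forall>x\<in>S. \<forall>y\<in>S. bracket x y \<in> S)"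

definition abelian :: "'g set \<Rightarrow> bool" where
  "abelian S \<longleftrightarrow> (\<forall>x\<in>S. \<forall>y\<in>S. bracket x y = 0)"

definition lie_ideal :: "'g set \<Rightarrow> bool" where
  "lie_ideal I \<longleftrightarrow> subspace I \<and> (\<forall>x. \<forall>y\<in>I. bracket x y \<in> I)"

definition semidirect_product :: "'g set \<Rightarrow> 'g set \<Rightarrow> bool" where
  "semidirect_product S I \<longleftrightarrow> lie_subalgebra S \<and> lie_ideal I \<and>
     S \<inter> I = {0} \<and> {a + b | a b. a \<in> S \<and> b \<in> I} = UNIV"

end

locale lie_module = lie_algebra scale bracket + M: vector_space mscale
  for scale :: "'k::field \<Rightarrow> 'g::ab_group_add \<Rightarrow> 'g"
    and bracket :: "'g \<Rightarrow> 'g \<Rightarrow> 'g"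
    and mscale :: "'k \<Rightarrow> 'm::ab_group_add \<Rightarrow> 'm" +
  fixes act :: "'g \<Rightarrow> 'm \<Rightarrow> 'm"
  assumes act_add_left: "act (x + y) m = act x m + act y m"
    and act_add_right: "act x (m + m') = act x m + act x m'"
    and act_scale_left: "act (scale c x) m = mscale c (act x m)"
    and act_scale_right: "act x (mscale c m) = mscale c (act x m)"
    and act_bracket: "act (bracket x y) m = act x (act y m) - act y (act x m)"


section \<open>Chevalley--Eilenberg cohomology\<close>

text \<open>
  The cohomology of a subalgebra \<open>S\<close> of a Lie algebra with scalar multiplication \<open>s\<close> and bracket
  \<open>br\<close>, with coefficients in a module with scalar multiplication \<open>t\<close> and action \<open>act\<close>. The
  whole Lie algebra is the case \<open>S = UNIV\<close>.
\<close>

definition cochains ::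
    "('k::field \<Rightarrow> 'g \<Rightarrow> 'g) \<Rightarrow> ('k \<Rightarrow> 'm \<Rightarrow> 'm) \<Rightarrow> 'g set \<Rightarrow> nat \<Rightarrow>
     ('g::ab_group_add list \<Rightarrow> 'm::ab_group_add) set" where
  "cochains s t S n = {F.
     (\<forall>xs\<in>tuples n S. \<forall>i<n. \<forall>x\<in>S. \<forall>y\<in>S. F (xs[i := x + y]) = F (xs[i := x]) + F (xs[i := y])) \<and>
     (\<forall>xs\<in>tuples n S. \<forall>i<n. \<forall>c. \<forall>x\<in>S. F (xs[i := s c x]) = t c (F (xs[i := x]))) \<and>
     (\<forall>xs\<in>tuples n S. \<forall>i j. i < j \<and> j < n \<and> xs ! i = xs ! j \<longrightarrow> F xs = 0) \<and>
     (\<forall>xs. xs \<notin> tuples n S \<longrightarrow> F xs = 0)}"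

definition remove_nth :: "nat \<Rightarrow> 'x list \<Rightarrow> 'x list" where
  "remove_nth i xs = take i xs @ drop (Suc i) xs"

text \<open>The arguments \<open>x\<^sub>0, \<dots>, x\<^sub>n\<close> are numbered from zero, hence the signs \<open>(-1)\<^sup>i\<close>.\<close>

definition differential ::
    "('g \<Rightarrow> 'g \<Rightarrow> 'g) \<Rightarrow> ('k::field \<Rightarrow> 'm \<Rightarrow> 'm) \<Rightarrow> ('g \<Rightarrow> 'm \<Rightarrow> 'm) \<Rightarrow> 'g set \<Rightarrow> nat \<Rightarrow>
     ('g list \<Rightarrow> 'm::ab_group_add) \<Rightarrow> 'g list \<Rightarrow> 'm" where
  "differential br t act S n F xs =
     (if xs \<in> tuples (Suc n) S
      then (\<Sum>i\<le>n. t ((-1) ^ i) (act (xs ! i) (F (remove_nth i xs)))) +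
           (\<Sum>j\<le>n. \<Sum>i<j. t ((-1) ^ (i + j))
              (F (br (xs ! i) (xs ! j) # remove_nth i (remove_nth j xs))))
      else 0)"

definition cocycles ::
    "('k::field \<Rightarrow> 'g \<Rightarrow> 'g) \<Rightarrow> ('g \<Rightarrow> 'g \<Rightarrow> 'g) \<Rightarrow> ('k \<Rightarrow> 'm \<Rightarrow> 'm) \<Rightarrow> ('g \<Rightarrow> 'm \<Rightarrow> 'm) \<Rightarrow>
     'g set \<Rightarrow> nat \<Rightarrow> ('g::ab_group_add list \<Rightarrow> 'm::ab_group_add) set" where
  "cocycles s br t act S n = {F \<in> cochains s t S n. differential br t act S n F = 0}"

fun coboundaries ::
    "('k::field \<Rightarrow> 'g \<Rightarrow> 'g) \<Rightarrow> ('g \<Rightarrow> 'g \<Rightarrow> 'g) \<Rightarrow> ('k \<Rightarrow> 'm \<Rightarrow> 'm) \<Rightarrow> ('g \<Rightarrow> 'm \<Rightarrow> 'm) \<Rightarrow>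
     'g set \<Rightarrow> nat \<Rightarrow> ('g::ab_group_add list \<Rightarrow> 'm::ab_group_add) set" where
  "coboundaries s br t act S 0 = {0}"
| "coboundaries s br t act S (Suc n) = differential br t act S n ` cochains s t S n"

definition cohomology ::
    "('k::field \<Rightarrow> 'g \<Rightarrow> 'g) \<Rightarrow> ('g \<Rightarrow> 'g \<Rightarrow> 'g) \<Rightarrow> ('k \<Rightarrow> 'm \<Rightarrow> 'm) \<Rightarrow> ('g \<Rightarrow> 'm \<Rightarrow> 'm) \<Rightarrow>
     'g set \<Rightarrow> nat \<Rightarrow> ('k, ('g::ab_group_add list \<Rightarrow> 'm::ab_group_add) set) module" where
  "cohomology s br t act S n =
     quotient_module (pointwise t) (cocycles s br t act S n) (coboundaries s br t act S n)"

definition cochain_action ::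
    "('g \<Rightarrow> 'g \<Rightarrow> 'g) \<Rightarrow> ('g \<Rightarrow> 'm \<Rightarrow> 'm) \<Rightarrow> 'g set \<Rightarrow> nat \<Rightarrow> 'g \<Rightarrow>
     ('g list \<Rightarrow> 'm::ab_group_add) \<Rightarrow> 'g list \<Rightarrow> 'm" where
  "cochain_action br act S n h F xs =
     (if xs \<in> tuples n S then act h (F xs) - (\<Sum>i<n. F (xs[i := br h (xs ! i)])) else 0)"

definition weight_zero_cohomology ::
    "('k::field \<Rightarrow> 'g \<Rightarrow> 'g) \<Rightarrow> ('g \<Rightarrow> 'g \<Rightarrow> 'g) \<Rightarrow> ('k \<Rightarrow> 'm \<Rightarrow> 'm) \<Rightarrow> ('g \<Rightarrow> 'm \<Rightarrow> 'm) \<Rightarrow>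
     'g set \<Rightarrow> 'g set \<Rightarrow> nat \<Rightarrow> ('k, ('g::ab_group_add list \<Rightarrow> 'm::ab_group_add) set) module" where
  "weight_zero_cohomology s br t act H S n =
     (let V = cohomology s br t act S n in
      V \<lparr>carrier := {A \<in> carrier V. \<forall>h\<in>H.
          induced (coboundaries s br t act S n) (cochain_action br act S n h) A = \<zero>\<^bsub>V\<^esub>}\<rparr>)"

end

theory Submission
  imports Defs
begin

text \<open>
  Torality makes every \<open>h \<in> \<hh>\<close> act semisimply on cochains, in the weak sense that in every quotient
  by a stable subspace the kernels of \<open>h\<close> and of \<open>h\<^sup>2\<close> agree. Hence cocycles and coboundaries split
  into their \<open>\<hh>\<close>-invariants and the image of \<open>\<hh>\<close>. By the Cartan formula
  \<open>\<theta>\<^sub>h = d \<iota>\<^sub>h + \<iota>\<^sub>h d\<close> this image is exact on cocycles of the whole algebra, so the invariant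
  cochains compute \<open>H(\<gg>, M)\<close>, while on \<open>\<kk>\<close> they compute the weight zero part of \<open>H(\<kk>, M)\<close>.

  Contraction with the increasing tuples \<open>A\<close> of a basis of \<open>\<hh>\<close> identifies invariant cochains
  of \<open>\<gg>\<close> with families \<open>(F\<^sub>A)\<close> of invariant cochains of \<open>\<kk>\<close>, of degree lowered by \<open>|A|\<close>; since
  \<open>\<theta>\<^sub>h\<close> vanishes on invariants, \<open>d\<close> anticommutes with each \<open>\<iota>\<^sub>h\<close> and so acts on each
  \<open>F\<^sub>A\<close> separately. With \<open>U\<^sub>m\<close> a complement of the coboundaries in the invariant cocycles of
  \<open>\<kk>\<close>, all graded spaces in the theorem become families \<open>(u\<^sub>A)\<close> with \<open>u\<^sub>A \<in> U\<^bsub>n - |A|\<^esub>\<close>.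
\<close>

section \<open>Linear isomorphisms\<close>

text \<open>The weak form of semisimplicity is chosen because it descends from the algebraic
  closure. There every cochain \<open>F\<close> is a finite sum of eigenvectors of
  \<open>\<theta>_h\<close>: the action is a sum of commuting operators, one for the values and one
  for each argument. As \<open>\<gg>\<close> is finite-dimensional, the values of \<open>F\<close>
  span a finite-dimensional space, and finitely many eigenvalues suffice for each of these
  operators.

  Quotients are compared by giving a map from a concrete space of families and checking it modulo
  the relations. Alternating forms are the special case of zero bracket and \<open>K = {0}\<close>
  of the component calculus; this yields dual bases for the exterior powers, and no wedge product
  has to be sorted.\<close>

lemma linear_iso_iff:
  "linear_iso f V W \<longleftrightarrow> bij_betw f (carrier V) (carrier W) \<and>
     (\<forall>x\<in>carrier V. \<forall>y\<in>carrier V. f (x \<oplus>\<^bsub>V\<^esub> y) = f x \<oplus>\<^bsub>W\<^esub> f y) \<and>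
     (\<forall>c. \<forall>x\<in>carrier V. f (c \<odot>\<^bsub>V\<^esub> x) = c \<odot>\<^bsub>W\<^esub> f x)"
  unfolding linear_iso_def iso_def hom_def by (auto simp: bij_betw_def)

lemma subspace_module_simps [simp]:
  "carrier (subspace_module s Y) = Y" "x \<oplus>\<^bsub>subspace_module s Y\<^esub> y = x + y"
  "c \<odot>\<^bsub>subspace_module s Y\<^esub> x = s c x"
  by (simp_all add: subspace_module_def)

lemma linear_iso_trans:
  assumes "linear_iso f U V" "linear_iso g V W"
  shows "linear_iso (g \<circ> f) U W"
proof -
  have "f x \<in> carrier V" if "x \<in> carrier U" for x
    using assms(1) that by (auto simp: linear_iso_iff bij_betw_def)
  then show ?thesis using assms by (auto simp: linear_iso_iff intro: bij_betw_trans)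
qed

text \<open>Records carry no module axioms, so closure of the source under its operations is
  assumed: it allows the preimage of a sum to be identified by injectivity.\<close>

lemma linear_iso_inv:
  assumes f: "linear_iso f V W"
    and V: "\<And>x y. \<lbrakk>x \<in> carrier V; y \<in> carrier V\<rbrakk> \<Longrightarrow> x \<oplus>\<^bsub>V\<^esub> y \<in> carrier V"
      "\<And>c x. x \<in> carrier V \<Longrightarrow> c \<odot>\<^bsub>V\<^esub> x \<in> carrier V"
  shows "linear_iso (inv_into (carrier V) f) W V"
proof -
  let ?g = "inv_into (carrier V) f"
  have bij: "bij_betw f (carrier V) (carrier W)" using f by (simp add: linear_iso_iff)
  have g: "?g x \<in> carrier V" "f (?g x) = x" if "x \<in> carrier W" for x
    using bij that by (auto simp: bij_betw_def inv_into_into f_inv_into_f)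
  have gf: "?g (f x) = x" if "x \<in> carrier V" for x
    using bij that by (auto simp: bij_betw_def)
  have "?g (x \<oplus>\<^bsub>W\<^esub> y) = ?g x \<oplus>\<^bsub>V\<^esub> ?g y" if xy: "x \<in> carrier W" "y \<in> carrier W" for x y
  proof -
    have "f (?g x \<oplus>\<^bsub>V\<^esub> ?g y) = x \<oplus>\<^bsub>W\<^esub> y" using f g xy by (simp add: linear_iso_iff)
    then show ?thesis using gf[OF V(1)] g(1) xy by metis
  qed
  moreover have "?g (c \<odot>\<^bsub>W\<^esub> x) = c \<odot>\<^bsub>V\<^esub> ?g x" if x: "x \<in> carrier W" for c x
  proof -
    have "f (c \<odot>\<^bsub>V\<^esub> ?g x) = c \<odot>\<^bsub>W\<^esub> x" using f g x by (simp add: linear_iso_iff)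
    then show ?thesis using gf[OF V(2)] g(1) x by metis
  qed
  ultimately show ?thesis using bij by (simp add: linear_iso_iff bij_betw_inv_into)
qed

lemma linear_iso_subspace_inv:
  assumes "vector_space s" "module.subspace s Y" "linear_iso f (subspace_module s Y) W"
  shows "linear_iso (inv_into Y f) W (subspace_module s Y)"
proof -
  interpret vector_space s by fact
  show ?thesis using linear_iso_inv[OF assms(3)] assms(2) by (simp add: subspace_add subspace_scale)
qed

text \<open>The common source is a genuine subspace and supplies the closure that inversion needs;
  the two targets are bare records.\<close>

lemma linear_iso_common_source:
  assumes "\<exists>T. linear_iso T (subspace_module s Q) V" "\<exists>T. linear_iso T (subspace_module s Q) V'"
    and "vector_space s" "module.subspace s Q"
  shows "\<exists>T. linear_iso T V V'"
  using linear_iso_subspace_inv[OF assms(3,4)] linear_iso_trans assms(1,2) by metis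

section \<open>Cosets and quotient records\<close>

context vector_space
begin

lemma coset_of_eq_iff:
  assumes "subspace B"
  shows "coset_of B x = coset_of B y \<longleftrightarrow> x - y \<in> B"
proof
  assume "coset_of B x = coset_of B y"
  moreover have "x \<in> coset_of B x" unfolding coset_of_def using subspace_0[OF assms] by force
  ultimately obtain b where "b \<in> B" "x = y + b" by (auto simp: coset_of_def)
  then show "x - y \<in> B" by simp
next
  assume xy: "x - y \<in> B"
  have "z \<in> coset_of B x \<longleftrightarrow> z - x \<in> B" for z x unfolding coset_of_def by (force simp: algebra_simps)
  moreover have "z - x \<in> B \<longleftrightarrow> z - y \<in> B" for z
    using subspace_add[OF assms, of "z - x" "x - y"] subspace_diff[OF assms, of "z - y" "x - y"] xy
    by auto
  ultimately show "coset_of B x = coset_of B y" by blast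
qed

lemma mem_coset_of: "z \<in> coset_of B x \<longleftrightarrow> z - x \<in> B"
  unfolding coset_of_def by (force simp: algebra_simps)

lemma coset_of_add:
  assumes "subspace B"
  shows "{a + b | a b. a \<in> coset_of B x \<and> b \<in> coset_of B y} = coset_of B (x + y)"
proof (intro Set.set_eqI iffI)
  fix z assume "z \<in> {a + b | a b. a \<in> coset_of B x \<and> b \<in> coset_of B y}"
  then obtain a b where z: "z = a + b" "a - x \<in> B" "b - y \<in> B" by (auto simp: mem_coset_of)
  have "z - (x + y) = (a - x) + (b - y)" using z by simp
  then show "z \<in> coset_of B (x + y)" unfolding mem_coset_of by (metis subspace_add[OF assms z(2,3)])
next
  fix z assume "z \<in> coset_of B (x + y)"
  then have "z - x \<in> coset_of B y" by (simp add: mem_coset_of algebra_simps)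
  moreover have "x \<in> coset_of B x" using subspace_0[OF assms] by (simp add: mem_coset_of)
  moreover have "z = x + (z - x)" by simp
  ultimately show "z \<in> {a + b | a b. a \<in> coset_of B x \<and> b \<in> coset_of B y}" by blast
qed

text \<open>Every \<open>z\<close> in the coset of \<open>x\<close> has \<open>f z\<close> congruent
  to \<open>f x\<close>, by near-additivity applied to \<open>x\<close> and \<open>z - x\<close>;
  the union defining \<open>induced\<close> then consists of copies of a single coset.\<close>

lemma induced_coset_of:
  assumes B: "subspace B" and f: "\<And>x y. f (x + y) - f x - f y \<in> B" "\<And>x. x \<in> B \<Longrightarrow> f x \<in> B"
  shows "induced B f (coset_of B x) = coset_of B (f x)"
proof -
  have "coset_of B (f z) = coset_of B (f x)" if "z \<in> coset_of B x" for z
  proof -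
    have "f z - f x = (f (x + (z - x)) - f x - f (z - x)) + f (z - x)" by simp
    also have "\<dots> \<in> B" using that by (intro subspace_add[OF B] f) (simp_all add: mem_coset_of)
    finally show ?thesis by (simp add: coset_of_eq_iff[OF B])
  qed
  moreover have "x \<in> coset_of B x" using subspace_0[OF B] by (simp add: mem_coset_of)
  ultimately show ?thesis unfolding induced_def by blast
qed

lemma quotient_module_simps:
  assumes "subspace B"
  shows "carrier (quotient_module scale Z B) = coset_of B ` Z"
    and "\<zero>\<^bsub>quotient_module scale Z B\<^esub> = B"
    and "coset_of B x \<oplus>\<^bsub>quotient_module scale Z B\<^esub> coset_of B y = coset_of B (x + y)"
    and "c \<odot>\<^bsub>quotient_module scale Z B\<^esub> coset_of B x = coset_of B (scale c x)"
proof -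
  show "coset_of B x \<oplus>\<^bsub>quotient_module scale Z B\<^esub> coset_of B y = coset_of B (x + y)"
    unfolding coset_of_add[OF assms, symmetric] by (simp add: quotient_module_def)
  show "c \<odot>\<^bsub>quotient_module scale Z B\<^esub> coset_of B x = coset_of B (scale c x)"
    unfolding quotient_module_def using assms
    by (simp add: induced_coset_of subspace_scale scale_right_distrib subspace_0)
qed (simp_all add: quotient_module_def)

end

text \<open>The common tool for presented spaces: \<open>T\<close> picks representatives, so
  linearity is asked only modulo \<open>B\<close>, and injectivity is tested at zero. Tensor
  products, exterior powers and cohomology are all put into coordinates by it.\<close>

lemma linear_iso_quotient:
  fixes s :: "'k::field \<Rightarrow> 'v \<Rightarrow> 'v::ab_group_add" and t :: "'k \<Rightarrow> 'y \<Rightarrow> 'y::ab_group_add"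
  assumes "vector_space s" "vector_space t"
    and Y: "module.subspace t Y" and B: "module.subspace s B"
    and TZ: "\<And>y. y \<in> Y \<Longrightarrow> T y \<in> Z"
    and add: "\<And>y y'. \<lbrakk>y \<in> Y; y' \<in> Y\<rbrakk> \<Longrightarrow> T (y + y') - T y - T y' \<in> B"
    and sc: "\<And>c y. y \<in> Y \<Longrightarrow> T (t c y) - s c (T y) \<in> B"
    and inj: "\<And>y. \<lbrakk>y \<in> Y; T y \<in> B\<rbrakk> \<Longrightarrow> y = 0"
    and surj: "\<And>z. z \<in> Z \<Longrightarrow> \<exists>y\<in>Y. z - T y \<in> B"
  shows "linear_iso (\<lambda>y. coset_of B (T y)) (subspace_module t Y) (quotient_module s Z B)"
proof -
  interpret S: vector_space s by fact
  interpret T: vector_space t by fact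
  note quot = S.quotient_module_simps[OF B]
  have eq: "coset_of B x = coset_of B y \<longleftrightarrow> x - y \<in> B" for x y by (rule S.coset_of_eq_iff[OF B])
  have "y = y'" if y: "y \<in> Y" "y' \<in> Y" and "coset_of B (T y) = coset_of B (T y')" for y y'
  proof -
    have d: "y - y' \<in> Y" using y by (rule T.subspace_diff[OF Y])
    have "T y - T y' \<in> B" using that eq by simp
    \<comment> \<open>Near-additivity for \<open>y - y'\<close> and \<open>y'\<close> turns the
      congruence of \<open>T y\<close> and \<open>T y'\<close> into
      \<open>T (y - y') \<in> B\<close>.\<close>
    moreover have "T ((y - y') + y') - T (y - y') - T y' \<in> B" using d y by (intro add)
    ultimately have "(T y - T y') - (T ((y - y') + y') - T (y - y') - T y') \<in> B"
      by (rule S.subspace_diff[OF B])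
    then have "T (y - y') \<in> B" by simp
    then show ?thesis using inj[OF d] by simp
  qed
  then have "bij_betw (\<lambda>y. coset_of B (T y)) Y (coset_of B ` Z)"
    using TZ surj by (auto simp: bij_betw_def inj_on_def image_iff eq)
  then show ?thesis
    using add sc by (simp add: linear_iso_iff quot eq) (simp add: algebra_simps)
qed

section \<open>Function spaces, free vector spaces and linear maps out of them\<close>

lemma vector_space_pointwise: "vector_space s \<Longrightarrow> vector_space (pointwise s)"
  unfolding vector_space_def pointwise_def by (auto simp: fun_eq_iff)

lemma vector_space_field: "vector_space ((*) :: 'k::field \<Rightarrow> 'k \<Rightarrow> 'k)"
  by unfold_locales (simp_all add: algebra_simps)

lemma lookup_fscale [simp]: "Poly_Mapping.lookup (fscale c p) x = c * Poly_Mapping.lookup p x"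
  unfolding fscale_def by (simp add: Poly_Mapping.map.rep_eq when_def)

lemma vector_space_fscale: "vector_space (fscale :: 'k::field \<Rightarrow> ('x \<Rightarrow>\<^sub>0 'k) \<Rightarrow> ('x \<Rightarrow>\<^sub>0 'k))"
  by unfold_locales (auto simp: poly_mapping_eq_iff fun_eq_iff lookup_add algebra_simps)

lemma subspace_free_on: "module.subspace fscale (free_on A)"
proof -
  interpret vector_space fscale by (rule vector_space_fscale)
  show ?thesis
    unfolding subspace_def free_on_def
    by (auto simp: in_keys_iff lookup_add subset_iff) (metis add.right_neutral)
qed

lemma fscale_single [simp]: "fscale c (Poly_Mapping.single x a) = Poly_Mapping.single x (c * a)"
  by (rule poly_mapping_eqI) (simp add: lookup_single when_def)

lemma single_in_free_on: "x \<in> A \<Longrightarrow> Poly_Mapping.single x c \<in> free_on A"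
  by (auto simp: free_on_def)

lemma poly_mapping_sum_single:
  "p = (\<Sum>x\<in>Poly_Mapping.keys p. Poly_Mapping.single x (Poly_Mapping.lookup p x))"
  by (rule poly_mapping_eqI)
     (simp add: lookup_sum lookup_single when_def sum.delta' in_keys_iff)

lemma free_on_induct [consumes 1, case_names zero add single]:
  assumes "p \<in> free_on A" "P 0" "\<And>p q. \<lbrakk>p \<in> free_on A; q \<in> free_on A; P p; P q\<rbrakk> \<Longrightarrow> P (p + q)"
    "\<And>x c. x \<in> A \<Longrightarrow> P (Poly_Mapping.single x c)"
  shows "P p"
proof -
  interpret vector_space fscale by (rule vector_space_fscale)
  have "finite K \<Longrightarrow> K \<subseteq> A \<Longrightarrow>
    (\<Sum>x\<in>K. Poly_Mapping.single x (Poly_Mapping.lookup p x)) \<in> free_on A \<and>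
    P (\<Sum>x\<in>K. Poly_Mapping.single x (Poly_Mapping.lookup p x))" for K
    by (induction K rule: finite_induct)
       (use assms in \<open>auto intro!: subspace_add[OF subspace_free_on] single_in_free_on
          simp: subspace_0[OF subspace_free_on]\<close>)
  from this[of "Poly_Mapping.keys p"] show ?thesis
    using assms(1) by (simp add: poly_mapping_sum_single[symmetric] free_on_def)
qed

text \<open>The linear map that the universal property of the free space attaches to a map
  \<open>F\<close> on basis elements.\<close>

definition extend_linear :: "('k::field \<Rightarrow> 'v \<Rightarrow> 'v) \<Rightarrow> ('x \<Rightarrow> 'v) \<Rightarrow> ('x \<Rightarrow>\<^sub>0 'k) \<Rightarrow> 'v::ab_group_add" where
  "extend_linear s F p = (\<Sum>x\<in>Poly_Mapping.keys p. s (Poly_Mapping.lookup p x) (F x))"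

context vector_space
begin

lemma extend_linear_superset:
  assumes "finite K" "Poly_Mapping.keys p \<subseteq> K"
  shows "extend_linear scale F p = (\<Sum>x\<in>K. scale (Poly_Mapping.lookup p x) (F x))"
  unfolding extend_linear_def using assms by (intro sum.mono_neutral_left) (auto simp: in_keys_iff)

lemma extend_linear_0 [simp]: "extend_linear scale F 0 = 0"
  by (simp add: extend_linear_def)

lemma extend_linear_add: "extend_linear scale F (p + q) = extend_linear scale F p + extend_linear scale F q"
proof -
  let ?K = "Poly_Mapping.keys p \<union> Poly_Mapping.keys q"
  have "Poly_Mapping.keys (p + q) \<subseteq> ?K" by (rule Poly_Mapping.keys_add)
  then show ?thesis
    by (simp add: extend_linear_superset[of ?K] lookup_add scale_left_distrib sum.distrib)
qed

lemma extend_linear_fscale: "extend_linear scale F (fscale c p) = scale c (extend_linear scale F p)"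
proof -
  have "Poly_Mapping.keys (fscale c p) \<subseteq> Poly_Mapping.keys p" by (auto simp: in_keys_iff)
  then show ?thesis
    by (simp add: extend_linear_superset[of "Poly_Mapping.keys p"] scale_sum_right)
qed

lemma extend_linear_single [simp]: "extend_linear scale F (Poly_Mapping.single x c) = scale c (F x)"
  by (simp add: extend_linear_superset[of "{x}"])

lemma extend_linear_diff: "extend_linear scale F (p - q) = extend_linear scale F p - extend_linear scale F q"
  using extend_linear_add[of F "p - q" q] by simp

text \<open>This is how a map out of a presented quotient is shown to be well defined: only the
  generating relations are checked.\<close>

lemma extend_linear_span_zero:
  assumes "\<And>p. p \<in> R \<Longrightarrow> extend_linear scale F p = 0" "p \<in> module.span fscale R"
  shows "extend_linear scale F p = 0"
proof -
  interpret F: vector_space fscale by (rule vector_space_fscale)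
  show ?thesis
    by (rule F.span_induct[OF assms(2), of "\<lambda>p. extend_linear scale F p = 0"])
       (auto simp: F.subspace_def extend_linear_add extend_linear_fscale assms(1))
qed

end

section \<open>Alternating cochains\<close>

lemma remove_nth_0 [simp]: "remove_nth 0 (x # xs) = xs"
  and remove_nth_Suc [simp]: "remove_nth (Suc i) (x # xs) = x # remove_nth i xs"
  by (simp_all add: remove_nth_def)

lemma length_remove_nth: "i < length xs \<Longrightarrow> length (remove_nth i xs) = length xs - 1"
  by (simp add: remove_nth_def)

lemma set_remove_nth: "set (remove_nth i xs) \<subseteq> set xs"
  by (auto simp: remove_nth_def dest: in_set_takeD in_set_dropD)

lemma tuples_Suc_iff: "xs \<in> tuples (Suc n) S \<longleftrightarrow> (\<exists>y ys. xs = y # ys \<and> y \<in> S \<and> ys \<in> tuples n S)"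
  by (cases xs) (auto simp: tuples_def)

lemma tuples_0 [simp]: "tuples 0 S = {[]}"
  by (auto simp: tuples_def)

lemma Cons_in_tuples [simp]: "x # xs \<in> tuples (Suc n) S \<longleftrightarrow> x \<in> S \<and> xs \<in> tuples n S"
  by (auto simp: tuples_def)

lemma Nil_notin_tuples [simp]: "[] \<notin> tuples (Suc n) S"
  by (auto simp: tuples_def)

lemma tuples_update: "\<lbrakk>xs \<in> tuples n S; x \<in> S\<rbrakk> \<Longrightarrow> xs[i := x] \<in> tuples n S"
  using set_update_subset_insert[of xs i x] by (auto simp: tuples_def)

lemma tuples_nth: "\<lbrakk>xs \<in> tuples n S; i < n\<rbrakk> \<Longrightarrow> xs ! i \<in> S"
  by (auto simp: tuples_def)

lemma tuples_remove_nth: "\<lbrakk>xs \<in> tuples (Suc n) S; i \<le> n\<rbrakk> \<Longrightarrow> remove_nth i xs \<in> tuples n S"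
  using set_remove_nth[of i xs] by (auto simp: tuples_def length_remove_nth)

text \<open>The contraction of \<open>F\<close> with \<open>x\<close>. Cochains are handled through their contractions, by
  induction on the degree; this replaces all index bookkeeping for the differential, except in the
  Cartan formula itself.\<close>

definition ins :: "'g \<Rightarrow> ('g list \<Rightarrow> 'm) \<Rightarrow> 'g list \<Rightarrow> 'm" where
  "ins x F ys = F (x # ys)"

lemma ins_add [simp]: "ins x (F + G) = ins x F + ins x G"
  and ins_diff [simp]: "ins x (F - G') = ins x F - ins x (G' :: _ \<Rightarrow> 'm :: ab_group_add)"
  and ins_0 [simp]: "ins x 0 = 0"
  and ins_pointwise [simp]: "ins x (pointwise t c F) = pointwise t c (ins x F)"
  by (simp_all add: ins_def fun_eq_iff pointwise_def)

context lie_module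
begin

sublocale W: vector_space "pointwise mscale :: 'k \<Rightarrow> ('g list \<Rightarrow> 'm) \<Rightarrow> 'g list \<Rightarrow> 'm"
  by (rule vector_space_pointwise) (rule M.vector_space_axioms)

abbreviation "C \<equiv> cochains scale mscale"
abbreviation "d \<equiv> differential bracket mscale act"
abbreviation "\<theta> \<equiv> cochain_action bracket act"

lemma subspace_C: "W.subspace (C S n)"
  unfolding W.subspace_def cochains_def
  by (auto simp: pointwise_def M.scale_right_distrib mult.commute)

lemmas C_add = W.subspace_add[OF subspace_C]
lemmas C_diff = W.subspace_diff[OF subspace_C]
lemmas C_scale = W.subspace_scale[OF subspace_C]
lemmas C_neg = W.subspace_neg[OF subspace_C]
lemmas C_zero = W.subspace_0[OF subspace_C]

lemma C_off: "\<lbrakk>F \<in> C S n; xs \<notin> tuples n S\<rbrakk> \<Longrightarrow> F xs = 0"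
  by (simp add: cochains_def)

lemma C_slot_add: "\<lbrakk>F \<in> C S n; xs \<in> tuples n S; i < n; x \<in> S; y \<in> S\<rbrakk>
    \<Longrightarrow> F (xs[i := x + y]) = F (xs[i := x]) + F (xs[i := y])"
  by (simp add: cochains_def)

lemma C_slot_scale: "\<lbrakk>F \<in> C S n; xs \<in> tuples n S; i < n; x \<in> S\<rbrakk>
    \<Longrightarrow> F (xs[i := scale c x]) = mscale c (F (xs[i := x]))"
  by (simp add: cochains_def)

lemma C_alt:
  assumes "F \<in> C S n" "xs \<in> tuples n S" "i < n" "j < n" "i \<noteq> j" "xs ! i = xs ! j"
  shows "F xs = 0"
proof -
  have "F xs = 0" if "a < b" "b < n" "xs ! a = xs ! b" for a b
    using assms(1,2) that unfolding cochains_def by blast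
  then show ?thesis using assms(3-6) by (metis linorder_neqE_nat)
qed

lemma C_0_iff: "F \<in> C S 0 \<longleftrightarrow> (\<forall>xs. xs \<noteq> [] \<longrightarrow> F xs = 0)"
  by (simp add: cochains_def)

text \<open>Polarisation: \<open>F\<close> vanishes with \<open>a + b\<close> in both slots, and
  expanding leaves only the two mixed terms. The converse fails in characteristic two, hence
  cochains are defined by vanishing on equal arguments.\<close>

lemma C_swap:
  assumes F: "F \<in> C S n" and xs: "xs \<in> tuples n S" and ij: "i < n" "j < n" "i \<noteq> j"
    and ab: "a \<in> S" "b \<in> S" and S: "subspace S"
  shows "F (xs[i := a, j := b]) = - F (xs[i := b, j := a])"
proof -
  let ?f = "\<lambda>x y. F (xs[i := x, j := y])"
  have len: "length xs = n" using xs by (simp add: tuples_def)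
  have upd: "xs[j := y] \<in> tuples n S" "xs[i := y] \<in> tuples n S"
    if "y \<in> S" for y using xs that by (auto intro: tuples_update)
  have s: "a + b \<in> S" using S ab by (rule subspace_add)
  have swap: "xs[i := x, j := y] = xs[j := y, i := x]" for x y using ij by (simp add: list_update_swap)
  have diag: "?f x x = 0" if "x \<in> S" for x
    by (rule C_alt[OF F _ ij]) (use ij len upd xs that in \<open>auto intro!: tuples_update\<close>)
  have add1: "?f (a + b) y = ?f a y + ?f b y" if "y \<in> S" for y
    unfolding swap using C_slot_add[OF F upd(1)[OF that] ij(1) ab] .
  have add2: "?f x (a + b) = ?f x a + ?f x b" if "x \<in> S" for x
    using C_slot_add[OF F upd(2)[OF that] ij(2) ab] .
  have "0 = ?f (a + b) (a + b)" using diag[OF s] by simp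
  also have "\<dots> = ?f a b + ?f b a" by (simp add: add1[OF s] add2[OF ab(1)] add2[OF ab(2)] diag ab)
  finally show ?thesis by (simp add: eq_neg_iff_add_eq_0)
qed

lemma C_swap_Cons:
  assumes F: "F \<in> C S (Suc (Suc n))" and S: "subspace S" and xy: "x \<in> S" "y \<in> S"
  shows "F (x # y # zs) = - F (y # x # zs)"
proof (cases "zs \<in> tuples n S")
  case True
  then show ?thesis using C_swap[OF F, of "x # y # zs" 0 1 x y] S xy by simp
next
  case False
  then show ?thesis using C_off[OF F] by simp
qed

lemma C_ins:
  assumes F: "F \<in> C S (Suc n)" and x: "x \<in> S"
  shows "ins x F \<in> C S n"
proof -
  have "F (x # ys[i := a + b]) = F (x # ys[i := a]) + F (x # ys[i := b])"
    if "ys \<in> tuples n S" "i < n" "a \<in> S" "b \<in> S" for ys i a b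
    using C_slot_add[OF F, of "x # ys" "Suc i" a b] that x by simp
  moreover have "F (x # ys[i := scale c a]) = mscale c (F (x # ys[i := a]))"
    if "ys \<in> tuples n S" "i < n" "a \<in> S" for ys i a c
    using C_slot_scale[OF F, of "x # ys" "Suc i" a c] that x by simp
  moreover have "F (x # ys) = 0" if "ys \<in> tuples n S" "i < j" "j < n" "ys ! i = ys ! j" for ys i j
    using C_alt[OF F, of "x # ys" "Suc i" "Suc j"] that x by simp
  moreover have "F (x # ys) = 0" if "ys \<notin> tuples n S" for ys
    using C_off[OF F, of "x # ys"] that by simp
  ultimately show ?thesis by (auto simp: cochains_def ins_def)
qed

lemma ins_linear:
  assumes F: "F \<in> C S (Suc n)"
  shows "\<lbrakk>x \<in> S; y \<in> S; subspace S\<rbrakk> \<Longrightarrow> ins (x + y) F = ins x F + ins y F"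
    and "\<lbrakk>x \<in> S; subspace S\<rbrakk> \<Longrightarrow> ins (scale c x) F = pointwise mscale c (ins x F)"
proof -
  have off: "F (z # ys) = 0" if "ys \<notin> tuples n S" for z ys using C_off[OF F] that by simp
  have "F ((x + y) # ys) = F (x # ys) + F (y # ys)" if "x \<in> S" "y \<in> S" "ys \<in> tuples n S" for x y ys
    using C_slot_add[OF F, of "x # ys" 0 x y] that by simp
  then show "\<lbrakk>x \<in> S; y \<in> S; subspace S\<rbrakk> \<Longrightarrow> ins (x + y) F = ins x F + ins y F"
    unfolding ins_def fun_eq_iff plus_fun_apply by (metis off add.right_neutral)
  have "F (scale c x # ys) = mscale c (F (x # ys))" if "x \<in> S" "ys \<in> tuples n S" for x ys
    using C_slot_scale[OF F, of "x # ys" 0 x c] that by simp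
  then show "\<lbrakk>x \<in> S; subspace S\<rbrakk> \<Longrightarrow> ins (scale c x) F = pointwise mscale c (ins x F)"
    unfolding ins_def fun_eq_iff pointwise_def by (metis off M.scale_zero_right)
qed

lemma ins_ins_swap:
  assumes "F \<in> C S (Suc (Suc n))" "subspace S" "x \<in> S" "y \<in> S"
  shows "ins x (ins y F) = - ins y (ins x F)"
  by (rule ext) (simp add: ins_def C_swap_Cons[OF assms(1,2,4,3)])

lemma ins_ins_self:
  assumes "F \<in> C S (Suc n)" "x \<in> S"
  shows "ins x (ins x F) = 0"
proof
  fix zs
  show "ins x (ins x F) zs = 0 zs"
  proof (cases "x # x # zs \<in> tuples (Suc n) S")
    case True
    then obtain m where "n = Suc m" by (cases n) (auto simp: tuples_def)
    then show ?thesis using C_alt[OF assms(1) True, of 0 1] by (simp add: ins_def)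
  next
    case False
    then show ?thesis using C_off[OF assms(1)] by (simp add: ins_def)
  qed
qed

lemma ins_diff_left:
  assumes "F \<in> C S (Suc n)" "subspace S" "x \<in> S" "y \<in> S"
  shows "ins (x - y) F = ins x F - ins y F"
  using ins_linear(1)[OF assms(1), of "x - y" y] assms subspace_diff[of S x y]
    by (simp add: algebra_simps)

lemma ins_zero_left:
  assumes "F \<in> C S (Suc n)" "subspace S"
  shows "ins 0 F = 0"
  using ins_diff_left[OF assms, of 0 0] subspace_0[OF assms(2)] by simp

text \<open>The recognition principle behind the inductions on the degree: alternation of
  \<open>F\<close> follows from alternation of its contractions together with
  \<open>\<iota>_x \<iota>_x F = 0\<close>.\<close>

lemma C_SucI:
  assumes S: "subspace S"
    and ins: "\<And>x. x \<in> S \<Longrightarrow> ins x F \<in> C S n"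
    and add: "\<And>x y. \<lbrakk>x \<in> S; y \<in> S\<rbrakk> \<Longrightarrow> ins (x + y) F = ins x F + ins y F"
    and sc: "\<And>c x. x \<in> S \<Longrightarrow> ins (scale c x) F = pointwise mscale c (ins x F)"
    and self: "\<And>x. x \<in> S \<Longrightarrow> ins x (ins x F) = 0"
    and off: "F [] = 0" "\<And>x. x \<notin> S \<Longrightarrow> ins x F = 0"
  shows "F \<in> C S (Suc n)"
proof -
  have insD: "F (x # ys) = ins x F ys" for x ys by (simp add: ins_def)
  have "F (xs[i := x + y]) = F (xs[i := x]) + F (xs[i := y])"
    if xs: "xs \<in> tuples (Suc n) S" "i < Suc n" and x: "x \<in> S" "y \<in> S" for xs i x y
  proof -
    obtain z zs where z: "xs = z # zs" "z \<in> S" "zs \<in> tuples n S" using xs by (auto simp: tuples_Suc_iff)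
    show ?thesis
      by (cases i) (use z xs x add C_slot_add[OF ins] in \<open>auto simp: insD\<close>)
  qed
  moreover have "F (xs[i := scale c x]) = mscale c (F (xs[i := x]))"
    if xs: "xs \<in> tuples (Suc n) S" "i < Suc n" and x: "x \<in> S" for xs i x c
  proof -
    obtain z zs where z: "xs = z # zs" "z \<in> S" "zs \<in> tuples n S" using xs by (auto simp: tuples_Suc_iff)
    show ?thesis
      by (cases i) (use z xs x sc C_slot_scale[OF ins] in \<open>auto simp: insD pointwise_def\<close>)
  qed
  moreover have "F xs = 0"
    if xs: "xs \<in> tuples (Suc n) S" and ij: "i < j" "j < Suc n" "xs ! i = xs ! j" for xs i j
  proof -
    obtain z zs where z: "xs = z # zs" "z \<in> S" "zs \<in> tuples n S" using xs by (auto simp: tuples_Suc_iff)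
    obtain j' where j': "j = Suc j'" "j' < n" using ij by (cases j) auto
    show ?thesis
    proof (cases i)
      case (Suc i')
      then have "ins z F zs = 0" using ij z j' by (intro C_alt[OF ins, of z zs i' j']) auto
      then show ?thesis using z by (simp add: insD)
    next
      case 0
      obtain u us where u: "zs = u # us" "u \<in> S" using j' z by (cases zs) (auto simp: tuples_def)
      have zu: "zs ! j' = z" using ij 0 z j' by simp
      have self': "F (z # z # ws) = 0"
        for ws using fun_cong[OF self[OF z(2)], of ws] by (simp add: ins_def)
      show ?thesis
      proof (cases j')
        case 0
        then show ?thesis using zu u z self' by simp
      next
        \<comment> \<open>The head \<open>z\<close> reappears at position \<open>j'\<close> of the
          tail. Antisymmetry of \<open>ins z F\<close> moves that copy to the front of the tail,
          where \<open>\<iota>_z \<iota>_z F = 0\<close> applies.\<close>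
        case (Suc k)
        have "ins z F (zs[0 := u, j' := z]) = - ins z F (zs[0 := z, j' := u])"
          using z u j' Suc by (intro C_swap[OF ins]) (auto simp: S)
        moreover have "zs[0 := u, j' := z] = zs"
          using u(1) list_update_id[of zs j'] unfolding zu by simp
        moreover have "ins z F (zs[0 := z, j' := u]) = 0" using u Suc self' by (simp add: ins_def)
        ultimately have "ins z F zs = 0" by simp
        then show ?thesis using z(1) by (simp add: ins_def)
      qed
    qed
  qed
  moreover have "F xs = 0" if "xs \<notin> tuples (Suc n) S" for xs
  proof (cases xs)
    case (Cons a ys)
    then show ?thesis using that off C_off[OF ins] by (cases "a \<in> S") (auto simp: insD)
  qed (use off in simp)
  ultimately show ?thesis unfolding cochains_def by blast
qed

text \<open>Carrying \<open>z\<close> from the front into slot \<open>j\<close> passes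
  \<open>j\<close> entries. In the Cartan formula this returns the bracket terms of the differential
  to the slots that the action modifies.\<close>

lemma C_move:
  assumes "F \<in> C S n" "xs \<in> tuples n S" "j < n" "z \<in> S" "subspace S"
  shows "F (z # remove_nth j xs) = mscale ((- 1) ^ j) (F (xs[j := z]))"
  using assms
proof (induction j arbitrary: F n xs)
  case 0
  then show ?case by (cases xs) (auto simp: tuples_def)
next
  case (Suc j)
  obtain k where k: "n = Suc k" using Suc.prems(3) by (cases n) simp_all
  obtain m where "k = Suc m" using Suc.prems(3) k by (cases k) simp_all
  with k have n: "n = Suc (Suc m)" by simp
  obtain x ys where xs: "xs = x # ys" "x \<in> S" "ys \<in> tuples (Suc m) S"
    using Suc.prems(2) unfolding n tuples_Suc_iff[of xs] by blast
  have "F (z # remove_nth (Suc j) xs) = - ins x F (z # remove_nth j ys)"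
    using C_swap_Cons[of F S m z x] Suc.prems n xs by (simp add: ins_def)
  also have "\<dots> = - mscale ((- 1) ^ j) (ins x F (ys[j := z]))"
    using Suc.IH[of "ins x F" "Suc m" ys] C_ins[of F S "Suc m" x] Suc.prems xs n by simp
  finally show ?case using xs by (simp add: ins_def)
qed

end

section \<open>Cartan calculus\<close>

context lie_module
begin

lemma bracket_skew: "bracket y x = - bracket x y"
proof -
  have "0 = bracket (x + y) (x + y)" by (rule bracket_self[symmetric])
  also have "\<dots> = bracket x y + bracket y x"
    unfolding bracket_add_left bracket_add_right by (simp add: bracket_self)
  finally show ?thesis by (simp add: eq_neg_iff_add_eq_0 add.commute)
qed

lemma bracket_jacobi: "bracket (bracket h x) y = bracket h (bracket x y) - bracket x (bracket h y)"
proof -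
  have "bracket h (bracket x y) + bracket x (bracket y h) + bracket y (bracket h x) = 0"
    by (rule jacobi)
  moreover have "bracket x (bracket y h) = - bracket x (bracket h y)"
    by (metis bracket_skew bracket_scale_right scale_minus_left scale_one)
  moreover have "bracket y (bracket h x) = - bracket (bracket h x) y" by (rule bracket_skew)
  ultimately show ?thesis by (simp add: algebra_simps)
qed

lemma bracket_0 [simp]: "bracket 0 x = 0" "bracket x 0 = 0"
  using bracket_add_left[of 0 0 x] bracket_add_right[of x 0 0] by simp_all

lemma act_0 [simp]: "act 0 m = 0" "act x 0 = 0"
  using act_add_left[of 0 0 m] act_add_right[of x 0 0] by simp_all

lemma lie_subalgebraD:
  assumes "lie_subalgebra S"
  shows "subspace S" "\<And>x y. \<lbrakk>x \<in> S; y \<in> S\<rbrakk> \<Longrightarrow> bracket x y \<in> S"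
  using assms by (auto simp: lie_subalgebra_def)

lemma \<theta>_add: "\<theta> S n h (F + G) = \<theta> S n h F + \<theta> S n h G"
  by (rule ext) (simp add: cochain_action_def act_add_right sum.distrib)

lemma \<theta>_scale: "\<theta> S n h (pointwise mscale c F) = pointwise mscale c (\<theta> S n h F)"
  by (rule ext)
     (simp add: cochain_action_def act_scale_right pointwise_def M.scale_right_diff_distrib M.scale_sum_right)

lemma \<theta>_0 [simp]: "\<theta> S n h 0 = 0"
  using \<theta>_add[of S n h 0 0] by simp

lemma \<theta>_diff: "\<theta> S n h (F - G) = \<theta> S n h F - \<theta> S n h G"
  using \<theta>_add[of S n h "F - G" G] by simp

lemma d_add: "d S n (F + G) = d S n F + d S n G"
  by (rule ext)
     (simp add: differential_def act_add_right M.scale_right_distrib sum.distrib algebra_simps)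

lemma d_scale: "d S n (pointwise mscale c F) = pointwise mscale c (d S n F)"
  by (rule ext)
     (simp add: differential_def act_scale_right pointwise_def M.scale_right_distrib M.scale_sum_right
       mult.commute)

lemma d_0 [simp]: "d S n 0 = 0"
  using d_add[of S n 0 0] by simp

lemma d_diff: "d S n (F - G) = d S n F - d S n G"
  using d_add[of S n "F - G" G] by simp

text \<open>The relation \<open>\<theta>_h \<iota>_x - \<iota>_x \<theta>_h = \<iota>_[h,x]\<close>:
  the last term is the summand of the action that modifies the first argument. As \<open>h\<close>
  may lie outside \<open>S\<close>, it also governs the action of \<open>\<hh>\<close> on cochains
  of \<open>\<kk>\<close>.\<close>

lemma ins_\<theta>:
  assumes F: "F \<in> C S (Suc n)" and x: "x \<in> S"
  shows "ins x (\<theta> S (Suc n) h F) = \<theta> S n h (ins x F) - ins (bracket h x) F"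
proof
  fix ys
  show "ins x (\<theta> S (Suc n) h F) ys = (\<theta> S n h (ins x F) - ins (bracket h x) F) ys"
  proof (cases "ys \<in> tuples n S")
    case True
    then show ?thesis using x
      by (simp add: ins_def cochain_action_def sum.lessThan_Suc_shift del: sum.lessThan_Suc)
  next
    case False
    then show ?thesis using C_off[OF F] by (simp add: ins_def cochain_action_def)
  qed
qed

lemma \<theta>_notin: "xs \<notin> tuples n S \<Longrightarrow> \<theta> S n h F xs = 0"
  by (simp add: cochain_action_def)

lemma \<theta>_C:
  assumes S: "subspace S" and h: "\<And>x. x \<in> S \<Longrightarrow> bracket h x \<in> S"
  shows "F \<in> C S n \<Longrightarrow> \<theta> S n h F \<in> C S n"
proof (induction n arbitrary: F)
  case 0
  then show ?case by (simp add: C_0_iff cochain_action_def)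
next
  case (Suc n)
  note F = Suc.prems
  show ?case
  proof (rule C_SucI[OF S])
    fix x y c assume x: "x \<in> S"
    show "ins x (\<theta> S (Suc n) h F) \<in> C S n"
      unfolding ins_\<theta>[OF F x] by (intro C_diff Suc.IH C_ins[OF F] x h)
    show "ins (scale c x) (\<theta> S (Suc n) h F) = pointwise mscale c (ins x (\<theta> S (Suc n) h F))"
      using x by (simp add: ins_\<theta>[OF F] subspace_scale[OF S] ins_linear[OF F] S h bracket_scale_right
          \<theta>_scale W.scale_right_diff_distrib)
    assume y: "y \<in> S"
    show "ins (x + y) (\<theta> S (Suc n) h F) = ins x (\<theta> S (Suc n) h F) + ins y (\<theta> S (Suc n) h F)"
      using x y by (simp add: ins_\<theta>[OF F] subspace_add[OF S] ins_linear[OF F] S h bracket_add_right \<theta>_add)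
  next
    fix x assume x: "x \<in> S"
    show "ins x (ins x (\<theta> S (Suc n) h F)) = 0"
    proof (cases n)
      case 0
      then have "ins x (\<theta> S (Suc n) h F) \<in> C S 0"
        unfolding ins_\<theta>[OF F x] using C_diff Suc.IH C_ins[OF F] x h by metis
      then show ?thesis by (auto simp: C_0_iff ins_def)
    next
      case (Suc m)
      have xF: "ins x F \<in> C S (Suc m)" using C_ins[OF F x] Suc by simp
      \<comment> \<open>Commuting both contractions past \<open>\<theta>_h\<close> leaves
        \<open>\<iota>_x\<close> and \<open>\<iota>_[h,x]\<close> in both orders; these cancel
        because contractions anticommute.\<close>
      have "ins x (ins x (\<theta> S (Suc n) h F))
          = - ins (bracket h x) (ins x F) - ins x (ins (bracket h x) F)"
        unfolding ins_\<theta>[OF F x] using ins_\<theta>[OF xF x] by (simp add: Suc ins_ins_self[OF F x])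
      also have "\<dots> = 0" using ins_ins_swap[of F S m x "bracket h x"] F S x h Suc by simp
      finally show ?thesis .
    qed
  qed (auto simp: cochain_action_def ins_def)
qed

text \<open>In degree zero this is the module axiom. Above it, contraction with \<open>y\<close>
  adds only terms in \<open>[h,[k,y]]\<close> and \<open>[k,[h,y]]\<close>, which the Jacobi
  identity combines.\<close>

lemma \<theta>_commutator:
  assumes S: "subspace S" and h: "\<And>x. x \<in> S \<Longrightarrow> bracket h x \<in> S" and k: "\<And>x. x \<in> S \<Longrightarrow> bracket k x \<in> S"
  shows "F \<in> C S n \<Longrightarrow> \<theta> S n h (\<theta> S n k F) - \<theta> S n k (\<theta> S n h F) = \<theta> S n (bracket h k) F"
proof (induction n arbitrary: F)
  case 0
  then show ?case by (intro ext) (simp add: cochain_action_def act_bracket)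
next
  case (Suc n)
  note F = Suc.prems
  have hF: "\<theta> S (Suc n) h F \<in> C S (Suc n)" by (rule \<theta>_C[OF S h F])
  have kF: "\<theta> S (Suc n) k F \<in> C S (Suc n)" by (rule \<theta>_C[OF S k F])
  show ?case
  proof
    fix xs
    show "(\<theta> S (Suc n) h (\<theta> S (Suc n) k F) - \<theta> S (Suc n) k (\<theta> S (Suc n) h F)) xs
      = \<theta> S (Suc n) (bracket h k) F xs"
    proof (cases "xs \<in> tuples (Suc n) S")
      case True
      then obtain y ys where xs: "xs = y # ys" "y \<in> S" by (auto simp: tuples_Suc_iff)
      note y = \<open>y \<in> S\<close>
      have "ins y (\<theta> S (Suc n) h (\<theta> S (Suc n) k F) - \<theta> S (Suc n) k (\<theta> S (Suc n) h F))
        = (\<theta> S n h (\<theta> S n k (ins y F)) - \<theta> S n k (\<theta> S n h (ins y F)))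
          - (ins (bracket h (bracket k y)) F - ins (bracket k (bracket h y)) F)"
        using y by (simp add: ins_\<theta>[OF hF] ins_\<theta>[OF kF] ins_\<theta>[OF F] h k \<theta>_diff)
      also have "\<dots> = \<theta> S n (bracket h k) (ins y F) - ins (bracket (bracket h k) y) F"
        using y by (simp add: Suc.IH C_ins[OF F] bracket_jacobi ins_diff_left[OF F S] h k)
      also have "\<dots> = ins y (\<theta> S (Suc n) (bracket h k) F)" by (simp add: ins_\<theta>[OF F y])
      finally show ?thesis unfolding xs ins_def by (rule fun_cong)
    qed (simp add: \<theta>_notin)
  qed
qed

lemma d_notin: "xs \<notin> tuples (Suc n) S \<Longrightarrow> d S n F xs = 0"
  by (simp add: differential_def)

lemma ins_d_0:
  assumes F: "F \<in> C S 0" and x: "x \<in> S"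
  shows "ins x (d S 0 F) = \<theta> S 0 x F"
  using assms by (auto simp: fun_eq_iff ins_def differential_def cochain_action_def)

text \<open>The Cartan formula. The terms of \<open>d F\<close> that involve \<open>x\<close>, by
  acting or in a bracket, form \<open>\<theta>_x F\<close>. The others form
  \<open>- d (\<iota>_x F)\<close>: action terms change sign by the shift of indices, bracket terms
  by moving \<open>x\<close> to the front.\<close>

lemma ins_d:
  assumes S: "lie_subalgebra S" and F: "F \<in> C S (Suc m)" and x: "x \<in> S"
  shows "ins x (d S (Suc m) F) = \<theta> S (Suc m) x F - d S m (ins x F)"
proof
  fix ys
  note sub = lie_subalgebraD[OF S]
  let ?t = "\<lambda>i. mscale ((- 1) ^ i)"
  show "ins x (d S (Suc m) F) ys = (\<theta> S (Suc m) x F - d S m (ins x F)) ys"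
  proof (cases "ys \<in> tuples (Suc m) S")
    case ys: True
    \<comment> \<open>\<open>x\<close> has index 0 and \<open>ys ! j\<close> index
      \<open>j + 1\<close>, so the sign is \<open>(-1)^(j+1)\<close>; moving the bracket into slot
      \<open>j\<close> contributes \<open>(-1)^j\<close>.\<close>
    have "?t (Suc j) (F (bracket x (ys ! j) # remove_nth j ys)) = - F (ys[j := bracket x (ys ! j)])"
      if "j \<le> m" for j
      using C_move[OF F ys, of j "bracket x (ys ! j)"] that sub x tuples_nth[OF ys]
      by (simp flip: power_mult_distrib)
    then have mv: "(\<Sum>j\<le>m. ?t (Suc j) (F (bracket x (ys ! j) # remove_nth j ys)))
        = - (\<Sum>j<Suc m. F (ys[j := bracket x (ys ! j)]))"
      unfolding lessThan_Suc_atMost by (simp add: sum_negf)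
    \<comment> \<open>Both indices are shifted by one, so the parity is unchanged; the minus sign
      comes from exchanging the bracket with \<open>x\<close>. As \<open>i < j \<le> m\<close>
      excludes \<open>m = 0\<close>, the subtraction in \<open>m - 1\<close> is exact.\<close>
    have br: "?t (Suc i + Suc j) (F (bracket (ys ! i) (ys ! j) # x # zs))
        = - ?t (i + j) (F (x # bracket (ys ! i) (ys ! j) # zs))" if "i < j" "j \<le> m" for i j zs
      using C_swap_Cons[of F S "m - 1" "bracket (ys ! i) (ys ! j)" x zs] that sub x F tuples_nth[OF ys]
      by (cases m) simp_all
    have "d S (Suc m) F (x # ys) =
      act x (F ys) + (\<Sum>i\<le>m. ?t (Suc i) (act (ys ! i) (F (x # remove_nth i ys)))) +
      (\<Sum>j\<le>m. ?t (Suc j) (F (bracket x (ys ! j) # remove_nth j ys)) +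
         (\<Sum>i<j. ?t (Suc i + Suc j) (F (bracket (ys ! i) (ys ! j) # x # remove_nth i (remove_nth j ys)))))"
      using ys x by (simp add: differential_def sum.atMost_Suc_shift sum.lessThan_Suc_shift
          del: sum.lessThan_Suc sum.atMost_Suc)
    also have "\<dots> = act x (F ys) - (\<Sum>j<Suc m. F (ys[j := bracket x (ys ! j)]))
      - ((\<Sum>i\<le>m. ?t i (act (ys ! i) (F (x # remove_nth i ys))))
      + (\<Sum>j\<le>m. \<Sum>i<j. ?t (i + j) (F (x # bracket (ys ! i) (ys ! j) # remove_nth i (remove_nth j ys)))))"
    proof -
      have "(\<Sum>j\<le>m. \<Sum>i<j. ?t (Suc i + Suc j) (F (bracket (ys ! i) (ys ! j) #
          x # remove_nth i (remove_nth j ys))))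
        = - (\<Sum>j\<le>m. \<Sum>i<j. ?t (i + j) (F (x # bracket (ys ! i) (ys ! j) # remove_nth i (remove_nth j ys))))"
        unfolding sum_negf[symmetric] by (intro sum.cong refl) (use br in simp)
      moreover have "(\<Sum>i\<le>m. ?t (Suc i) (act (ys ! i) (F (x # remove_nth i ys))))
        = - (\<Sum>i\<le>m. ?t i (act (ys ! i) (F (x # remove_nth i ys))))"
        by (simp add: sum_negf)
      ultimately show ?thesis unfolding sum.distrib mv by (simp add: algebra_simps)
    qed
    finally show ?thesis using ys x
      by (simp add: ins_def cochain_action_def differential_def del: sum.lessThan_Suc sum.atMost_Suc)
  next
    case False
    then show ?thesis by (simp add: ins_def cochain_action_def differential_def)
  qed
qed

lemma ins_d_normalized:
  assumes "lie_subalgebra S" "F \<in> C S n" "x \<in> S"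
  shows "ins x (d S n F) = \<theta> S n x F - (if n = 0 then 0 else d S (n - 1) (ins x F))"
  using ins_d_0 ins_d assms by (cases n) auto

lemma \<theta>_linear_left:
  assumes S: "subspace S" and F: "F \<in> C S n" and h: "\<And>x. x \<in> S \<Longrightarrow> bracket h x \<in> S" and k: "\<And>x. x \<in> S
      \<Longrightarrow> bracket k x \<in> S"
  shows "\<theta> S n (h + k) F = \<theta> S n h F + \<theta> S n k F" (is ?A)
    and "\<theta> S n (scale c h) F = pointwise mscale c (\<theta> S n h F)" (is ?B)
proof -
  have slot: "F (xs[i := bracket (h + k) (xs ! i)]) = F (xs[i := bracket h (xs ! i)])
      + F (xs[i := bracket k (xs ! i)])"
      "F (xs[i := bracket (scale c h) (xs ! i)]) = mscale c (F (xs[i := bracket h (xs ! i)]))"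
    if "xs \<in> tuples n S" "i < n" for xs i
    using that h k tuples_nth[OF that] C_slot_add[OF F that] C_slot_scale[OF F that]
    by (simp_all add: bracket_add_left bracket_scale_left)
  have "\<theta> S n (h + k) F xs = (\<theta> S n h F + \<theta> S n k F) xs" for xs
    by (cases "xs \<in> tuples n S") (simp_all add: cochain_action_def act_add_left slot sum.distrib)
  then show ?A by blast
  have "\<theta> S n (scale c h) F xs = pointwise mscale c (\<theta> S n h F) xs" for xs
    by (cases "xs \<in> tuples n S")
       (simp_all add: cochain_action_def act_scale_left slot pointwise_def M.scale_sum_right
           M.scale_right_diff_distrib)
  then show ?B by blast
qed

text \<open>By the Cartan formula the contractions of \<open>d F\<close> are
  \<open>\<theta>_x F - d (\<iota>_x F)\<close>, a cochain by induction; the explicit sum is never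
  examined under permutations.\<close>

lemma d_C:
  assumes S: "lie_subalgebra S"
  shows "F \<in> C S n \<Longrightarrow> d S n F \<in> C S (Suc n)"
proof (induction n arbitrary: F)
  case 0
  note sub = lie_subalgebraD[OF S]
  note F = 0
  note lin = \<theta>_linear_left[OF sub(1) F sub(2) sub(2)]
  show ?case
  proof (rule C_SucI[OF sub(1)])
    fix x assume "x \<in> S"
    then have "ins x (d S 0 F) \<in> C S 0" using ins_d_0[OF F] \<theta>_C[OF sub(1) sub(2) F] by simp
    then show "ins x (d S 0 F) \<in> C S 0" "ins x (ins x (d S 0 F)) = 0" by (auto simp: C_0_iff ins_def)
  qed (use sub lin in \<open>auto simp: ins_d_0[OF F] subspace_add subspace_scale, auto simp: ins_def
      differential_def\<close>)
next
  case (Suc n)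
  note sub = lie_subalgebraD[OF S]
  note F = Suc.prems
  note lin = \<theta>_linear_left[OF sub(1) F sub(2) sub(2)]
  note insd = ins_d[OF S F]
  show ?case
  proof (rule C_SucI[OF sub(1)])
    fix x assume x: "x \<in> S"
    show "ins x (d S (Suc n) F) \<in> C S (Suc n)"
      unfolding insd[OF x] by (intro C_diff \<theta>_C[OF sub(1) sub(2) F] Suc.IH C_ins[OF F] x)
    have xF: "ins x F \<in> C S n" by (rule C_ins[OF F x])
    \<comment> \<open>Contraction with \<open>x\<close> commutes with \<open>\<theta>_x\<close>
      because \<open>[x,x] = 0\<close>; a second use of the Cartan formula leaves only
      \<open>d (\<iota>_x \<iota>_x F)\<close>.\<close>
    have "ins x (ins x (d S (Suc n) F)) = \<theta> S n x (ins x F) - ins x (d S n (ins x F))"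
      using ins_\<theta>[OF F x, of x] by (simp add: insd[OF x] bracket_self ins_zero_left[OF F sub(1)])
    also have "\<dots> = (if n = 0 then 0 else d S (n - 1) (ins x (ins x F)))"
      using ins_d_normalized[OF S xF x] by simp
    finally show "ins x (ins x (d S (Suc n) F)) = 0" by (simp add: ins_ins_self[OF F x])
  next
    fix x y assume "x \<in> S" "y \<in> S"
    then show "ins (x + y) (d S (Suc n) F) = ins x (d S (Suc n) F) + ins y (d S (Suc n) F)"
      by (simp add: insd lin subspace_add[OF sub(1)] ins_linear[OF F] sub(1) d_add)
  next
    fix c x assume "x \<in> S"
    then show "ins (scale c x) (d S (Suc n) F) = pointwise mscale c (ins x (d S (Suc n) F))"
      by (simp add: insd lin subspace_scale[OF sub(1)] ins_linear[OF F] sub(1) d_scale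
        W.scale_right_diff_distrib)
  qed (auto simp: ins_def differential_def)
qed

text \<open>Both sides have the same contractions: the Cartan formula turns the claim into the
  commutator identity for \<open>\<theta>\<close> and the same claim one degree lower.\<close>

lemma \<theta>_d_commute:
  assumes S: "lie_subalgebra S" and h: "\<And>x. x \<in> S \<Longrightarrow> bracket h x \<in> S"
  shows "F \<in> C S n \<Longrightarrow> \<theta> S (Suc n) h (d S n F) = d S n (\<theta> S n h F)"
proof (induction n arbitrary: F)
  case 0
  note sub = lie_subalgebraD[OF S]
  note F = 0
  have hF: "\<theta> S 0 h F \<in> C S 0" by (rule \<theta>_C[OF sub(1) h F])
  have dF: "d S 0 F \<in> C S (Suc 0)" by (rule d_C[OF S F])
  have "ins x (\<theta> S (Suc 0) h (d S 0 F)) = ins x (d S 0 (\<theta> S 0 h F))" if x: "x \<in> S" for x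
    using \<theta>_commutator[OF sub(1) h sub(2)[OF x] F] h[OF x]
    by (simp add: ins_\<theta>[OF dF x] ins_d_0[OF F] ins_d_0[OF hF] x algebra_simps)
  then have "\<theta> S (Suc 0) h (d S 0 F) xs = d S 0 (\<theta> S 0 h F) xs" for xs
    by (cases xs) (auto simp: \<theta>_notin d_notin ins_def fun_eq_iff, metis \<theta>_notin d_notin Cons_in_tuples)
  then show ?case by blast
next
  case (Suc n)
  note sub = lie_subalgebraD[OF S]
  note F = Suc.prems
  have hF: "\<theta> S (Suc n) h F \<in> C S (Suc n)" by (rule \<theta>_C[OF sub(1) h F])
  have dF: "d S (Suc n) F \<in> C S (Suc (Suc n))" by (rule d_C[OF S F])
  have "ins x (\<theta> S (Suc (Suc n)) h (d S (Suc n) F)) = ins x (d S (Suc n) (\<theta> S (Suc n) h F))"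
    if x: "x \<in> S" for x
  proof -
    have "ins x (\<theta> S (Suc (Suc n)) h (d S (Suc n) F))
      = (\<theta> S (Suc n) h (\<theta> S (Suc n) x F) - \<theta> S (Suc n) (bracket h x) F)
        - \<theta> S (Suc n) h (d S n (ins x F)) + d S n (ins (bracket h x) F)"
      using h[OF x] by (simp add: ins_\<theta>[OF dF x] ins_d[OF S F] x \<theta>_diff)
    also have "\<dots> = \<theta> S (Suc n) x (\<theta> S (Suc n) h F) - d S n (\<theta> S n h (ins x F)) + d S n (ins (bracket h x) F)"
      using \<theta>_commutator[OF sub(1) h sub(2)[OF x] F]
        by (simp add: Suc.IH[OF C_ins[OF F x]] algebra_simps)
    also have "\<dots> = ins x (d S (Suc n) (\<theta> S (Suc n) h F))"
      by (simp add: ins_d[OF S hF x] ins_\<theta>[OF F x] d_diff)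
    finally show ?thesis .
  qed
  then have "\<theta> S (Suc (Suc n)) h (d S (Suc n) F) xs = d S (Suc n) (\<theta> S (Suc n) h F) xs" for xs
    by (cases xs) (auto simp: \<theta>_notin d_notin ins_def fun_eq_iff, metis \<theta>_notin d_notin Cons_in_tuples)
  then show ?case by blast
qed

end

section \<open>Splitting off an Abelian complement\<close>

definition restr :: "'x set \<Rightarrow> nat \<Rightarrow> ('x list \<Rightarrow> 'm) \<Rightarrow> 'x list \<Rightarrow> 'm::zero" where
  "restr S n F xs = (if xs \<in> tuples n S then F xs else 0)"

lemma tuples_mono: "S \<subseteq> S' \<Longrightarrow> tuples n S \<subseteq> tuples n S'"
  by (auto simp: tuples_def)

context lie_module
begin

lemma ins_C_0: "F \<in> C S 0 \<Longrightarrow> ins x F = 0"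
  by (auto simp: C_0_iff ins_def)

lemma ins_add_left:
  assumes "F \<in> C S n" "subspace S" "x \<in> S" "y \<in> S"
  shows "ins (x + y) F = ins x F + ins y F"
  using ins_linear(1) assms by (cases n) (auto simp: ins_C_0)

lemma ins_scale_left:
  assumes "F \<in> C S n" "subspace S" "x \<in> S"
  shows "ins (scale c x) F = pointwise mscale c (ins x F)"
  using ins_linear(2) assms by (cases n) (auto simp: ins_C_0 W.scale_zero_right)

lemma ins_twice:
  assumes "F \<in> C S n" "x \<in> S"
  shows "ins x (ins x F) = 0"
  using ins_ins_self assms by (cases n) (auto simp: ins_C_0)

lemma restr_C:
  assumes "S \<subseteq> S'" and F: "F \<in> C S' n" and S: "subspace S"
  shows "restr S n F \<in> C S n"
proof -
  have sub: "xs \<in> tuples n S'" if "xs \<in> tuples n S" for xs using that tuples_mono[OF assms(1)] by blast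
  have "restr S n F xs = 0" if "xs \<in> tuples n S" "i < j" "j < n" "xs ! i = xs ! j" for xs i j
    using C_alt[OF F sub[OF that(1)], of i j] that by (simp add: restr_def)
  then show ?thesis
    unfolding cochains_def using C_slot_add[OF F sub] C_slot_scale[OF F sub] assms(1)
    by (auto simp: restr_def tuples_update subset_iff subspace_add[OF S] subspace_scale[OF S])
qed

lemma restr_d:
  assumes S: "lie_subalgebra S" and sub: "S \<subseteq> S'"
  shows "restr S (Suc n) (d S' n F) = d S n (restr S n F)"
proof
  fix xs
  show "restr S (Suc n) (d S' n F) xs = d S n (restr S n F) xs"
  proof (cases "xs \<in> tuples (Suc n) S")
    case True
    then have T: "xs \<in> tuples (Suc n) S'" using tuples_mono[OF sub] by blast
    have "bracket (xs ! i) (xs ! j) # remove_nth i (remove_nth j xs) \<in> tuples n S"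
      if ij: "i < j" "j \<le> n" for i j
    proof -
      obtain m where n: "n = Suc m" using ij by (cases n) auto
      have "remove_nth i (remove_nth j xs) \<in> tuples m S"
        using tuples_remove_nth[OF tuples_remove_nth[OF True, of j, unfolded n], of i] ij n by simp
      then show ?thesis using lie_subalgebraD(2)[OF S] tuples_nth[OF True] ij by (simp add: n)
    qed
    then show ?thesis using True T tuples_remove_nth[OF True]
      by (simp add: restr_def differential_def)
  next
    case False
    then show ?thesis by (simp add: restr_def d_notin)
  qed
qed

lemma restr_\<theta>:
  assumes "S \<subseteq> S'" "\<And>x. x \<in> S \<Longrightarrow> bracket h x \<in> S"
  shows "restr S n (\<theta> S' n h F) = \<theta> S n h (restr S n F)"
proof
  fix xs
  show "restr S n (\<theta> S' n h F) xs = \<theta> S n h (restr S n F) xs"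
    using tuples_mono[OF assms(1), of n] assms(2) tuples_update[of xs n S] tuples_nth[of xs n S]
    by (auto simp: restr_def cochain_action_def subset_iff)
qed

section \<open>Extending cochains from a subspace by one further vector\<close>

definition coord :: "'g set \<Rightarrow> 'g \<Rightarrow> 'g \<Rightarrow> 'k" where
  "coord S h x = (THE c. x - scale c h \<in> S)"

definition proj :: "'g set \<Rightarrow> 'g \<Rightarrow> 'g \<Rightarrow> 'g" where
  "proj S h x = x - scale (coord S h x) h"

text \<open>The cochain on the span of \<open>S\<close> and \<open>h\<close> which restricts to \<open>\<alpha>\<close> on \<open>S\<close>, and
  whose contraction with \<open>h\<close> restricts to \<open>\<beta>\<close>.\<close>

fun glue :: "'g set \<Rightarrow> 'g \<Rightarrow> ('g list \<Rightarrow> 'm) \<Rightarrow> ('g list \<Rightarrow> 'm) \<Rightarrow> 'g list \<Rightarrow> 'm" where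
  "glue S h \<alpha> \<beta> [] = \<alpha> []"
| "glue S h \<alpha> \<beta> (x # ys) = (if x \<in> span (insert h S)
     then glue S h (ins (proj S h x) \<alpha>) (- ins (proj S h x) \<beta>) ys + mscale (coord S h x) (glue S h \<beta> 0 ys)
     else 0)"

lemma glue_add: "glue S h (\<alpha> + \<alpha>') (\<beta> + \<beta>') = glue S h \<alpha> \<beta> + glue S h \<alpha>' \<beta>'"
proof
  have neg: "- (a + b) = - a + - b" for a b :: "'g list \<Rightarrow> 'm" by simp
  show "glue S h (\<alpha> + \<alpha>') (\<beta> + \<beta>') xs = (glue S h \<alpha> \<beta> + glue S h \<alpha>' \<beta>') xs" for xs
  proof (induction xs arbitrary: \<alpha> \<alpha>' \<beta> \<beta>')
    case (Cons x xs)
    have "glue S h (\<beta> + \<beta>') 0 xs = glue S h \<beta> 0 xs + glue S h \<beta>' 0 xs"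
      using Cons.IH[of \<beta> \<beta>' 0 0] unfolding add_0_right plus_fun_apply .
    then show ?case
      unfolding glue.simps ins_add neg Cons.IH by (simp add: M.scale_right_distrib)
  qed simp
qed

lemma glue_0 [simp]: "glue S h 0 0 = 0"
  using glue_add[of S h 0 0 0 0] by simp

lemma glue_scale: "glue S h (pointwise mscale c \<alpha>) (pointwise mscale c \<beta>) = pointwise mscale c (glue S h \<alpha> \<beta>)"
proof
  show "glue S h (pointwise mscale c \<alpha>) (pointwise mscale c \<beta>) xs = pointwise mscale c (glue S h \<alpha> \<beta>) xs" for xs
  proof (induction xs arbitrary: \<alpha> \<beta>)
    case (Cons x xs)
    have "glue S h (pointwise mscale c \<beta>) 0 xs = pointwise mscale c (glue S h \<beta> 0) xs"
      using Cons.IH[of \<beta> 0] unfolding W.scale_zero_right .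
    then show ?case
      unfolding glue.simps ins_pointwise W.scale_minus_right[symmetric] Cons.IH
      by (simp add: pointwise_def M.scale_right_distrib mult.commute)
  qed (simp add: pointwise_def)
qed

text \<open>With \<open>p\<close> the projection to \<open>S\<close> along \<open>h\<close> and
  \<open>\<xi>\<close> the coefficient of \<open>h\<close>, \<open>glue\<close> encodes
  \<open>\<alpha> \<circ> p + \<xi> \<and> (\<beta> \<circ> p)\<close>. Contracting the wedge
  product gives \<open>\<xi>(x) (\<beta> \<circ> p) - \<xi> \<and> (\<iota>_(p x) \<beta> \<circ>
  p)\<close>, which explains the sign and the recursion.\<close>

lemma ins_glue:
  "x \<in> span (insert h S) \<Longrightarrow> ins x (glue S h \<alpha> \<beta>) =
     glue S h (ins (proj S h x) \<alpha>) (- ins (proj S h x) \<beta>) + pointwise mscale (coord S h x) (glue S h \<beta> 0)"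
  by (rule ext) (simp add: ins_def pointwise_def)

context
  fixes S :: "'g set" and h :: 'g
  assumes S: "subspace S" and h: "h \<notin> S"
begin

lemma in_span_insert: "x \<in> span (insert h S) \<longleftrightarrow> (\<exists>c. x - scale c h \<in> S)"
proof -
  have eq: "span S = S" using S by simp
  show ?thesis unfolding span_insert eq by simp
qed

lemma subset_span_insert: "S \<subseteq> span (insert h S)"
  by (meson span_superset subset_insertI subset_trans)

lemma coord_eqI: assumes "x - scale c h \<in> S" shows "coord S h x = c"
  unfolding coord_def
proof (rule the_equality[where P = "\<lambda>c. x - scale c h \<in> S"])
  show "x - scale c h \<in> S" by fact
  fix c' assume "x - scale c' h \<in> S"
  then have "(x - scale c h) - (x - scale c' h) \<in> S" by (rule subspace_diff[OF S assms])
  then have *: "scale (c' - c) h \<in> S" by (simp add: algebra_simps)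
  show "c' = c"
  proof (rule ccontr)
    assume "c' \<noteq> c"
    moreover have "scale (inverse (c' - c)) (scale (c' - c) h) \<in> S"
      using * by (rule subspace_scale[OF S])
    ultimately show False using h by simp
  qed
qed

lemma proj_in: "x \<in> span (insert h S) \<Longrightarrow> proj S h x \<in> S"
  using coord_eqI by (auto simp: in_span_insert proj_def)

lemma coord_add:
  assumes "x \<in> span (insert h S)" "y \<in> span (insert h S)"
  shows "coord S h (x + y) = coord S h x + coord S h y" "proj S h (x + y) = proj S h x + proj S h y"
proof -
  have "x + y - scale (coord S h x + coord S h y) h = proj S h x + proj S h y"
    by (simp add: proj_def algebra_simps)
  then show "coord S h (x + y) = coord S h x + coord S h y"
    using subspace_add[OF S proj_in proj_in] assms coord_eqI by metis
  then show "proj S h (x + y) = proj S h x + proj S h y" by (simp add: proj_def algebra_simps)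
qed

lemma coord_scale:
  assumes "x \<in> span (insert h S)"
  shows "coord S h (scale c x) = c * coord S h x" "proj S h (scale c x) = scale c (proj S h x)"
proof -
  have "scale c x - scale (c * coord S h x) h = scale c (proj S h x)"
    by (simp add: proj_def algebra_simps)
  then show "coord S h (scale c x) = c * coord S h x"
    using subspace_scale[OF S proj_in] assms coord_eqI by metis
  then show "proj S h (scale c x) = scale c (proj S h x)" by (simp add: proj_def algebra_simps)
qed

lemma coord_in: "x \<in> S \<Longrightarrow> coord S h x = 0" "x \<in> S \<Longrightarrow> proj S h x = x"
  using coord_eqI[of x 0] by (simp_all add: proj_def)

lemma coord_self: "coord S h h = 1" "proj S h h = 0"
  using coord_eqI[of h 1] subspace_0[OF S] by (simp_all add: proj_def)

lemma glue_on: "set xs \<subseteq> S \<Longrightarrow> glue S h \<alpha> \<beta> xs = \<alpha> xs"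
proof (induction xs arbitrary: \<alpha> \<beta>)
  case (Cons x xs)
  then have "x \<in> span (insert h S)" using subset_span_insert by auto
  then show ?case using Cons by (simp add: coord_in ins_def)
qed simp

text \<open>\<open>\<beta>\<close> has degree \<open>n - 1\<close>, so it has to vanish for
  \<open>n = 0\<close>, where truncated subtraction would give the wrong degree.\<close>

lemma glue_C:
  assumes "\<alpha> \<in> C S n" "if n = 0 then \<beta> = 0 else \<beta> \<in> C S (n - 1)"
  shows "glue S h \<alpha> \<beta> \<in> C (span (insert h S)) n"
  using assms
proof (induction n arbitrary: \<alpha> \<beta>)
  case 0
  have "glue S h \<alpha> 0 (x # ys) = 0" for x ys
    using 0 by (simp add: ins_C_0)
  then have "glue S h \<alpha> 0 xs = 0" if "xs \<noteq> []" for xs using that by (cases xs) auto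
  then show ?case using 0 unfolding C_0_iff by simp
next
  case (Suc n)
  let ?S = "span (insert h S)"
  have \<alpha>: "\<alpha> \<in> C S (Suc n)" and \<beta>: "\<beta> \<in> C S n" using Suc.prems by auto
  have zero: "0 \<in> C S m" for m by (rule C_zero)
  have p: "proj S h x \<in> S" if "x \<in> ?S" for x using that by (rule proj_in)
  have ig: "ins x (glue S h \<alpha>' \<beta>') = glue S h (ins (proj S h x) \<alpha>') (- ins (proj S h x) \<beta>')
      + pointwise mscale (coord S h x) (glue S h \<beta>' 0)" if "x \<in> ?S" for x \<alpha>' \<beta>'
    using that by (rule ins_glue)
  have "if n = 0 then - ins (proj S h x) \<beta> = 0 else - ins (proj S h x) \<beta> \<in> C S (n - 1)"
    if "x \<in> ?S" for x
    using \<beta> C_ins[of \<beta> S "n - 1"] p[OF that] by (cases n) (auto simp: ins_C_0 intro: C_neg)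
  then have in1: "glue S h (ins (proj S h x) \<alpha>) (- ins (proj S h x) \<beta>) \<in> C ?S n" if "x \<in> ?S" for x
    using that by (intro Suc.IH C_ins[OF \<alpha>] p)
  have in2: "glue S h \<beta> 0 \<in> C ?S n" using \<beta> zero by (intro Suc.IH) presburger+
  show ?case
  proof (rule C_SucI[OF subspace_span])
    fix x assume x: "x \<in> ?S"
    show "ins x (glue S h \<alpha> \<beta>) \<in> C ?S n"
      unfolding ig[OF x] by (intro C_add C_scale in1 in2 x)
    \<comment> \<open>Contracting twice with \<open>x\<close> produces these two cross terms, one
      from each summand of \<open>ins_glue\<close>; they cancel, and the remaining terms vanish
      because \<open>\<alpha>\<close> and \<open>\<beta>\<close> are alternating.\<close>
    have "glue S h (- ins (proj S h x) \<beta>) 0 + glue S h (ins (proj S h x) \<beta>) 0 = 0"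
      by (simp flip: glue_add)
    then have "pointwise mscale (coord S h x) (glue S h (- ins (proj S h x) \<beta>) 0)
       + pointwise mscale (coord S h x) (glue S h (ins (proj S h x) \<beta>) 0) = 0"
      by (simp flip: W.scale_right_distrib add: W.scale_zero_right)
    moreover have "ins (proj S h x) (- F) = - ins (proj S h x) F" for F :: "'g list \<Rightarrow> 'm"
      by (auto simp: ins_def)
    ultimately show "ins x (ins x (glue S h \<alpha> \<beta>)) = 0"
      by (simp add: ig[OF x] ins_twice[OF \<alpha> p[OF x]] ins_twice[OF \<beta> p[OF x]] W.scale_zero_right)
    fix c
    show "ins (scale c x) (glue S h \<alpha> \<beta>) = pointwise mscale c (ins x (glue S h \<alpha> \<beta>))"
      using glue_scale[of S h c "ins (proj S h x) \<alpha>" "- ins (proj S h x) \<beta>"]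
      by (simp add: ig x span_scale coord_scale ins_scale_left[OF \<alpha> S] ins_scale_left[OF \<beta> S] p
          W.scale_right_distrib W.scale_minus_right)
  next
    fix x y assume x: "x \<in> ?S" and y: "y \<in> ?S"
    show "ins (x + y) (glue S h \<alpha> \<beta>) = ins x (glue S h \<alpha> \<beta>) + ins y (glue S h \<alpha> \<beta>)"
      using glue_add[of S h "ins (proj S h x) \<alpha>" "ins (proj S h y) \<alpha>" "- ins (proj S h x) \<beta>"
        "- ins (proj S h y) \<beta>"]
      by (simp add: ig x y span_add coord_add ins_add_left[OF \<alpha> S] ins_add_left[OF \<beta> S] p
          W.scale_left_distrib)
  qed (use \<alpha> in \<open>auto simp: ins_def C_off\<close>)
qed

text \<open>\<open>h\<close> projects to zero and has coefficient one, so only the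
  \<open>\<beta>\<close> part survives.\<close>

lemma ins_glue_on:
  assumes "\<alpha> \<in> C S n" "\<beta> \<in> C S m" "set ys \<subseteq> S"
  shows "glue S h \<alpha> \<beta> (h # ys) = \<beta> ys"
proof -
  have "ins 0 F = 0" if "F \<in> C S k" for F k
    using that by (cases k) (auto simp: ins_C_0 ins_zero_left[OF _ S])
  then have "ins 0 \<alpha> = 0" "ins 0 \<beta> = 0" using assms by auto
  moreover have "h \<in> span (insert h S)" by (simp add: span_base)
  ultimately show ?thesis using glue_on[OF assms(3)] by (simp add: coord_self)
qed

text \<open>By induction on the degree both kinds of contraction vanish: for
  \<open>s \<in> S\<close> one exchange brings \<open>h\<close> to the front, and for
  \<open>h\<close> a second \<open>h\<close> is killed by alternation. Linearity covers the
  span.\<close>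

lemma glue_unique:
  assumes "F \<in> C (span (insert h S)) n"
    and "\<And>xs. set xs \<subseteq> S \<Longrightarrow> F xs = 0" "\<And>xs. set xs \<subseteq> S \<Longrightarrow> F (h # xs) = 0"
  shows "F = 0"
  using assms
proof (induction n arbitrary: F)
  case 0
  have "F xs = 0" for xs using 0 by (cases "xs = []") (auto simp: C_0_iff)
  then show ?case by auto
next
  case (Suc n)
  let ?S = "span (insert h S)"
  note F = Suc.prems(1)
  have hS: "h \<in> ?S" by (simp add: span_base)
  have 1: "ins s F = 0" if s: "s \<in> S" for s
  proof (rule Suc.IH)
    have s': "s \<in> ?S" using s subset_span_insert by auto
    show "ins s F \<in> C ?S n" using F s' by (rule C_ins)
    show "ins s F xs = 0" if "set xs \<subseteq> S" for xs using that Suc.prems(2) s by (simp add: ins_def)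
    show "ins s F (h # xs) = 0" if "set xs \<subseteq> S" for xs
    proof (cases n)
      case 0
      then show ?thesis using C_off[OF F] by (simp add: ins_def tuples_def)
    next
      case (Suc m)
      then have "F (s # h # xs) = - F (h # s # xs)"
        using F C_swap_Cons[OF _ subspace_span s' hS] by metis
      then show ?thesis using Suc.prems(3) s that by (simp add: ins_def)
    qed
  qed
  have 2: "ins h F = 0"
  proof (rule Suc.IH)
    show "ins h F \<in> C ?S n" using F hS by (rule C_ins)
    show "ins h F xs = 0" if "set xs \<subseteq> S" for xs using that Suc.prems(3) by (simp add: ins_def)
    show "ins h F (h # xs) = 0" for xs
      using fun_cong[OF ins_ins_self[OF F hS], of xs] by (simp add: ins_def)
  qed
  have "F (x # ys) = 0" if "x \<in> ?S" for x ys
  proof -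
    have "ins (proj S h x + scale (coord S h x) h) F = 0"
      using ins_add_left[OF F subspace_span, of "proj S h x" "scale (coord S h x) h"] proj_in[OF that]
        ins_scale_left[OF F subspace_span hS] subset_span_insert hS
      by (simp add: 1 2 span_scale subset_iff W.scale_zero_right)
    then have "ins x F = 0" by (simp add: proj_def)
    then show ?thesis by (metis ins_def zero_fun_apply)
  qed
  moreover have "F xs = 0" if "xs \<notin> tuples (Suc n) ?S" for xs using C_off[OF F that] .
  ultimately have "F xs = 0" for xs by (cases xs) (auto, metis Cons_in_tuples)
  then show ?case by auto
qed

end

end

text \<open>\<open>H\<close> is a set of commuting elements stabilising the subalgebra
  \<open>K\<close>. Torality enters later as an explicit hypothesis, so the component calculus also
  applies to the zero bracket with \<open>K = {0}\<close>, where it describes alternating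
  forms.\<close>

locale lie_module_torus = lie_module +
  fixes H K :: "'b set"
  assumes H_abelian: "\<And>h k. \<lbrakk>h \<in> H; k \<in> H\<rbrakk> \<Longrightarrow> bracket h k = 0"
    and K: "lie_subalgebra K"
    and H_K: "\<And>h x. \<lbrakk>h \<in> H; x \<in> K\<rbrakk> \<Longrightarrow> bracket h x \<in> K"
begin

lemmas K_sub = lie_subalgebraD(1)[OF K]

definition ext_by :: "'b list \<Rightarrow> 'b set" where
  "ext_by hs = span (set hs \<union> K)"

text \<open>Linear independence modulo \<open>K\<close>, ordered so that vectors can be added one at
  a time by \<open>glue\<close>.\<close>

fun indep_mod :: "'b list \<Rightarrow> bool" where
  "indep_mod [] \<longleftrightarrow> True"
| "indep_mod (h # hs) \<longleftrightarrow> h \<notin> ext_by hs \<and> indep_mod hs"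

definition CI :: "'b set \<Rightarrow> nat \<Rightarrow> ('b list \<Rightarrow> 'c) set" where
  "CI S n = {F \<in> C S n. \<forall>h\<in>H. \<theta> S n h F = 0}"

lemma ext_by_Nil [simp]: "ext_by [] = K"
  using K_sub by (simp add: ext_by_def)

lemma subspace_ext_by: "subspace (ext_by hs)"
  by (simp add: ext_by_def)

lemma ext_by_Cons: "ext_by (h # hs) = span (insert h (ext_by hs))"
proof
  show "ext_by (h # hs) \<subseteq> span (insert h (ext_by hs))"
    unfolding ext_by_def by (intro span_mono) (auto intro: span_base)
  have "ext_by hs \<subseteq> ext_by (h # hs)" unfolding ext_by_def by (intro span_mono) auto
  then have "insert h (ext_by hs) \<subseteq> ext_by (h # hs)"
    by (auto simp: ext_by_def intro: span_base)
  then show "span (insert h (ext_by hs)) \<subseteq> ext_by (h # hs)"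
    by (rule span_minimal) (rule subspace_ext_by)
qed

lemma K_subset_ext_by: "K \<subseteq> ext_by hs" and set_subset_ext_by: "set hs \<subseteq> ext_by hs"
  by (auto simp: ext_by_def intro: span_base)

lemma ext_by_induct:
  assumes "x \<in> ext_by hs" "subspace {x. P x}" "\<And>h. h \<in> set hs \<Longrightarrow> P h" "\<And>k. k \<in> K \<Longrightarrow> P k"
  shows "P x"
  using span_induct[OF assms(1)[unfolded ext_by_def], of P] assms by auto

lemma H_ext_by:
  assumes "set hs \<subseteq> H" "h \<in> H" "x \<in> ext_by hs"
  shows "bracket h x \<in> ext_by hs"
  using assms(3)
proof (rule ext_by_induct)
  show "subspace {x. bracket h x \<in> ext_by hs}"
    using subspace_ext_by[of hs] by (auto simp: subspace_def bracket_add_right bracket_scale_right)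
qed (use assms H_abelian H_K K_subset_ext_by subspace_0[OF subspace_ext_by] in \<open>auto simp: subset_iff\<close>)

lemma CI_D: "F \<in> CI S n \<Longrightarrow> F \<in> C S n" "\<lbrakk>F \<in> CI S n; h \<in> H\<rbrakk> \<Longrightarrow> \<theta> S n h F = 0"
  by (auto simp: CI_def)

text \<open>\<open>[k,h] = 0\<close> makes contraction with \<open>h\<close> commute with each
  \<open>\<theta>_k\<close>. Iterating this is what makes the components of an invariant cochain
  invariant.\<close>

lemma CI_ins:
  assumes F: "F \<in> CI S (Suc n)" and h: "h \<in> S" "h \<in> H" and S: "subspace S"
  shows "ins h F \<in> CI S n"
proof -
  have C: "F \<in> C S (Suc n)" by (rule CI_D[OF F])
  have "\<theta> S n k (ins h F) = 0" if "k \<in> H" for k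
    using ins_\<theta>[OF C h(1), of k] CI_D(2)[OF F that] H_abelian[OF that h(2)]
    by (simp add: ins_zero_left[OF C S])
  then show ?thesis using C_ins[OF C h(1)] by (simp add: CI_def)
qed

lemma subspace_CI: "W.subspace (CI S n)"
  using subspace_C[of S n] unfolding W.subspace_def CI_def
  by (auto simp: \<theta>_add \<theta>_scale W.scale_zero_right)

text \<open>The subsequences of \<open>h # hs\<close> split by whether they contain
  \<open>h\<close>; the two halves control the restrictions of \<open>F\<close> and of its
  contraction with \<open>h\<close> to the smaller span, and these determine \<open>F\<close> by
  \<open>glue_unique\<close>.\<close>

lemma eq_0_if_components:
  assumes "set hs \<subseteq> H" "indep_mod hs" "F \<in> C (ext_by hs) n"
    and "\<And>A xs. \<lbrakk>A \<in> set (subseqs hs); set xs \<subseteq> K\<rbrakk> \<Longrightarrow> F (A @ xs) = 0"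
  shows "F = 0"
  using assms
proof (induction hs arbitrary: n F)
  case Nil
  have "F xs = 0" for xs
    using Nil.prems(4)[of "[]" xs] C_off[OF Nil.prems(3), of xs]
      by (cases "set xs \<subseteq> K") (auto simp: tuples_def)
  then show ?case by auto
next
  case (Cons h hs)
  let ?S = "ext_by hs"
  have hS: "h \<notin> ?S" and ind: "indep_mod hs" and hs: "set hs \<subseteq> H" using Cons.prems by auto
  have F: "F \<in> C (span (insert h ?S)) n" using Cons.prems(3) by (simp add: ext_by_Cons)
  note sub = subset_span_insert[OF subspace_ext_by hS]
  have restr: "G xs = 0" if "set xs \<subseteq> ?S" "G \<in> C (span (insert h ?S)) m"
    "\<And>A xs. \<lbrakk>A \<in> set (subseqs hs); set xs \<subseteq> K\<rbrakk> \<Longrightarrow> G (A @ xs) = 0" for G xs m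
  proof -
    have "restr ?S m G = 0"
      by (rule Cons.IH[OF hs ind restr_C[OF sub that(2) subspace_ext_by]]) (simp add: restr_def that(3))
    then have "restr ?S m G xs = 0" by simp
    then show ?thesis using C_off[OF that(2)] that(1) sub
      by (cases "xs \<in> tuples m ?S") (auto simp: restr_def tuples_def)
  qed
  show ?case
  proof (rule glue_unique[OF subspace_ext_by hS F])
    fix xs assume xs: "set xs \<subseteq> ?S"
    show "F xs = 0"
      by (rule restr[OF xs F]) (use Cons.prems(4) in \<open>simp add: Let_def\<close>)
    have "ins h F xs = 0"
    proof (cases n)
      case 0
      then show ?thesis using ins_C_0 F by fastforce
    next
      case (Suc m)
      have "h \<in> span (insert h ?S)" by (simp add: span_base)
      then show ?thesis
        by (intro restr[OF xs C_ins[OF F[unfolded Suc]]])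
          (use Cons.prems(4)[of "h # _"] in \<open>simp_all add: Let_def ins_def\<close>)
    qed
    then show "F (h # xs) = 0" by (simp add: ins_def)
  qed
qed

lemma subseqs_set: "A \<in> set (subseqs hs) \<Longrightarrow> set A \<subseteq> set hs"
  using subseqs_powset[of hs] by blast

text \<open>Components are prescribed by gluing along the same split. Invariance of the result is
  checked with \<open>glue_unique\<close>, since \<open>\<theta>_k\<close> commutes with restriction
  and with contraction by \<open>h\<close>.\<close>

lemma exists_components:
  assumes "set hs \<subseteq> H" "indep_mod hs"
    and "\<And>A. \<lbrakk>A \<in> set (subseqs hs); length A \<le> n\<rbrakk> \<Longrightarrow> u A \<in> CI K (n - length A)"
  shows "\<exists>F\<in>CI (ext_by hs) n. \<forall>A\<in>set (subseqs hs). \<forall>xs. length A \<le> n \<longrightarrow> set xs \<subseteq> K \<longrightarrow> F (A @ xs) = u A xs"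
  using assms
proof (induction hs arbitrary: n u)
  case Nil
  then show ?case by (intro bexI[of _ "u []"]) auto
next
  case (Cons h hs)
  let ?S = "ext_by hs"
  let ?T = "span (insert h ?S)"
  have hS: "h \<notin> ?S" and ind: "indep_mod hs" and hs: "set hs \<subseteq> H" and h: "h \<in> H" using Cons.prems by auto
  note gl = subspace_ext_by[of hs] hS
  note sub = subset_span_insert[OF gl]
  have hT: "h \<in> ?T" by (simp add: span_base)
  have T: "?T = ext_by (h # hs)" by (simp add: ext_by_Cons)
  obtain \<alpha> where \<alpha>: "\<alpha> \<in> CI ?S n"
      "\<And>A xs. \<lbrakk>A \<in> set (subseqs hs); set xs \<subseteq> K; length A \<le> n\<rbrakk> \<Longrightarrow> \<alpha> (A @ xs) = u A xs"
    using Cons.IH[OF hs ind, of n u] Cons.prems(3) by (auto simp: Let_def)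
  \<comment> \<open>For \<open>n = 0\<close> no sequence containing \<open>h\<close> fits into
    \<open>n\<close> arguments, and \<open>\<beta>\<close> is zero.\<close>
  obtain \<beta> where \<beta>: "if n = 0 then \<beta> = 0 else \<beta> \<in> CI ?S (n - 1)"
      "\<And>A xs. \<lbrakk>A \<in> set (subseqs hs); set xs \<subseteq> K; length A < n\<rbrakk> \<Longrightarrow> \<beta> (A @ xs) = u (h # A) xs"
  proof (cases n)
    case 0
    then show ?thesis using that[of 0] by simp
  next
    case (Suc m)
    then show ?thesis using Cons.IH[OF hs ind, of m "\<lambda>A. u (h # A)"] Cons.prems(3)[of "h # _"] that
      by (auto simp: Let_def less_Suc_eq_le)
  qed
  have \<beta>C: "if n = 0 then \<beta> = 0 else \<beta> \<in> C ?S (n - 1)" using \<beta>(1) CI_D(1) by auto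
  have \<beta>C': "\<beta> \<in> C ?S (n - 1)" using \<beta>C C_zero by (auto split: if_splits)
  let ?F = "glue ?S h \<alpha> \<beta>"
  have F: "?F \<in> C ?T n" by (rule glue_C[OF gl CI_D(1)[OF \<alpha>(1)] \<beta>C])
  have F\<alpha>: "?F xs = \<alpha> xs" if "set xs \<subseteq> ?S" for xs by (rule glue_on[OF gl that])
  have F\<beta>: "?F (h # xs) = \<beta> xs" if "set xs \<subseteq> ?S" for xs
    by (rule ins_glue_on[OF gl CI_D(1)[OF \<alpha>(1)] \<beta>C' that])
  have "\<theta> ?T n k ?F = 0" if k: "k \<in> H" for k
  proof (rule glue_unique[OF gl])
    have kS: "bracket k x \<in> ?S" if "x \<in> ?S" for x using H_ext_by[OF hs k that] .
    have kT: "bracket k x \<in> ?T" if "x \<in> ?T" for x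
      using H_ext_by[OF Cons.prems(1) k] that by (simp add: T)
    show "\<theta> ?T n k ?F \<in> C ?T n" by (rule \<theta>_C[OF subspace_span kT F])
    fix xs assume xs: "set xs \<subseteq> ?S"
    have "restr ?S n ?F = \<alpha>"
      using F\<alpha> C_off[OF CI_D(1)[OF \<alpha>(1)]] by (auto simp: restr_def fun_eq_iff tuples_def)
    then have "restr ?S n (\<theta> ?T n k ?F) = 0"
      using restr_\<theta>[OF sub kS, of n ?F] CI_D(2)[OF \<alpha>(1) k] by simp
    then have "restr ?S n (\<theta> ?T n k ?F) xs = 0" by simp
    then show "\<theta> ?T n k ?F xs = 0"
      using xs sub by (cases "length xs = n") (auto simp: restr_def tuples_def cochain_action_def)
    show "\<theta> ?T n k ?F (h # xs) = 0"
    proof (cases n)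
      case 0
      then show ?thesis by (simp add: cochain_action_def)
    next
      case (Suc m)
      have FS: "?F \<in> C ?T (Suc m)" using F Suc by simp
      have \<beta>m: "\<beta> \<in> CI ?S m" using \<beta>(1) Suc by simp
      have "restr ?S m (ins h ?F) = \<beta>"
        using F\<beta> C_off[OF CI_D(1)[OF \<beta>m]] by (auto simp: restr_def fun_eq_iff tuples_def ins_def)
      then have "restr ?S m (\<theta> ?T m k (ins h ?F)) = 0"
        using restr_\<theta>[OF sub kS, of m "ins h ?F"] CI_D(2)[OF \<beta>m k] by simp
      then have "restr ?S m (\<theta> ?T m k (ins h ?F)) xs = 0" by simp
      moreover have "ins h (\<theta> ?T n k ?F) = \<theta> ?T m k (ins h ?F)"
        using ins_\<theta>[OF FS hT, of k] H_abelian[OF k h] Suc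
          by (simp add: ins_zero_left[OF FS subspace_span])
      ultimately have "restr ?S m (ins h (\<theta> ?T n k ?F)) xs = 0" by simp
      then show ?thesis
        using xs sub Suc by (cases "length xs = m") (auto simp: restr_def tuples_def cochain_action_def ins_def)
    qed
  qed
  then have FI: "?F \<in> CI (ext_by (h # hs)) n" using F by (simp add: CI_def T)
  have in_S: "set (A @ xs) \<subseteq> ?S" if "A \<in> set (subseqs hs)" "set xs \<subseteq> K" for A xs
    using subseqs_set[OF that(1)] that(2) set_subset_ext_by[of hs] K_subset_ext_by[of hs] by auto
  have "?F (A @ xs) = u A xs"
    if A: "A \<in> set (subseqs (h # hs))" "length A \<le> n" and xs: "set xs \<subseteq> K" for A xs
  proof (cases "A \<in> set (subseqs hs)")
    case True
    then show ?thesis using F\<alpha>[OF in_S] \<alpha>(2) A xs by simp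
  next
    case False
    then obtain A' where A': "A = h # A'" "A' \<in> set (subseqs hs)" using A(1) by (auto simp: Let_def)
    then show ?thesis using F\<beta>[OF in_S[OF A'(2) xs]] \<beta>(2)[OF A'(2) xs] A(2) by simp
  qed
  then show ?case using FI by blast
qed

text \<open>Meant for \<open>length A \<le> n\<close>. For longer \<open>A\<close> the truncated
  degree is 0, and a cochain \<open>F\<close> of degree \<open>n\<close> gives zero.\<close>

definition comp :: "'b list \<Rightarrow> nat \<Rightarrow> ('b list \<Rightarrow> 'c) \<Rightarrow> 'b list \<Rightarrow> 'c" where
  "comp A n F = restr K (n - length A) (\<lambda>xs. F (A @ xs))"

lemma comp_Cons: "comp (h # A) (Suc n) F = comp A n (ins h F)"
  by (simp add: comp_def ins_def)

context
  fixes S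
  assumes S: "lie_subalgebra S" and KS: "K \<subseteq> S"
begin

lemma comp_CI:
  assumes "F \<in> CI S n" "length A \<le> n" "set A \<subseteq> S \<inter> H"
  shows "comp A n F \<in> CI K (n - length A)"
  using assms
proof (induction A arbitrary: n F)
  case Nil
  have "\<theta> K n h (restr K n F) = 0" if "h \<in> H" for h
  proof -
    have "\<theta> K n h (restr K n F) = restr K n (\<theta> S n h F)" using restr_\<theta>[OF KS H_K[OF that]] by simp
    also have "\<dots> = 0" using CI_D(2)[OF Nil.prems(1) that] by (auto simp: restr_def)
    finally show ?thesis .
  qed
  then show ?case using restr_C[OF KS CI_D(1)[OF Nil.prems(1)] K_sub] by (simp add: comp_def CI_def)
next
  case (Cons h A)
  then obtain m where n: "n = Suc m" by (cases n) auto
  have "ins h F \<in> CI S m" using CI_ins[of F S m h] Cons.prems n lie_subalgebraD(1)[OF S] by auto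
  then show ?case using Cons.IH Cons.prems n by (simp add: comp_Cons)
qed

text \<open>The Cartan formula with \<open>\<theta>_h F = 0\<close>: contraction anticommutes with
  \<open>d\<close> on invariants.\<close>

lemma ins_d_CI:
  assumes "F \<in> CI S n" "h \<in> S" "h \<in> H"
  shows "ins h (d S n F) = (if n = 0 then 0 else - d S (n - 1) (ins h F))"
  using ins_d_normalized[OF S CI_D(1)[OF assms(1)] assms(2)] CI_D(2)[OF assms(1,3)] by simp

lemma comp_d:
  assumes "F \<in> CI S n" "length A \<le> n" "set A \<subseteq> S \<inter> H"
  shows "comp A (Suc n) (d S n F) = pointwise mscale ((- 1) ^ length A) (d K (n - length A) (comp A n F))"
  using assms
proof (induction A arbitrary: n F)
  case Nil
  show ?case using restr_d[OF K KS, of n F] by (simp add: comp_def W.scale_one)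
next
  case (Cons h A)
  then obtain m where n: "n = Suc m" by (cases n) auto
  have F: "ins h F \<in> CI S m" using CI_ins[of F S m h] Cons.prems n lie_subalgebraD(1)[OF S] by auto
  have "comp (h # A) (Suc n) (d S n F) = comp A n (- d S m (ins h F))"
    using ins_d_CI[OF Cons.prems(1), of h] Cons.prems(3) n by (simp add: comp_Cons)
  also have "\<dots> = - comp A n (d S m (ins h F))" by (auto simp: comp_def restr_def)
  finally show ?case using Cons.IH[OF F] Cons.prems n by (simp add: comp_Cons W.scale_minus_left)
qed

text \<open>After \<open>n\<close> contractions an invariant of degree 0 is left, and contracting
  its differential once more gives its image under \<open>\<theta>_h\<close>, which is zero. This
  settles the components of \<open>d F\<close> with \<open>length A = n + 1\<close>, which have no
  counterpart in \<open>F\<close>.\<close>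

lemma comp_d_top:
  assumes "F \<in> CI S n" "n < length A" "set A \<subseteq> S \<inter> H"
  shows "d S n F (A @ xs) = 0"
  using assms
proof (induction A arbitrary: n F)
  case (Cons h A)
  have *: "d S n F (h # A @ xs) = (if n = 0 then 0 else - d S (n - 1) (ins h F) (A @ xs))"
    using fun_cong[OF ins_d_CI[OF Cons.prems(1), of h], of "A @ xs"] Cons.prems(3)
      by (simp add: ins_def)
  show ?case
  proof (cases n)
    case (Suc m)
    have F: "ins h F \<in> CI S m" using CI_ins[of F S m h] Cons.prems Suc lie_subalgebraD(1)[OF S] by auto
    show ?thesis using * Cons.IH[OF F] Cons.prems Suc by simp
  qed (use * in simp)
qed simp

end

end

section \<open>Alternating forms\<close>

context lie_module
begin

lemma C_zero_entry:
  assumes F: "F \<in> C S n" and S: "subspace S" and x: "0 \<in> set xs"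
  shows "F xs = 0"
proof (cases "xs \<in> tuples n S")
  case True
  obtain i where i: "i < n" "xs ! i = 0" using x True by (auto simp: in_set_conv_nth tuples_def)
  have "F (xs[i := scale 0 0]) = mscale 0 (F (xs[i := 0]))"
    using True i subspace_0[OF S] by (intro C_slot_scale[OF F]) auto
  then show ?thesis using i(2) by (simp add: list_update_same_conv) (metis list_update_id)
qed (rule C_off[OF F])

end

context vector_space
begin

text \<open>A vector space is an Abelian Lie algebra acting trivially on the field. With
  \<open>K = {0}\<close> every cochain is invariant, and components become values of alternating
  forms on basis tuples.\<close>

lemma lie_module_torus_trivial:
  "lie_module_torus scale (\<lambda>_ _. 0) (*) (\<lambda>_ _. 0) UNIV {0}"
proof (intro lie_module_torus.intro lie_module_torus_axioms.intro)
  have alg: "lie_algebra scale (\<lambda>_ _. 0)" by unfold_locales simp_all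
  show "lie_module scale (\<lambda>_ _. 0) ((*) :: 'a \<Rightarrow> 'a \<Rightarrow> 'a) (\<lambda>_ _. 0)"
    by (intro lie_module.intro lie_module_axioms.intro alg vector_space_field) simp_all
  show "lie_algebra.lie_subalgebra scale (\<lambda>_ _. 0) {0}"
    unfolding lie_algebra.lie_subalgebra_def[OF alg] by (intro conjI subspace_single_0) auto
qed simp_all

text \<open>Over \<open>K = {0}\<close> a component can be nonzero only in degree 0, that is for
  \<open>length A = n\<close>, where it is the single value \<open>F A\<close>.\<close>

lemma
  fixes c :: "'b list \<Rightarrow> 'a"
  assumes hs: "distinct hs" "independent (set hs)"
  shows alternating_form_exists:
      "\<exists>F\<in>cochains scale (*) (span (set hs)) n. \<forall>A\<in>set (subseqs hs). length A = n \<longrightarrow> F A = c A"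
    and alternating_form_unique:
      "\<And>F. \<lbrakk>F \<in> cochains scale (*) (span (set hs)) n; \<And>A. \<lbrakk>A \<in> set (subseqs hs);
          length A = n\<rbrakk> \<Longrightarrow> F A = 0\<rbrakk>
         \<Longrightarrow> F = (0 :: 'b list \<Rightarrow> 'a)"
proof -
  interpret lie_module_torus scale "\<lambda>_ _. 0" "(*) :: 'a \<Rightarrow> 'a \<Rightarrow> 'a" "\<lambda>_ _. 0" UNIV "{0}"
    by (rule lie_module_torus_trivial)
  \<comment> \<open>Both have become \<open>0 = 0\<close>, on which the simplifier loops.\<close>
  note bracket_0 [simp del] act_0 [simp del]
  have ext: "ext_by gs = span (set gs)" for gs by (simp add: ext_by_def)
  have ind: "indep_mod gs" if "distinct gs" "independent (set gs)" for gs
    using that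
  proof (induction gs)
    case (Cons g gs)
    then show ?case by (auto simp: ext independent_insert intro: independent_mono)
  qed simp
  let ?u = "\<lambda>A xs. if xs = [] \<and> length A = n then c A else 0"
  have "?u A \<in> CI {0} (n - length A)" if "length A \<le> n" for A
  proof (cases "length A = n")
    case True
    then show ?thesis by (simp add: CI_def C_0_iff cochain_action_def fun_eq_iff)
  next
    case False
    then have "?u A = 0" by (simp add: fun_eq_iff)
    then show ?thesis using W.subspace_0[OF subspace_CI] by metis
  qed
  then obtain F where F: "F \<in> CI (ext_by hs) n"
      "\<And>A xs. \<lbrakk>A \<in> set (subseqs hs); length A \<le> n; set xs \<subseteq> {0}\<rbrakk> \<Longrightarrow> F (A @ xs) = ?u A xs"
    using exists_components[of hs n ?u] ind[OF hs] by auto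
  show "\<exists>F\<in>cochains scale (*) (span (set hs)) n. \<forall>A\<in>set (subseqs hs). length A = n \<longrightarrow> F A = c A"
    using F(1) F(2)[of _ "[]"] by (intro bexI[of _ F]) (auto simp: CI_def ext)
  fix F :: "'b list \<Rightarrow> 'a"
  assume F: "F \<in> cochains scale (*) (span (set hs)) n"
    and 0: "\<And>A. \<lbrakk>A \<in> set (subseqs hs); length A = n\<rbrakk> \<Longrightarrow> F A = 0"
  show "F = 0"
  proof (rule eq_0_if_components)
    show "F \<in> C (ext_by hs) n" using F by (simp add: ext)
    fix A xs assume A: "A \<in> set (subseqs hs)" and xs: "set xs \<subseteq> {0::'b}"
    show "F (A @ xs) = 0"
    proof (cases xs)
      case Nil
      then show ?thesis using 0[OF A] C_off[OF F, of A]
        by (cases "length A = n") (auto simp: tuples_def)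
    next
      case (Cons x ys)
      then show ?thesis using xs by (intro C_zero_entry[OF F]) auto
    qed
  qed (use ind[OF hs] in auto)
qed

end

section \<open>Sums of eigenvectors\<close>

text \<open>One theory of eigenvectors for \<open>\<gg>\<close>, for \<open>M\<close>, for the
  cochains and for their extensions to the algebraic closure.\<close>

locale eigen_space = vector_space
begin

definition eigvecs :: "('b \<Rightarrow> 'b) \<Rightarrow> 'b set" where
  "eigvecs A = {w. \<exists>e. A w = scale e w}"

definition eigsum :: "('b \<Rightarrow> 'b) \<Rightarrow> 'a set \<Rightarrow> 'b set" where
  "eigsum A N = {\<Sum>e\<in>N. w e | w. \<forall>e\<in>N. A (w e) = scale e (w e)}"

definition linear_op :: "('b \<Rightarrow> 'b) \<Rightarrow> bool" where
  "linear_op A \<longleftrightarrow> (\<forall>x y. A (x + y) = A x + A y) \<and> (\<forall>c x. A (scale c x) = scale c (A x))"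

lemma linear_opD:
  fixes A :: "'b \<Rightarrow> 'b" and x y :: 'b
  assumes "linear_op A"
  shows "A (x + y) = A x + A y" "A (scale c x) = scale c (A x)" "A 0 = 0" "A (- x) = - A x"
      "A (x - y) = A x - A y"
    "A (sum f I) = (\<Sum>i\<in>I. A (f i))"
proof -
  show add: "A (x + y) = A x + A y" and sc: "A (scale c x) = scale c (A x)" for x y c
    using assms by (auto simp: linear_op_def)
  show 0: "A 0 = 0" using sc[of 0 0] by simp
  show "A (- x) = - A x" using sc[of "- 1" x] by simp
  show "A (x - y) = A x - A y" using add[of "x - y" y] by simp
  show "A (sum f I) = (\<Sum>i\<in>I. A (f i))"
    using add 0 by (induction I rule: infinite_finite_induct) simp_all
qed

text \<open>Induction on the number of eigenvalues: \<open>A - m\<close> removes the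
  \<open>m\<close>-summand and multiplies the others by the invertible factors \<open>e - m\<close>,
  so these lie in \<open>Y\<close>, and then so does the remaining one.\<close>

lemma eigsum_component:
  assumes "linear_op A" and Y: "subspace Y" "\<And>x. x \<in> Y \<Longrightarrow> A x \<in> Y" and "finite N"
    and "\<And>e. e \<in> N \<Longrightarrow> A (w e) = scale e (w e)" "(\<Sum>e\<in>N. w e) \<in> Y" "e \<in> N"
  shows "w e \<in> Y"
  using assms(4-)
proof (induction N arbitrary: w e rule: finite_induct)
  case (insert m N)
  note A = linear_opD[OF assms(1)]
  let ?v = "w m + (\<Sum>e\<in>N. w e)"
  have v: "?v \<in> Y" using insert by simp
  have "A ?v - scale m ?v \<in> Y" by (intro subspace_diff[OF Y(1)] subspace_scale[OF Y(1)] Y(2) v)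
  also have "A ?v - scale m ?v = (\<Sum>e\<in>N. A (w e) - scale m (w e))"
    using insert by (simp add: A sum_subtractf scale_sum_right scale_right_distrib)
  also have "\<dots> = (\<Sum>e\<in>N. scale (e - m) (w e))"
    using insert by (intro sum.cong) (auto simp: scale_left_diff_distrib)
  finally have "(\<Sum>e\<in>N. scale (e - m) (w e)) \<in> Y" .
  then have sc: "scale (\<kappa> - m) (w \<kappa>) \<in> Y" if "\<kappa> \<in> N" for \<kappa>
    using insert.IH[of "\<lambda>e. scale (e - m) (w e)" \<kappa>] insert.prems that by (simp add: A mult.commute)
  have "scale (inverse (\<kappa> - m)) (scale (\<kappa> - m) (w \<kappa>)) \<in> Y" if "\<kappa> \<in> N" for \<kappa>
    by (rule subspace_scale[OF Y(1) sc[OF that]])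
  moreover have "\<kappa> \<noteq> m" if "\<kappa> \<in> N" for \<kappa> using that insert.hyps by auto
  ultimately have in_X: "w \<kappa> \<in> Y" if "\<kappa> \<in> N" for \<kappa> using that by force
  then have "?v - (\<Sum>e\<in>N. w e) \<in> Y" by (intro subspace_diff[OF Y(1) v] subspace_sum[OF Y(1)])
  then show ?case using in_X insert.prems by auto
qed simp

lemma subspace_eigsum:
  assumes "linear_op A"
  shows "subspace (eigsum A N)"
proof (rule subspaceI)
  note A = linear_opD[OF assms]
  show "0 \<in> eigsum A N" unfolding eigsum_def by (rule CollectI, rule exI[of _ "\<lambda>_. 0"]) (simp add: A)
  fix x y assume "x \<in> eigsum A N" "y \<in> eigsum A N"
  then obtain w w' where "x = (\<Sum>e\<in>N. w e)" "y = (\<Sum>e\<in>N. w' e)"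
    "\<forall>e\<in>N. A (w e) = scale e (w e)" "\<forall>e\<in>N. A (w' e) = scale e (w' e)" by (auto simp: eigsum_def)
  then show "x + y \<in> eigsum A N" unfolding eigsum_def
    by (intro CollectI exI[of _ "\<lambda>e. w e + w' e"]) (simp add: A sum.distrib scale_right_distrib)
next
  note A = linear_opD[OF assms]
  fix x c assume "x \<in> eigsum A N"
  then obtain w where "x = (\<Sum>e\<in>N. w e)" "\<forall>e\<in>N. A (w e) = scale e (w e)" by (auto simp: eigsum_def)
  then show "scale c x \<in> eigsum A N" unfolding eigsum_def
    by (intro CollectI exI[of _ "\<lambda>e. scale c (w e)"]) (simp add: A scale_sum_right mult.commute)
qed

lemma eigsum_mono:
  assumes "linear_op A" "N \<subseteq> N'" "finite N'"
  shows "eigsum A N \<subseteq> eigsum A N'"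
proof
  fix x assume "x \<in> eigsum A N"
  then obtain w where w: "x = (\<Sum>e\<in>N. w e)" "\<forall>e\<in>N. A (w e) = scale e (w e)" by (auto simp: eigsum_def)
  have "(\<Sum>e\<in>N'. if e \<in> N then w e else 0) = x"
    unfolding w(1) using assms by (intro sum.mono_neutral_cong_right) auto
  then show "x \<in> eigsum A N'" unfolding eigsum_def
    using w(2) linear_opD(3)[OF assms(1)]
      by (intro CollectI exI[of _ "\<lambda>e. if e \<in> N then w e else 0"]) auto
qed

lemma eigsum_subset_span: "eigsum A N \<subseteq> span (eigvecs A)"
proof
  fix x assume "x \<in> eigsum A N"
  then obtain w where w: "x = (\<Sum>e\<in>N. w e)" "\<forall>e\<in>N. A (w e) = scale e (w e)" by (auto simp: eigsum_def)
  show "x \<in> span (eigvecs A)" unfolding w(1)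
    by (rule span_sum, rule span_base) (use w(2) in \<open>auto simp: eigvecs_def\<close>)
qed

lemma span_eigvecs_eigsum:
  assumes A: "linear_op A" and x: "x \<in> span (eigvecs A)"
  shows "\<exists>N. finite N \<and> x \<in> eigsum A N"
proof (rule span_induct[OF x])
  show "subspace {x. \<exists>N. finite N \<and> x \<in> eigsum A N}"
  proof (rule subspaceI; clarsimp)
    show "\<exists>N. finite N \<and> 0 \<in> eigsum A N"
      using subspace_0[OF subspace_eigsum[OF A]] by (intro exI[of _ "{}"]) auto
  next
    fix x y N N' assume "finite N" "finite N'" "x \<in> eigsum A N" "y \<in> eigsum A N'"
    moreover from this have "x \<in> eigsum A (N \<union> N')" "y \<in> eigsum A (N \<union> N')"
      using eigsum_mono[OF A, of _ "N \<union> N'"] by auto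
    ultimately show "\<exists>N. finite N \<and> x + y \<in> eigsum A N"
      by (intro exI[of _ "N \<union> N'"]) (auto intro: subspace_add[OF subspace_eigsum[OF A]])
  next
    fix c x N assume "finite N" "x \<in> eigsum A N"
    then show "\<exists>N. finite N \<and> scale c x \<in> eigsum A N"
      by (intro exI[of _ N]) (auto intro: subspace_scale[OF subspace_eigsum[OF A]])
  qed
  fix x assume "x \<in> eigvecs A"
  then obtain e where "A x = scale e x" by (auto simp: eigvecs_def)
  then show "\<exists>N. finite N \<and> x \<in> eigsum A N"
    by (intro exI[of _ "{e}"]) (auto simp: eigsum_def intro: exI[of _ "\<lambda>_. x"])
qed

text \<open>Simultaneous diagonalisation. The span of the \<open>B\<close>-eigenvectors is
  \<open>A\<close>-stable, so it contains each \<open>A\<close>-component of \<open>x\<close>; the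
  \<open>A\<close>-eigenspace of such a component is \<open>B\<close>-stable, so it contains its
  \<open>B\<close>-parts, on which \<open>A + B\<close> is a scalar.\<close>

lemma span_eigvecs_add:
  assumes A: "linear_op A" and B: "linear_op B" and comm: "\<And>x. A (B x) = B (A x)"
    and x: "x \<in> span (eigvecs A)" "x \<in> span (eigvecs B)"
  shows "x \<in> span (eigvecs (\<lambda>x. A x + B x))"
proof -
  obtain N w where N: "finite N" "x = (\<Sum>e\<in>N. w e)" "\<And>e. e \<in> N \<Longrightarrow> A (w e) = scale e (w e)"
    using span_eigvecs_eigsum[OF A x(1)] by (auto simp: eigsum_def)
  have stable: "A y \<in> span (eigvecs B)" if "y \<in> span (eigvecs B)" for y
  proof (rule span_induct[OF that])
    show "subspace {y. A y \<in> span (eigvecs B)}"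
      using linear_opD[OF A] by (auto simp: subspace_def intro: span_zero span_add span_scale)
    fix y assume "y \<in> eigvecs B"
    then obtain e where e: "B y = scale e y" by (auto simp: eigvecs_def)
    have "B (A y) = scale e (A y)" using comm[of y] linear_opD(2)[OF A, of e y] e by simp
    then show "A y \<in> span (eigvecs B)" by (auto simp: eigvecs_def intro: span_base)
  qed
  have "w e \<in> span (eigvecs (\<lambda>x. A x + B x))" if e: "e \<in> N" for e
  proof -
    have "w e \<in> span (eigvecs B)"
      using eigsum_component[OF A subspace_span stable N(1,3)] N(2) x(2) e by simp
    then obtain M u where M: "finite M" "w e = (\<Sum>m\<in>M. u m)" "\<And>m. m \<in> M \<Longrightarrow> B (u m) = scale m (u m)"
      using span_eigvecs_eigsum[OF B] by (force simp: eigsum_def)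
    have Y: "subspace {x. A x = scale e x}"
      using linear_opD[OF A] by (auto simp: subspace_def scale_right_distrib mult.commute)
    have Bst: "B x \<in> {x. A x = scale e x}" if "x \<in> {x. A x = scale e x}" for x
      using that comm linear_opD(2)[OF B] by simp
    have "u m \<in> {x. A x = scale e x}" if "m \<in> M" for m
      by (rule eigsum_component[OF B Y Bst M(1,3)]) (use that M(2) N(3)[OF e] in auto)
    then have "u m \<in> eigvecs (\<lambda>x. A x + B x)" if "m \<in> M" for m
      using M(3)[OF that] that unfolding eigvecs_def by (auto simp flip: scale_left_distrib)
    then show ?thesis unfolding M(2) by (auto intro: span_sum span_base)
  qed
  then show ?thesis unfolding N(2) by (auto intro: span_sum)
qed

text \<open>Unlike a decomposition into eigenvectors, this product of the \<open>A - e\<close> can be evaluated on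
  cochains one argument tuple at a time.\<close>

fun kill :: "('b \<Rightarrow> 'b) \<Rightarrow> 'a list \<Rightarrow> 'b \<Rightarrow> 'b" where
  "kill A [] v = v"
| "kill A (e # es) v = kill A es (A v - scale e v)"

text \<open>The factors \<open>A - e\<close> are applied in turn, each removing one eigenvalue from
  the decomposition.\<close>

lemma kill_eigsum:
  assumes A: "linear_op A"
  shows "v \<in> eigsum A (set es) \<Longrightarrow> kill A es v = 0"
proof (induction es arbitrary: v)
  case (Cons m es)
  note AD = linear_opD[OF A]
  obtain w where w: "v = (\<Sum>e\<in>set (m # es). w e)" "\<And>e. e \<in> set (m # es) \<Longrightarrow> A (w e) = scale e (w e)"
    using Cons.prems by (auto simp: eigsum_def)
  have "A v - scale m v = (\<Sum>e\<in>set (m # es). A (w e) - scale m (w e))"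
    unfolding w(1) by (simp only: AD scale_sum_right sum_subtractf)
  also have "\<dots> = (\<Sum>e\<in>set (m # es). scale (e - m) (w e))"
    using w(2) by (intro sum.cong refl) (simp add: scale_left_diff_distrib)
  also have "\<dots> = (\<Sum>e\<in>set es. scale (e - m) (w e))"
    by (rule sum.mono_neutral_right) auto
  also have "\<dots> \<in> eigsum A (set es)" unfolding eigsum_def
    by (rule CollectI, rule exI[of _ "\<lambda>e. scale (e - m) (w e)"]) (use w(2) AD in \<open>auto simp: mult.commute\<close>)
  finally show ?case using Cons.IH by simp
qed (simp add: eigsum_def)

text \<open>This is how diagonalisability is established on cochains: an annihilating product with
  simple roots forces a sum of eigenvectors.\<close>

lemma kill_0_eigsum:
  assumes A: "linear_op A"
  shows "distinct es \<Longrightarrow> kill A es v = 0 \<Longrightarrow> v \<in> eigsum A (set es)"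
proof (induction es arbitrary: v)
  case Nil
  then show ?case by (simp add: eigsum_def)
next
  case (Cons m es)
  note AD = linear_opD[OF A]
  have "A v - scale m v \<in> eigsum A (set es)" using Cons by simp
  then obtain w where w: "A v - scale m v = (\<Sum>e\<in>set es. w e)"
      "\<And>e. e \<in> set es \<Longrightarrow> A (w e) = scale e (w e)" by (auto simp: eigsum_def)
  \<comment> \<open>A preimage of \<open>A v - m v\<close> under \<open>A - m\<close> is found by
    dividing each eigenvector by \<open>e - m\<close>, nonzero since \<open>m\<close> does not occur
    in \<open>es\<close>. The rest \<open>u\<close> of \<open>v\<close> then lies in the kernel of
    \<open>A - m\<close>.\<close>
  define w' where "w' e = scale (inverse (e - m)) (w e)" for e
  define u where "u = v - (\<Sum>e\<in>set es. w' e)"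
  have w': "A (w' e) = scale e (w' e)" "scale (e - m) (w' e) = w e" if "e \<in> set es" for e
  proof -
    have "e - m \<noteq> 0" using that Cons.prems(1) by auto
    then show "A (w' e) = scale e (w' e)" "scale (e - m) (w' e) = w e"
      using w(2)[OF that] by (simp_all add: w'_def AD mult.commute)
  qed
  have "A u - scale m u = (A v - scale m v) - (\<Sum>e\<in>set es. scale (e - m) (w' e))"
    using w'(1) by (simp add: u_def AD scale_right_diff_distrib scale_sum_right
      scale_left_diff_distrib sum_subtractf)
  also have "\<dots> = 0" using w w' by simp
  finally have u: "A u = scale m u" by simp
  have "v = (\<Sum>e\<in>set (m # es). if e = m then u else w' e)"
  proof -
    have "(\<Sum>e\<in>set es. if e = m then u else w' e) = (\<Sum>e\<in>set es. w' e)"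
      using Cons.prems(1) by (intro sum.cong) auto
    then show ?thesis using Cons.prems(1) by (simp add: u_def)
  qed
  then show ?case unfolding eigsum_def
    by (intro CollectI exI[of _ "\<lambda>e. if e = m then u else w' e"]) (use u w' in auto)
qed

end

section \<open>Extension of scalars\<close>

text \<open>The extension of scalars of \<open>V\<close> embeds into the additive maps to \<open>V\<close> from the space of
  linear functionals on the algebraic closure: \<open>v \<otimes> c\<close> is the map \<open>\<phi> \<mapsto> \<phi> c v\<close>. Operators and
  subspaces of \<open>V\<close> extend to such maps pointwise.\<close>

definition lin_func :: "('k::field alg_closure \<Rightarrow> 'k) \<Rightarrow> bool" where
  "lin_func \<phi> \<longleftrightarrow> (\<forall>x y. \<phi> (x + y) = \<phi> x + \<phi> y) \<and> (\<forall>a x. \<phi> (to_ac a * x) = a * \<phi> x)"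

lemma lin_func_add: "\<lbrakk>lin_func \<phi>; lin_func \<psi>\<rbrakk> \<Longrightarrow> lin_func (\<phi> + \<psi>)"
  unfolding lin_func_def plus_fun_apply by (metis add.assoc add.left_commute distrib_left)

lemma lin_func_comp:
  assumes "lin_func \<phi>"
  shows "lin_func (\<lambda>x. \<phi> (c * x))"
  unfolding lin_func_def
proof (intro conjI allI)
  fix x y a
  show "\<phi> (c * (x + y)) = \<phi> (c * x) + \<phi> (c * y)"
    using assms unfolding lin_func_def distrib_left by blast
  show "\<phi> (c * (to_ac a * x)) = a * \<phi> (c * x)"
    using assms unfolding lin_func_def mult.left_commute[of c] by blast
qed

text \<open>A retraction of the closure onto the ground field, obtained by extending from the
  independent set \<open>{1}\<close>. Evaluating at it recovers \<open>v\<close> from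
  \<open>v \<otimes> 1\<close>.\<close>

lemma exists_lin_func: "\<exists>\<phi> :: 'k::field alg_closure \<Rightarrow> 'k. lin_func \<phi> \<and> \<phi> 1 = 1"
proof -
  interpret vector_space_pair "\<lambda>a (x :: 'k alg_closure). to_ac a * x" "(*) :: 'k \<Rightarrow> 'k \<Rightarrow> 'k"
    by unfold_locales (simp_all add: distrib_left distrib_right mult.assoc)
  have "\<exists>g. Vector_Spaces.linear (\<lambda>a (x :: 'k alg_closure). to_ac a * x) (*) g \<and> (\<forall>x\<in>{1}. g x = (1 :: 'k))"
  proof (rule linear_independent_extend)
    show "vs1.independent {1}" unfolding vs1.dependent_single by (rule one_neq_zero)
  qed
  then show ?thesis
    unfolding lin_func_def Vector_Spaces.linear_iff by blast
qed

text \<open>A type rather than a carrier set, so that \<open>eigen_space\<close> applies to it over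
  the closure. Values off the linear functionals are fixed to zero, so that equality is decided on
  these functionals.\<close>

typedef (overloaded) ('k, 'v) ext = "{G :: ('k::field alg_closure \<Rightarrow> 'k) \<Rightarrow> 'v::ab_group_add.
    (\<forall>\<phi> \<psi>. lin_func \<phi> \<longrightarrow> lin_func \<psi> \<longrightarrow> G (\<phi> + \<psi>) = G \<phi> + G \<psi>) \<and> (\<forall>\<phi>. \<not> lin_func \<phi> \<longrightarrow> G \<phi> = 0)}"
  by (rule exI[of _ "\<lambda>_. 0"]) simp

setup_lifting type_definition_ext

instantiation ext :: (field, ab_group_add) ab_group_add
begin

lift_definition zero_ext :: "('a, 'b) ext" is "\<lambda>_. 0" by simp
lift_definition plus_ext :: "('a, 'b) ext \<Rightarrow> ('a, 'b) ext \<Rightarrow> ('a, 'b) ext" is "\<lambda>G G' \<phi>. G \<phi> + G' \<phi>"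
  by simp
lift_definition minus_ext :: "('a, 'b) ext \<Rightarrow> ('a, 'b) ext \<Rightarrow> ('a, 'b) ext" is "\<lambda>G G' \<phi>. G \<phi> - G' \<phi>"
  by simp
lift_definition uminus_ext :: "('a, 'b) ext \<Rightarrow> ('a, 'b) ext" is "\<lambda>G \<phi>. - G \<phi>"
  by simp

instance by standard (transfer; simp add: fun_eq_iff)+

end

text \<open>Multiplication acts through the functional: for \<open>v \<otimes> x\<close> the value
  \<open>\<phi> x v\<close> becomes \<open>\<phi> (c x) v\<close>.\<close>

lift_definition escale :: "'k alg_closure \<Rightarrow> ('k::field, 'v::ab_group_add) ext \<Rightarrow> ('k, 'v) ext"
  is "\<lambda>c G \<phi>. if lin_func \<phi> then G (\<lambda>x. \<phi> (c * x)) else 0"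
  subgoal for c G
    using lin_func_add lin_func_comp[of _ c] by (auto simp: plus_fun_def)
  done

lemma Rep_ext_add: "lin_func \<phi> \<Longrightarrow> lin_func \<psi> \<Longrightarrow> Rep_ext G (\<phi> + \<psi>) = Rep_ext G \<phi> + Rep_ext G \<psi>"
  and Rep_ext_off: "\<not> lin_func \<phi> \<Longrightarrow> Rep_ext G \<phi> = 0"
  using Rep_ext[of G] by auto

lemma ext_eqI:
  assumes "\<And>\<phi>. lin_func \<phi> \<Longrightarrow> Rep_ext G \<phi> = Rep_ext G' \<phi>"
  shows "G = G'"
proof -
  have "Rep_ext G \<phi> = Rep_ext G' \<phi>" for \<phi> using assms Rep_ext_off by metis
  then show ?thesis by (simp add: Rep_ext_inject[symmetric] fun_eq_iff)
qed

lemmas Rep_ext_ops = plus_ext.rep_eq minus_ext.rep_eq uminus_ext.rep_eq zero_ext.rep_eq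

lemma Rep_escale: "lin_func \<phi> \<Longrightarrow> Rep_ext (escale c G) \<phi> = Rep_ext G (\<lambda>x. \<phi> (c * x))"
  by (simp add: escale.rep_eq)

interpretation E: eigen_space "escale :: _ \<Rightarrow> ('k::field, 'v::ab_group_add) ext \<Rightarrow> _"
proof unfold_locales
  fix a b :: "'k alg_closure" and x y :: "('k, 'v) ext"
  show "escale a (x + y) = escale a x + escale a y"
    by (rule ext_eqI) (simp add: Rep_escale Rep_ext_ops)
  show "escale (a + b) x = escale a x + escale b x"
  proof (rule ext_eqI)
    fix \<phi> :: "'k alg_closure \<Rightarrow> 'k" assume \<phi>: "lin_func \<phi>"
    then have "(\<lambda>x. \<phi> ((a + b) * x)) = (\<lambda>x. \<phi> (a * x)) + (\<lambda>x. \<phi> (b * x))"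
      by (simp add: lin_func_def fun_eq_iff distrib_right)
    then show "Rep_ext (escale (a + b) x) \<phi> = Rep_ext (escale a x + escale b x) \<phi>"
      using \<phi> by (simp add: Rep_escale Rep_ext_ops Rep_ext_add lin_func_comp)
  qed
  show "escale a (escale b x) = escale (a * b) x"
    by (rule ext_eqI) (simp add: Rep_escale lin_func_comp mult.assoc)
  show "escale 1 x = x"
    by (rule ext_eqI) (simp add: Rep_escale)
qed

definition emap :: "('v \<Rightarrow> 'v) \<Rightarrow> ('k::field, 'v::ab_group_add) ext \<Rightarrow> ('k, 'v) ext" where
  "emap f G = Abs_ext (\<lambda>\<phi>. f (Rep_ext G \<phi>))"

text \<open>Under the embedding this is \<open>v \<otimes> 1\<close>.\<close>

definition unit_ext :: "('k \<Rightarrow> 'v \<Rightarrow> 'v) \<Rightarrow> 'v \<Rightarrow> ('k::field, 'v::ab_group_add) ext" where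
  "unit_ext s v = Abs_ext (\<lambda>\<phi>. if lin_func \<phi> then s (\<phi> 1) v else 0)"

lemma Rep_emap:
  assumes "\<And>x y. f (x + y) = f x + f y"
  shows "Rep_ext (emap f G) \<phi> = f (Rep_ext G \<phi>)"
proof -
  have "f 0 = 0" using assms[of 0 0] by simp
  then show ?thesis unfolding emap_def
    by (subst Abs_ext_inverse) (auto simp: Rep_ext_add Rep_ext_off assms)
qed

lemma Rep_unit_ext:
  assumes "vector_space s"
  shows "lin_func \<phi> \<Longrightarrow> Rep_ext (unit_ext s v) \<phi> = s (\<phi> 1) v"
proof -
  interpret vector_space s by fact
  show "lin_func \<phi> \<Longrightarrow> Rep_ext (unit_ext s v) \<phi> = s (\<phi> 1) v" unfolding unit_ext_def
    by (subst Abs_ext_inverse) (auto simp: lin_func_add scale_left_distrib)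
qed

context eigen_space
begin

lemma linear_op_emap:
  assumes "linear_op f"
  shows "E.linear_op (emap f :: ('a, 'b) ext \<Rightarrow> _)"
  unfolding E.linear_op_def
  using linear_opD(1,3)[OF assms] by (auto intro!: ext_eqI simp: Rep_emap Rep_ext_ops Rep_escale)

lemma emap_unit_ext:
  assumes "linear_op f"
  shows "emap f (unit_ext scale v) = unit_ext scale (f v)"
  using linear_opD[OF assms]
  by (intro ext_eqI) (simp add: Rep_emap Rep_unit_ext[OF vector_space_axioms])

lemma unit_ext_add: "unit_ext scale (v + w) = unit_ext scale v + unit_ext scale w"
  by (intro ext_eqI) (simp add: Rep_unit_ext[OF vector_space_axioms] Rep_ext_ops scale_right_distrib)

lemma unit_ext_scale: "unit_ext scale (scale c v) = escale (to_ac c) (unit_ext scale v)"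
proof (intro ext_eqI)
  fix \<phi> :: "'a alg_closure \<Rightarrow> 'a" assume \<phi>: "lin_func \<phi>"
  then have "\<phi> (to_ac c) = c * \<phi> 1" by (metis lin_func_def mult.right_neutral)
  then show "Rep_ext (unit_ext scale (scale c v)) \<phi> = Rep_ext (escale (to_ac c) (unit_ext scale v)) \<phi>"
    using \<phi> lin_func_comp[OF \<phi>, of "to_ac c"]
    by (simp add: Rep_unit_ext[OF vector_space_axioms] Rep_escale mult.commute)
qed

lemma unit_ext_0: "unit_ext scale 0 = 0"
  by (intro ext_eqI) (simp add: Rep_unit_ext[OF vector_space_axioms] Rep_ext_ops)

lemma subspace_unit_ext:
  assumes "E.subspace Y"
  shows "subspace {v. unit_ext scale v \<in> Y}"
  using assms by (auto simp: subspace_def unit_ext_0 unit_ext_add unit_ext_scale E.subspace_0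
    E.subspace_add E.subspace_scale)

text \<open>This passes from the algebraic closure back to the ground field. Applied to the stable
  subspace generated by \<open>f (f v)\<close>, it says that zero is at most a simple root of the minimal
  polynomial of \<open>v\<close>.\<close>

lemma stable_subspace_eigvecs:
  assumes f: "linear_op f" and v: "unit_ext scale v \<in> E.span (E.eigvecs (emap f))"
    and Y: "subspace Y" "\<And>y. y \<in> Y \<Longrightarrow> f y \<in> Y" and ff: "f (f v) \<in> Y"
  shows "f v \<in> Y"
proof -
  let ?f = "emap f :: ('a, 'b) ext \<Rightarrow> _"
  define EY :: "('a, 'b) ext set" where "EY = {G. \<forall>\<phi>. Rep_ext G \<phi> \<in> Y}"
  have EY: "E.subspace EY"
  proof (rule E.subspaceI)
    fix c and G :: "('a, 'b) ext" assume "G \<in> EY"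
    then have "Rep_ext (escale c G) \<phi> \<in> Y" for \<phi>
      by (cases "lin_func \<phi>") (auto simp: EY_def Rep_escale Rep_ext_off subspace_0[OF Y(1)])
    then show "escale c G \<in> EY" by (simp add: EY_def)
  qed (auto simp: EY_def Rep_ext_ops subspace_0[OF Y(1)] subspace_add[OF Y(1)])
  note ef = linear_op_emap[OF f]
  have stable: "?f G \<in> EY" if "G \<in> EY" for G
    using that Y(2) linear_opD(1)[OF f] by (simp add: EY_def Rep_emap)
  obtain N w where N: "finite N" "unit_ext scale v = (\<Sum>e\<in>N. w e)"
      "\<And>e. e \<in> N \<Longrightarrow> ?f (w e) = escale e (w e)"
    using E.span_eigvecs_eigsum[OF ef v] by (auto simp: E.eigsum_def)
  note efD = E.linear_opD[OF ef]
  have unit_EY: "unit_ext scale x \<in> EY" if "x \<in> Y" for x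
  proof -
    have "Rep_ext (unit_ext scale x) \<phi> \<in> Y" for \<phi>
      by (cases "lin_func \<phi>")
        (use that Y(1) in \<open>auto simp: Rep_unit_ext[OF vector_space_axioms] Rep_ext_off subspace_0
            subspace_scale\<close>)
    then show ?thesis by (simp add: EY_def)
  qed
  have 1: "?f (unit_ext scale v) = (\<Sum>e\<in>N. escale e (w e))"
    unfolding N(2) efD using N(3) by (intro sum.cong) auto
  then have "unit_ext scale (f (f v)) = (\<Sum>e\<in>N. escale (e * e) (w e))"
    using N(3) by (simp add: emap_unit_ext[OF f, symmetric] efD cong: sum.cong)
  then have "(\<Sum>e\<in>N. escale (e * e) (w e)) \<in> EY" using unit_EY[OF ff] by simp
  \<comment> \<open>The components of \<open>f (f v)\<close> are \<open>e^2 w_e\<close>; stability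
    puts each of them into \<open>EY\<close>, and dividing by \<open>e\<close> where it is nonzero
    puts \<open>e w_e\<close>, the components of \<open>f v\<close>, there as well.\<close>
  then have sq: "escale (e * e) (w e) \<in> EY" if "e \<in> N" for e
    by (intro E.eigsum_component[OF ef EY stable N(1), where w = "\<lambda>e. escale (e * e) (w e)"])
      (use that N(3) efD in \<open>auto simp: mult.commute\<close>)
  have "escale e (w e) \<in> EY" if "e \<in> N" for e
  proof (cases "e = 0")
    case True
    then show ?thesis by (simp add: E.subspace_0[OF EY])
  next
    case False
    then have "inverse e * (e * e) = e" unfolding mult.assoc[symmetric] by simp
    then have "escale (inverse e) (escale (e * e) (w e)) = escale e (w e)" by (simp only: E.scale_scale)
    then show ?thesis using E.subspace_scale[OF EY sq[OF that], of "inverse e"] by metis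
  qed
  then have "unit_ext scale (f v) \<in> EY"
    using 1 by (simp add: emap_unit_ext[OF f] E.subspace_sum[OF EY])
  \<comment> \<open>Evaluation at a functional with \<open>\<phi> 1 = 1\<close> returns from
    \<open>EY\<close> to \<open>Y\<close>.\<close>
  moreover obtain \<phi> :: "'a alg_closure \<Rightarrow> 'a" where "lin_func \<phi>" "\<phi> 1 = 1" using exists_lin_func by blast
  ultimately show "f v \<in> Y"
    by (auto simp: EY_def Rep_unit_ext[OF vector_space_axioms] dest!: spec[of _ \<phi>])
qed

text \<open>The coordinates in \<open>semisimple_operator\<close> live on the presented extension of
  scalars. A class with coordinates supported at one index is an eigenvector there;
  \<open>\<tau>\<close> carries it to an eigenvector in \<open>ext\<close>, and
  \<open>unit_ext scale v\<close> is a finite sum of such images.\<close>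

lemma semisimple_operator_eigvecs:
  assumes f: "linear_op f" and ss: "semisimple_operator scale f"
  shows "unit_ext scale v \<in> E.span (E.eigvecs (emap f))"
proof -
  interpret F: vector_space "fscale :: 'a alg_closure \<Rightarrow> ('b \<Rightarrow>\<^sub>0 'a alg_closure) \<Rightarrow> _"
    by (rule vector_space_fscale)
  let ?f = "emap f :: ('a, 'b) ext \<Rightarrow> _"
  define R where "R = F.span (closure_relations scale)"
  define push :: "('b \<Rightarrow>\<^sub>0 'a alg_closure) \<Rightarrow> 'b \<Rightarrow>\<^sub>0 'a alg_closure"
    where "push = extend_linear fscale (\<lambda>v. Poly_Mapping.single (f v) 1)"
  \<comment> \<open>The map \<open>v \<otimes> c \<mapsto> c (v \<otimes> 1)\<close>, from formal
    sums into \<open>ext\<close>.\<close>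
  define \<tau> :: "('b \<Rightarrow>\<^sub>0 'a alg_closure) \<Rightarrow> ('a, 'b) ext" where "\<tau> = extend_linear escale (unit_ext scale)"
  have R: "F.subspace R" by (simp add: R_def)
  have push_add: "push (p + q) = push p + push q" and push_scale: "push (fscale c p) = fscale c (push p)"
    and push_single: "push (Poly_Mapping.single x c) = Poly_Mapping.single (f x) c" for p q c x
    by (simp_all add: push_def F.extend_linear_add F.extend_linear_fscale)
  have push_diff: "push (p - q) = push p - push q" for p q using push_add[of "p - q" q] by simp
  have \<tau>_add: "\<tau> (p + q) = \<tau> p + \<tau> q" and \<tau>_scale: "\<tau> (fscale c p)
      = escale c (\<tau> p)" and \<tau>_diff: "\<tau> (p - q) = \<tau> p - \<tau> q"
    and \<tau>_single: "\<tau> (Poly_Mapping.single x c) = escale c (unit_ext scale x)" for p q c x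
    by (simp_all add: \<tau>_def E.extend_linear_add E.extend_linear_fscale E.extend_linear_diff)
  have \<tau>_R: "\<tau> p = 0" if "p \<in> R" for p
    unfolding \<tau>_def
  proof (rule E.extend_linear_span_zero[OF _ that[unfolded R_def]])
    fix p assume "p \<in> closure_relations scale"
    then have "\<tau> p = 0"
      by (auto simp: closure_relations_def \<tau>_diff \<tau>_single unit_ext_add unit_ext_scale)
    then show "extend_linear escale (unit_ext scale) p = 0" by (simp add: \<tau>_def)
  qed
  have push_R: "push p \<in> R" if "p \<in> R" for p
    using that unfolding R_def
  proof (rule F.span_induct)
    show "F.subspace {p. push p \<in> F.span (closure_relations scale)}"
      using push_add push_scale push_diff[of 0 0]
      by (auto simp: F.subspace_def intro: F.span_zero F.span_add F.span_scale)
    fix p assume "p \<in> closure_relations scale"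
    then consider (add) v w
        where "p = Poly_Mapping.single (v + w) 1 - Poly_Mapping.single v 1 - Poly_Mapping.single w 1"
      | (scale) c v where "p = Poly_Mapping.single (scale c v) 1 - Poly_Mapping.single v (to_ac c)"
      unfolding closure_relations_def by blast
    then have "push p \<in> closure_relations scale"
    proof cases
      case add
      then have "push p = Poly_Mapping.single (f v + f w) 1 - Poly_Mapping.single (f v) 1
          - Poly_Mapping.single (f w) 1"
        by (simp add: push_diff push_single linear_opD[OF f])
      then show ?thesis unfolding closure_relations_def by blast
    next
      case scale
      then have "push p = Poly_Mapping.single (c *s f v) 1 - Poly_Mapping.single (f v) (to_ac c)"
        by (simp add: push_diff push_single linear_opD[OF f])
      then show ?thesis unfolding closure_relations_def by blast
    qed
    then show "push p \<in> F.span (closure_relations scale)" by (rule F.span_base)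
  qed
  have push_eq: "(\<lambda>p. \<Sum>v \<in> Poly_Mapping.keys p. Poly_Mapping.single (f v) (Poly_Mapping.lookup p v)) = push"
    by (simp add: push_def extend_linear_def fun_eq_iff)
  have closure_map: "closure_map scale f (coset_of R p) = coset_of R (push p)" for p
    unfolding closure_map_def push_eq R_def[symmetric]
    by (rule F.induced_coset_of[OF R]) (auto simp: push_add F.subspace_0[OF R] push_R)
  have \<tau>_push: "\<tau> (push p) = ?f (\<tau> p)" for p
  proof -
    have "p \<in> free_on UNIV" by (simp add: free_on_def)
    then show ?thesis
      by (induction p rule: free_on_induct)
        (use push_diff[of 0 0] \<tau>_diff[of 0 0] in \<open>simp_all add: push_add \<tau>_add push_single \<tau>_single
          E.linear_opD[OF linear_op_emap[OF f]] emap_unit_ext[OF f]\<close>)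
  qed
  note quot = F.quotient_module_simps[OF R]
  have ce: "closure_extension scale = quotient_module fscale UNIV R"
    by (simp add: closure_extension_def R_def)
  have carrier: "carrier (closure_extension scale) = range (coset_of R)" by (simp add: ce quot)
  obtain I :: "'b set" and a :: "'b \<Rightarrow> 'a alg_closure" and \<Phi> where
    iso: "linear_iso \<Phi> (closure_extension scale) (subspace_module fscale (free_on I))" and
    diag: "\<And>x. x \<in> carrier (closure_extension scale) \<Longrightarrow>
           \<Phi> (closure_map scale f x) = Poly_Mapping.mapp (\<lambda>i c. a i * c) (\<Phi> x)"
    using ss unfolding semisimple_operator_def by blast
  have bij: "bij_betw \<Phi> (range (coset_of R)) (free_on I)"
    and \<Phi>_add: "\<Phi> (coset_of R (p + q)) = \<Phi> (coset_of R p) + \<Phi> (coset_of R q)"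
    and \<Phi>_scale: "\<Phi> (coset_of R (fscale c p)) = fscale c (\<Phi> (coset_of R p))" for p q c
    using iso unfolding linear_iso_iff carrier by (simp_all add: ce quot)
  have inj: "p - q \<in> R" if "\<Phi> (coset_of R p) = \<Phi> (coset_of R q)" for p q
  proof -
    have "coset_of R p = coset_of R q"
      using bij that by (auto simp: bij_betw_def inj_on_def)
    then show ?thesis by (simp add: F.coset_of_eq_iff[OF R])
  qed
  have surj: "\<exists>r. \<Phi> (coset_of R r) = p" if "p \<in> free_on I" for p
  proof -
    have "p \<in> \<Phi> ` range (coset_of R)" using bij that by (simp add: bij_betw_def)
    then show ?thesis by blast
  qed
  \<comment> \<open>Induction runs over coordinate vectors instead of formal sums, since it is the
    coordinates that split into eigenvectors; \<open>r\<close> ranges over all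
    representatives.\<close>
  have "\<forall>r. \<Phi> (coset_of R r) = p \<longrightarrow> \<tau> r \<in> E.span (E.eigvecs ?f)" if "p \<in> free_on I" for p
    using that
  proof (induction p rule: free_on_induct)
    case zero
    have "\<Phi> (coset_of R 0) = 0" using \<Phi>_add[of 0 0] by simp
    then have "\<tau> r = 0" if "\<Phi> (coset_of R r) = 0" for r using inj[of r 0] that \<tau>_R by simp
    then show ?case by (simp add: E.span_zero)
  next
    case (add p q)
    obtain r1 r2 where r: "\<Phi> (coset_of R r1) = p" "\<Phi> (coset_of R r2) = q" using surj add.hyps by metis
    have "\<tau> r = \<tau> r1 + \<tau> r2" if "\<Phi> (coset_of R r) = p + q" for r
    proof -
      have "r - (r1 + r2) \<in> R" using inj that r \<Phi>_add by simp
      then have "\<tau> (r - (r1 + r2)) = 0" by (rule \<tau>_R)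
      then show ?thesis by (simp add: \<tau>_diff \<tau>_add)
    qed
    then show ?case using add.IH r by (simp add: E.span_add)
  next
    case (single i c)
    have "?f (\<tau> r) = escale (a i) (\<tau> r)" if r: "\<Phi> (coset_of R r) = Poly_Mapping.single i c" for r
    proof -
      have "\<Phi> (coset_of R (push r)) = Poly_Mapping.mapp (\<lambda>i c. a i * c) (Poly_Mapping.single i c)"
        using diag[of "coset_of R r"] r by (simp add: carrier closure_map)
      also have "\<dots> = fscale (a i) (Poly_Mapping.single i c)"
        by (rule poly_mapping_eqI) (simp add: lookup_mapp lookup_single when_def in_keys_iff)
      also have "\<dots> = \<Phi> (coset_of R (fscale (a i) r))" unfolding \<Phi>_scale r ..
      finally have "push r - fscale (a i) r \<in> R" by (rule inj)
      from \<tau>_R[OF this] show ?thesis by (simp add: \<tau>_diff \<tau>_push \<tau>_scale)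
    qed
    then show ?case by (auto simp: E.eigvecs_def intro!: E.span_base)
  qed
  moreover have "\<Phi> (coset_of R (Poly_Mapping.single v 1)) \<in> free_on I"
    using bij by (auto simp: bij_betw_def)
  ultimately have "\<tau> (Poly_Mapping.single v 1) \<in> E.span (E.eigvecs ?f)" by blast
  then show ?thesis by (simp add: \<tau>_single)
qed

end

section \<open>Toral actions on cochains\<close>

context eigen_space
begin

text \<open>One list of eigenvalues has to work for the whole span, because on cochains the same
  product \<open>kill\<close> is evaluated at every argument tuple.\<close>

lemma finite_common_eigsum:
  assumes f: "linear_op f" and B: "finite B" and ev: "\<And>b. b \<in> B \<Longrightarrow> unit_ext scale b
      \<in> E.span (E.eigvecs (emap f))"
  shows "\<exists>es. distinct es \<and> (\<forall>v\<in>span B. unit_ext scale v \<in> E.eigsum (emap f) (set es))"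
proof -
  note ef = linear_op_emap[OF f]
  obtain N where N: "\<And>b. b \<in> B \<Longrightarrow> finite (N b) \<and> unit_ext scale b \<in> E.eigsum (emap f) (N b)"
    using E.span_eigvecs_eigsum[OF ef ev] by metis
  have "finite (\<Union>b\<in>B. N b)" using B N by auto
  then obtain es where es: "set es = (\<Union>b\<in>B. N b)" "distinct es" using finite_distinct_list by blast
  have "unit_ext scale b \<in> E.eigsum (emap f) (set es)" if "b \<in> B" for b
  proof -
    have "N b \<subseteq> set es" using es(1) that by auto
    then show ?thesis using E.eigsum_mono[OF ef, of "N b" "set es"] N[OF that] by auto
  qed
  then have "span B \<subseteq> {v. unit_ext scale v \<in> E.eigsum (emap f) (set es)}"
    by (intro span_minimal subspace_unit_ext E.subspace_eigsum[OF ef]) auto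
  then show ?thesis using es by blast
qed

end

lemma emap_add:
  assumes "\<And>x y. f (x + y) = f x + f y" "\<And>x y. g (x + y) = g x + g y"
  shows "emap (\<lambda>x. f x + g x) G = emap f G + emap g G"
  by (rule ext_eqI) (simp add: Rep_emap Rep_ext_ops assms algebra_simps)

text \<open>The scalar extension of evaluation at \<open>x\<close>.\<close>

definition eval_ext :: "'x \<Rightarrow> ('k::field, 'x \<Rightarrow> 'v::ab_group_add) ext \<Rightarrow> ('k, 'v) ext" where
  "eval_ext x G = Abs_ext (\<lambda>\<phi>. Rep_ext G \<phi> x)"

lemma Rep_eval_ext: "Rep_ext (eval_ext x G) \<phi> = Rep_ext G \<phi> x"
  unfolding eval_ext_def by (subst Abs_ext_inverse) (auto simp: Rep_ext_add Rep_ext_off)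

context lie_module
begin

sublocale ge: eigen_space scale by unfold_locales
sublocale me: eigen_space mscale by unfold_locales
sublocale we: eigen_space "pointwise mscale :: 'k \<Rightarrow> ('g list \<Rightarrow> 'm) \<Rightarrow> 'g list \<Rightarrow> 'm" by unfold_locales

lemma linear_op_bracket: "ge.linear_op (bracket h)"
  by (simp add: ge.linear_op_def bracket_add_right bracket_scale_right)

lemma linear_op_act: "me.linear_op (act h)"
  by (simp add: me.linear_op_def act_add_right act_scale_right)

lemma linear_op_\<theta>: "we.linear_op (\<theta> S n h)"
  by (simp add: we.linear_op_def \<theta>_add \<theta>_scale)

text \<open>Multilinearity reduces arbitrary arguments to basis tuples. For finite \<open>B\<close>
  the values of one cochain thus span a finite-dimensional space, even when \<open>M\<close> is
  infinite-dimensional.\<close>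

lemma C_values_in_subspace:
  assumes Y: "M.subspace Y" and S: "S = span B"
  shows "\<lbrakk>F \<in> C S n; \<And>bs. bs \<in> tuples n B \<Longrightarrow> F bs \<in> Y; xs \<in> tuples n S\<rbrakk> \<Longrightarrow> F xs \<in> Y"
proof (induction n arbitrary: F xs)
  case (Suc n)
  note F = Suc.prems(1)
  obtain x ys where xs: "xs = x # ys" "x \<in> S" "ys \<in> tuples n S"
    using Suc.prems(3) by (auto simp: tuples_Suc_iff)
  have sub: "subspace S" by (simp add: S)
  have base: "ins b F zs \<in> Y" if "b \<in> B" "zs \<in> tuples n S" for b zs
  proof (rule Suc.IH)
    show "ins b F \<in> C S n" using that by (intro C_ins[OF F]) (simp add: S span_base)
    show "ins b F bs \<in> Y" if "bs \<in> tuples n B" for bs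
      using Suc.prems(2)[of "b # bs"] that \<open>b \<in> B\<close> by (simp add: ins_def)
  qed (rule that)
  have "x \<in> S \<and> ins x F ys \<in> Y"
  proof (rule span_induct[of x B])
    show "x \<in> span B" using xs S by simp
    show "subspace {x. x \<in> S \<and> ins x F ys \<in> Y}"
    proof (rule subspaceI; clarsimp)
      show "0 \<in> S \<and> ins 0 F ys \<in> Y"
        using ins_zero_left[OF F sub] subspace_0[OF sub] M.subspace_0[OF Y] by simp
    next
      fix x y assume "x \<in> S" "ins x F ys \<in> Y" "y \<in> S" "ins y F ys \<in> Y"
      then show "x + y \<in> S \<and> ins (x + y) F ys \<in> Y"
        using ins_add_left[OF F sub] subspace_add[OF sub] M.subspace_add[OF Y] by simp
    next
      fix c x assume "x \<in> S" "ins x F ys \<in> Y"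
      then show "scale c x \<in> S \<and> ins (scale c x) F ys \<in> Y"
        using ins_scale_left[OF F sub] subspace_scale[OF sub] M.subspace_scale[OF Y]
          by (simp add: pointwise_def)
    qed
    show "b \<in> S \<and> ins b F ys \<in> Y" if "b \<in> B" for b
      using base[OF that xs(3)] that by (simp add: S span_base)
  qed
  then show ?case by (simp add: xs ins_def)
qed simp

text \<open>The action is \<open>val_op\<close> minus the sum of all \<open>slot_op\<close>: one
  operator for the values and one for each argument. These commute and are diagonalised
  separately.\<close>

definition val_op :: "'g set \<Rightarrow> nat \<Rightarrow> 'g \<Rightarrow> ('g list \<Rightarrow> 'm) \<Rightarrow> 'g list \<Rightarrow> 'm" where
  "val_op S n h F xs = (if xs \<in> tuples n S then act h (F xs) else 0)"

definition slot_op :: "'g set \<Rightarrow> nat \<Rightarrow> 'g \<Rightarrow> nat \<Rightarrow> ('g list \<Rightarrow> 'm) \<Rightarrow> 'g list \<Rightarrow> 'm" where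
  "slot_op S n h i F xs = (if xs \<in> tuples n S then F (xs[i := bracket h (xs ! i)]) else 0)"

text \<open>Partial sums of that splitting, for adding one slot at a time.\<close>

definition part_op :: "'g set \<Rightarrow> nat \<Rightarrow> 'g \<Rightarrow> nat \<Rightarrow> ('g list \<Rightarrow> 'm) \<Rightarrow> 'g list \<Rightarrow> 'm" where
  "part_op S n h k F xs = val_op S n h F xs - (\<Sum>i<k. slot_op S n h i F xs)"

lemma \<theta>_eq_part_op: "\<theta> S n h = part_op S n h n"
  by (intro ext) (simp add: cochain_action_def part_op_def val_op_def slot_op_def)

lemma linear_ops:
  "we.linear_op (val_op S n h)" "we.linear_op (slot_op S n h i)" "we.linear_op (part_op S n h k)"
  "we.linear_op (\<lambda>F. - slot_op S n h i F)"
  unfolding we.linear_op_def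
  by (auto simp: fun_eq_iff val_op_def slot_op_def part_op_def pointwise_def act_add_right act_scale_right
      sum.distrib M.scale_right_diff_distrib M.scale_sum_right)

context
  fixes S :: "'g set" and h :: 'g
  assumes S: "subspace S" and h: "\<And>x. x \<in> S \<Longrightarrow> bracket h x \<in> S"
begin

lemma upd_in: "xs \<in> tuples n S \<Longrightarrow> i < n \<Longrightarrow> xs[i := bracket h (xs ! i)] \<in> tuples n S"
  by (intro tuples_update h tuples_nth)

lemma slot_val_commute:
  assumes "i < n"
  shows "slot_op S n h i (val_op S n h F) = val_op S n h (slot_op S n h i F)"
  by (rule ext) (simp add: slot_op_def val_op_def upd_in assms)

lemma slot_slot_commute:
  assumes "i < n" "j < n"
  shows "slot_op S n h i (slot_op S n h j F) = slot_op S n h j (slot_op S n h i F)"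
proof
  fix xs
  show "slot_op S n h i (slot_op S n h j F) xs = slot_op S n h j (slot_op S n h i F) xs"
    by (cases "i = j") (simp_all add: slot_op_def upd_in assms list_update_swap)
qed

lemma slot_part_commute:
  assumes "i < n" "k \<le> n"
  shows "slot_op S n h i (part_op S n h k F) = part_op S n h k (slot_op S n h i F)"
proof
  fix xs
  have "slot_op S n h i (slot_op S n h j F) xs = slot_op S n h j (slot_op S n h i F) xs"
    if "j < k" for j
    using slot_slot_commute[of i n j F] assms that by simp
  then have sums: "(\<Sum>j<k. slot_op S n h i (slot_op S n h j F) xs)
      = (\<Sum>j<k. slot_op S n h j (slot_op S n h i F) xs)"
    by simp
  have "slot_op S n h i (part_op S n h k F) xs
    = slot_op S n h i (val_op S n h F) xs - (\<Sum>j<k. slot_op S n h i (slot_op S n h j F) xs)"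
    unfolding slot_op_def[of S n h i] part_op_def by simp
  then show "slot_op S n h i (part_op S n h k F) xs = part_op S n h k (slot_op S n h i F) xs"
    unfolding sums slot_val_commute[OF assms(1)] part_op_def .
qed

text \<open>\<open>val_op\<close> acts on each value separately, so \<open>kill\<close> commutes
  with evaluation at a tuple, where it becomes \<open>kill\<close> for \<open>act h\<close> on
  \<open>M\<close>.\<close>

lemma kill_val_op:
  fixes G :: "('k, 'g list \<Rightarrow> 'm) ext"
  assumes "\<And>\<phi> xs. xs \<notin> tuples n S \<Longrightarrow> Rep_ext G \<phi> xs = 0"
    and "\<And>xs. xs \<in> tuples n S \<Longrightarrow> E.kill (emap (act h)) es (eval_ext xs G) = 0"
  shows "E.kill (emap (val_op S n h)) es G = 0"
  using assms
proof (induction es arbitrary: G)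
  case Nil
  have "Rep_ext G \<phi> xs = 0" for \<phi> xs
  proof (cases "xs \<in> tuples n S")
    case True
    then have "Rep_ext (eval_ext xs G) \<phi> = 0" using Nil.prems(2)[OF True] by (simp add: Rep_ext_ops)
    then show ?thesis by (simp add: Rep_eval_ext)
  qed (rule Nil.prems(1))
  then have "G = 0" by (intro ext_eqI) (simp add: Rep_ext_ops fun_eq_iff)
  then show ?case by simp
next
  case (Cons e es)
  let ?A = "emap (val_op S n h)"
  have Rep: "Rep_ext (?A G - escale e G) \<phi> xs
      = val_op S n h (Rep_ext G \<phi>) xs - Rep_ext G (\<lambda>x. \<phi> (e * x)) xs" if "lin_func \<phi>" for \<phi> xs
    using that we.linear_opD(1)[OF linear_ops(1)] by (simp add: Rep_ext_ops Rep_emap Rep_escale)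
  have "E.kill ?A es (?A G - escale e G) = 0"
  proof (rule Cons.IH)
    fix \<phi> xs assume "xs \<notin> tuples n S"
    then show "Rep_ext (?A G - escale e G) \<phi> xs = 0"
      using Rep[of \<phi> xs] Cons.prems(1) by (cases "lin_func \<phi>") (auto simp: val_op_def Rep_ext_off)
  next
    fix xs assume xs: "xs \<in> tuples n S"
    have "eval_ext xs (?A G - escale e G) = emap (act h) (eval_ext xs G) - escale e (eval_ext xs G)"
    proof (rule ext_eqI)
      fix \<phi> :: "'k alg_closure \<Rightarrow> 'k" assume \<phi>: "lin_func \<phi>"
      have "Rep_ext (emap (act h) (eval_ext xs G) - escale e (eval_ext xs G)) \<phi>
          = act h (Rep_ext G \<phi> xs) - Rep_ext G (\<lambda>x. \<phi> (e * x)) xs"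
        using \<phi> by (simp add: Rep_ext_ops Rep_emap Rep_escale act_add_right Rep_eval_ext)
      then show "Rep_ext (eval_ext xs (?A G - escale e G)) \<phi>
          = Rep_ext (emap (act h) (eval_ext xs G) - escale e (eval_ext xs G)) \<phi>"
        unfolding Rep_eval_ext Rep[OF \<phi>] using xs by (simp add: val_op_def)
    qed
    then show "E.kill (emap (act h)) es (eval_ext xs (?A G - escale e G)) = 0"
      using Cons.prems(2)[OF xs] by simp
  qed
  then show ?case by simp
qed

text \<open>The \<open>i\<close>-th argument is replaced by an element \<open>y\<close> of the
  extension of \<open>\<gg>\<close> depending on it, so that \<open>kill\<close> on cochains becomes
  \<open>kill\<close> on \<open>y\<close>. The family starts as \<open>unit_ext\<close> and is kept
  general because every factor changes it; it has to stay in \<open>S\<close> pointwise and to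
  intertwine \<open>bracket h\<close> for the induction to continue.\<close>

lemma kill_slot_op:
  fixes G :: "('k, 'g list \<Rightarrow> 'm) ext" and y :: "'g \<Rightarrow> ('k, 'g) ext"
  assumes F: "F \<in> C S n" and i: "i < n"
    and "\<And>\<phi> xs. xs \<notin> tuples n S \<Longrightarrow> Rep_ext G \<phi> xs = 0"
    and "\<And>\<phi> xs. xs \<in> tuples n S \<Longrightarrow> Rep_ext G \<phi> xs = F (xs[i := Rep_ext (y (xs ! i)) \<phi>])"
    and "\<And>x \<phi>. x \<in> S \<Longrightarrow> Rep_ext (y x) \<phi> \<in> S"
    and "\<And>x. x \<in> S \<Longrightarrow> y (bracket h x) = emap (bracket h) (y x)"
    and "\<And>x. x \<in> S \<Longrightarrow> E.kill (emap (bracket h)) es (y x) = 0"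
  shows "E.kill (emap (slot_op S n h i)) es G = 0"
  using assms(3-)
proof (induction es arbitrary: G y)
  case Nil
  have "Rep_ext G \<phi> xs = 0" for \<phi> xs
  proof (cases "xs \<in> tuples n S")
    case True
    have len: "i < length xs" using True i by (simp add: tuples_def)
    have "y (xs ! i) = 0" using Nil.prems(5)[OF tuples_nth[OF True i]] by simp
    then have "Rep_ext G \<phi> xs = F (xs[i := 0])" using Nil.prems(2)[OF True] by (simp add: Rep_ext_ops)
    also have "\<dots> = 0" by (rule C_zero_entry[OF F S]) (rule set_update_memI[OF len])
    finally show ?thesis .
  qed (rule Nil.prems(1))
  then have "G = 0" by (intro ext_eqI) (simp add: Rep_ext_ops fun_eq_iff)
  then show ?case by simp
next
  case (Cons e es)
  let ?A = "emap (slot_op S n h i)"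
  let ?b = "emap (bracket h) :: ('k, 'g) ext \<Rightarrow> _"
  note off = Cons.prems(1) and on = Cons.prems(2) and in_S = Cons.prems(3) and br = Cons.prems(4)
  have Rep: "Rep_ext (?A G - escale e G) \<phi> xs
      = slot_op S n h i (Rep_ext G \<phi>) xs - Rep_ext G (\<lambda>x. \<phi> (e * x)) xs" if "lin_func \<phi>" for \<phi> xs
    using that we.linear_opD(1)[OF linear_ops(2)] by (simp add: Rep_ext_ops Rep_emap Rep_escale)
  have Rep_y: "Rep_ext (?b (y x) - escale e (y x)) \<phi> = bracket h (Rep_ext (y x) \<phi>)
      - Rep_ext (y x) (\<lambda>x. \<phi> (e * x))"
    if "lin_func \<phi>" for x \<phi>
    using that by (simp add: Rep_ext_ops Rep_emap Rep_escale bracket_add_right)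
  have "E.kill ?A es (?A G - escale e G) = 0"
  proof (rule Cons.IH[where y = "\<lambda>x. ?b (y x) - escale e (y x)"])
    fix \<phi> xs assume "xs \<notin> tuples n S"
    then show "Rep_ext (?A G - escale e G) \<phi> xs = 0"
      using Rep[of \<phi> xs] off by (cases "lin_func \<phi>") (auto simp: slot_op_def Rep_ext_off)
  next
    fix \<phi> xs assume xs: "xs \<in> tuples n S"
    have len: "i < length xs" using xs i by (simp add: tuples_def)
    have xi: "xs ! i \<in> S" using tuples_nth[OF xs i] .
    show "Rep_ext (?A G - escale e G) \<phi> xs = F (xs[i := Rep_ext (?b (y (xs ! i)) - escale e (y (xs ! i))) \<phi>])"
    proof (cases "lin_func \<phi>")
      case True
      let ?u = "bracket h (Rep_ext (y (xs ! i)) \<phi>)" and ?v = "Rep_ext (y (xs ! i)) (\<lambda>x. \<phi> (e * x))"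
      have uv: "?u \<in> S" "?v \<in> S" using h in_S[OF xi] by auto
      have "Rep_ext G \<phi> (xs[i := bracket h (xs ! i)]) = F (xs[i := ?u])"
        using on[OF upd_in[OF xs i], of \<phi>] br[OF xi] len by (simp add: Rep_emap bracket_add_right)
      moreover have "F (xs[i := ?u - ?v]) = F (xs[i := ?u]) - F (xs[i := ?v])"
        using C_slot_add[OF F xs i, of "?u - ?v" ?v] uv subspace_diff[OF S] by simp
      ultimately show ?thesis
        using xs by (simp add: Rep[OF True] Rep_y[OF True] slot_op_def on)
    next
      case False
      have "F (xs[i := 0]) = 0" by (rule C_zero_entry[OF F S]) (rule set_update_memI[OF len])
      then show ?thesis using False by (simp add: Rep_ext_off)
    qed
  next
    fix x \<phi> assume x: "x \<in> S"
    show "Rep_ext (?b (y x) - escale e (y x)) \<phi> \<in> S"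
      using Rep_y[of \<phi> x] in_S[OF x] h subspace_diff[OF S] subspace_0[OF S]
      by (cases "lin_func \<phi>") (auto simp: Rep_ext_off)
    show "?b (y (bracket h x)) - escale e (y (bracket h x)) = ?b (?b (y x) - escale e (y x))"
      using E.linear_opD[OF ge.linear_op_emap[OF linear_op_bracket]] br[OF x] by simp
    show "E.kill ?b es (?b (y x) - escale e (y x)) = 0" using Cons.prems(5)[OF x] by simp
  qed
  then show ?case by simp
qed

text \<open>Finite dimension of \<open>\<gg>\<close> enters twice: it makes the values of
  \<open>F\<close> span a finite-dimensional space, and it gives one list of eigenvalues for all
  arguments.\<close>

lemma \<theta>_eigvecs:
  assumes fd: "finite B0" "span B0 = UNIV"
    and ssg: "semisimple_operator scale (bracket h)" and ssm: "semisimple_operator mscale (act h)"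
    and F: "F \<in> C S n"
  shows "unit_ext (pointwise mscale) F \<in> E.span (E.eigvecs (emap (\<theta> S n h)))"
proof -
  let ?u = "unit_ext (pointwise mscale) F :: ('k, 'g list \<Rightarrow> 'm) ext"
  obtain B where B: "B \<subseteq> S" "independent B" "S \<subseteq> span B" using maximal_independent_subset[of S] by blast
  have "finite B" using independent_span_bound[OF fd(1) B(2)] fd(2) by auto
  have SB: "S = span B" using B span_minimal[OF B(1) S] by auto
  have "finite (tuples n B)"
    using finite_lists_length_eq[OF \<open>finite B\<close>, of n] by (simp add: tuples_def conj_commute)
  then have fin: "finite (F ` tuples n B)" by simp
  have off: "Rep_ext ?u \<phi> xs = 0" if "xs \<notin> tuples n S" for \<phi> xs
    using C_off[OF F that] Rep_unit_ext[OF W.vector_space_axioms, of \<phi> F]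
    by (cases "lin_func \<phi>") (simp_all add: pointwise_def Rep_ext_off)
  note eg = ge.linear_op_emap[OF linear_op_bracket[of h]]
  note em = me.linear_op_emap[OF linear_op_act[of h]]
  have val: "?u \<in> E.span (E.eigvecs (emap (val_op S n h)))"
  proof -
    obtain es where es: "distinct es" "\<And>v. v \<in> M.span (F ` tuples n B) \<Longrightarrow> unit_ext mscale v
        \<in> E.eigsum (emap (act h)) (set es)"
      using me.finite_common_eigsum[OF linear_op_act fin me.semisimple_operator_eigvecs[OF
        linear_op_act ssm]] by blast
    have "E.kill (emap (val_op S n h)) es ?u = 0"
    proof (rule kill_val_op[OF off])
      fix xs assume xs: "xs \<in> tuples n S"
      have "F xs \<in> M.span (F ` tuples n B)"
        by (rule C_values_in_subspace[OF M.subspace_span SB F _ xs]) (auto intro: M.span_base)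
      then have "E.kill (emap (act h)) es (unit_ext mscale (F xs)) = 0"
        by (intro E.kill_eigsum[OF em] es)
      moreover have "eval_ext xs ?u = unit_ext mscale (F xs)"
        by (rule ext_eqI) (simp add: Rep_eval_ext Rep_unit_ext[OF W.vector_space_axioms]
            Rep_unit_ext[OF M.vector_space_axioms] pointwise_def)
      ultimately show "E.kill (emap (act h)) es (eval_ext xs ?u) = 0" by simp
    qed
    then show ?thesis
      using E.kill_0_eigsum[OF we.linear_op_emap[OF linear_ops(1)] es(1)] E.eigsum_subset_span by blast
  qed
  obtain es where es: "distinct es" "\<And>v. unit_ext scale v \<in> E.eigsum (emap (bracket h)) (set es)"
    using ge.finite_common_eigsum[OF linear_op_bracket fd(1) ge.semisimple_operator_eigvecs[OF
      linear_op_bracket ssg]]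
    unfolding fd(2) by blast
  have slot: "?u \<in> E.span (E.eigvecs (emap (slot_op S n h i)))" if i: "i < n" for i
  proof -
    have "E.kill (emap (slot_op S n h i)) es ?u = 0"
    proof (rule kill_slot_op[OF F i off, where y = "unit_ext scale"])
      fix \<phi> xs assume xs: "xs \<in> tuples n S"
      have len: "i < length xs" using xs i by (simp add: tuples_def)
      show "Rep_ext ?u \<phi> xs = F (xs[i := Rep_ext (unit_ext scale (xs ! i)) \<phi>])"
      proof (cases "lin_func \<phi>")
        case True
        then show ?thesis using C_slot_scale[OF F xs i tuples_nth[OF xs i], of "\<phi> 1"]
          by (simp add: Rep_unit_ext[OF W.vector_space_axioms] Rep_unit_ext[OF vector_space_axioms]
            pointwise_def)
      next
        case False
        have "F (xs[i := 0]) = 0" by (rule C_zero_entry[OF F S]) (rule set_update_memI[OF len])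
        then show ?thesis using False by (simp add: Rep_ext_off)
      qed
    next
      fix x \<phi> assume "x \<in> S"
      then show "Rep_ext (unit_ext scale x) \<phi> \<in> S"
        by (cases "lin_func \<phi>")
          (simp_all add: Rep_unit_ext[OF vector_space_axioms] Rep_ext_off subspace_scale[OF S] subspace_0[OF S])
      show "unit_ext scale (bracket h x) = emap (bracket h) (unit_ext scale x)"
        by (simp add: ge.emap_unit_ext[OF linear_op_bracket])
      show "E.kill (emap (bracket h)) es (unit_ext scale x) = 0"
        by (intro E.kill_eigsum[OF eg] es)
    qed
    then show ?thesis
      using E.kill_0_eigsum[OF we.linear_op_emap[OF linear_ops(2)] es(1)] E.eigsum_subset_span by blast
  qed
  \<comment> \<open>Commuting operators are added one slot at a time; \<open>Q\<close> is the
    negated slot operator, with the same eigenvectors and opposite eigenvalues.\<close>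
  have "k \<le> n \<Longrightarrow> ?u \<in> E.span (E.eigvecs (emap (part_op S n h k)))" for k
  proof (induction k)
    case 0
    have "part_op S n h 0 = val_op S n h" by (intro ext) (simp add: part_op_def)
    then show ?case using val by simp
  next
    case (Suc k)
    let ?P = "part_op S n h k"
    define Q where "Q F = - slot_op S n h k F" for F
    have linQ: "we.linear_op Q" using linear_ops(4)[of S n h k] by (simp add: Q_def[abs_def])
    note addP = we.linear_opD(1)[OF linear_ops(3)[of S n h k]] and addQ = we.linear_opD(1)[OF linQ]
    note addS = we.linear_opD(1)[OF linear_ops(2)[of S n h k]]
    have "E.eigvecs (emap (slot_op S n h k) :: ('k, 'g list \<Rightarrow> 'm) ext \<Rightarrow> _) \<subseteq> E.eigvecs (emap Q)"
    proof
      fix w :: "('k, 'g list \<Rightarrow> 'm) ext" assume "w \<in> E.eigvecs (emap (slot_op S n h k))"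
      then obtain e where "emap (slot_op S n h k) w = escale e w" by (auto simp: E.eigvecs_def)
      moreover have "emap Q w = - emap (slot_op S n h k) w"
        by (rule ext_eqI) (simp add: Rep_emap[OF addQ] Rep_emap[OF addS] Rep_ext_ops Q_def fun_eq_iff)
      ultimately have "emap Q w = escale (- e) w" by simp
      then show "w \<in> E.eigvecs (emap Q)" unfolding E.eigvecs_def by blast
    qed
    then have Q: "?u \<in> E.span (E.eigvecs (emap Q))" using slot[of k] Suc.prems E.span_mono by auto
    have "?P (Q F) = Q (?P F)" for F
      unfolding Q_def using we.linear_opD(4)[OF linear_ops(3)] slot_part_commute[of k n k] Suc.prems
        by simp
    then have comm: "emap ?P (emap Q G) = emap Q (emap ?P G)" for G :: "('k, 'g list \<Rightarrow> 'm) ext"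
      by (intro ext_eqI) (simp add: Rep_emap[OF addP] Rep_emap[OF addQ])
    have "?u \<in> E.span (E.eigvecs (\<lambda>G. emap ?P G + emap Q G))"
      using E.span_eigvecs_add[OF we.linear_op_emap[OF linear_ops(3)] we.linear_op_emap[OF linQ] comm]
        Suc Q by simp
    moreover have "(\<lambda>G :: ('k, 'g list \<Rightarrow> 'm) ext. emap ?P G + emap Q G) = emap (\<lambda>F. ?P F + Q F)"
      by (rule HOL.ext) (rule emap_add[OF addP addQ, symmetric])
    moreover have "(\<lambda>F. ?P F + Q F) = part_op S n h (Suc k)"
      by (intro ext) (simp add: part_op_def Q_def)
    ultimately show ?case by simp
  qed
  then show ?thesis by (simp add: \<theta>_eq_part_op)
qed

end

end

section \<open>Tensor products and exterior powers in coordinates\<close>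

lemma sum_fun_apply: "(\<Sum>i\<in>I. h i) x = (\<Sum>i\<in>I. h i x :: 'v::comm_monoid_add)"
  by (induction I rule: infinite_finite_induct) simp_all

definition fun_space :: "'j set \<Rightarrow> 'v set \<Rightarrow> ('j \<Rightarrow> 'v::zero) set" where
  "fun_space J U = {u. (\<forall>j\<in>J. u j \<in> U) \<and> (\<forall>j. j \<notin> J \<longrightarrow> u j = 0)}"

abbreviation coord_module :: "'j set \<Rightarrow> ('k::field, 'j \<Rightarrow> 'k) module" where
  "coord_module J \<equiv> subspace_module (pointwise (*)) (fun_space J UNIV)"

definition unit_fun :: "'j \<Rightarrow> 'j \<Rightarrow> 'k::field" where
  "unit_fun i j = (if j = i then 1 else 0)"

lemma subspace_fun_space:
  assumes "vector_space s" "module.subspace s U"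
  shows "module.subspace (pointwise s) (fun_space J U)"
proof -
  interpret vector_space s by fact
  interpret p: vector_space "pointwise s" by (rule vector_space_pointwise) fact
  show ?thesis
    using subspace_0[OF assms(2)] subspace_add[OF assms(2)] subspace_scale[OF assms(2)]
    by (auto simp: p.subspace_def fun_space_def pointwise_def)
qed

lemma subspace_coords: "module.subspace (pointwise (*)) (fun_space J (UNIV :: 'k::field set))"
proof -
  interpret vector_space "(*) :: 'k \<Rightarrow> 'k \<Rightarrow> 'k" by (rule vector_space_field)
  show ?thesis by (rule subspace_fun_space) (rule vector_space_axioms subspace_UNIV)+
qed

lemma linear_isoD:
  assumes "linear_iso f V W"
  shows "x \<in> carrier V \<Longrightarrow> f x \<in> carrier W"
    "\<lbrakk>x \<in> carrier V; y \<in> carrier V\<rbrakk> \<Longrightarrow> f (x \<oplus>\<^bsub>V\<^esub> y) = f x \<oplus>\<^bsub>W\<^esub> f y"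
    "x \<in> carrier V \<Longrightarrow> f (c \<odot>\<^bsub>V\<^esub> x) = c \<odot>\<^bsub>W\<^esub> f x"
    "\<lbrakk>x \<in> carrier V; y \<in> carrier V; f x = f y\<rbrakk> \<Longrightarrow> x = y"
    "w \<in> carrier W \<Longrightarrow> \<exists>x\<in>carrier V. w = f x"
  using assms unfolding linear_iso_iff bij_betw_def inj_on_def by auto

text \<open>If \<open>e i\<close> is the basis of \<open>V\<close> given by \<open>f\<close>, every
  tensor is uniquely a sum of terms \<open>e i \<otimes> g (u i)\<close>.\<close>

lemma tensor_coords:
  fixes s :: "'k::field \<Rightarrow> 'u \<Rightarrow> 'u::ab_group_add"
  assumes vs: "vector_space s" and U: "module.subspace s U" and J: "finite J"
    and f: "linear_iso f (coord_module J) V" and g: "linear_iso g (subspace_module s U) W"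
  shows "\<exists>T. linear_iso T (subspace_module (pointwise s) (fun_space J U)) (tensor V W)"
proof -
  interpret u: vector_space s by fact
  interpret p: vector_space "pointwise s :: 'k \<Rightarrow> ('a \<Rightarrow> 'u) \<Rightarrow> 'a \<Rightarrow> 'u"
    by (rule vector_space_pointwise) fact
  interpret c: vector_space "pointwise (*) :: 'k \<Rightarrow> ('a \<Rightarrow> 'k) \<Rightarrow> 'a \<Rightarrow> 'k"
    by (rule vector_space_pointwise) (rule vector_space_field)
  interpret F: vector_space "fscale :: 'k \<Rightarrow> ('b \<times> 'c \<Rightarrow>\<^sub>0 'k) \<Rightarrow> _" by (rule vector_space_fscale)
  let ?s = "Poly_Mapping.single :: 'b \<times> 'c \<Rightarrow> 'k \<Rightarrow> _"
  define R where "R = F.span (tensor_relations V W)"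
  have R: "F.subspace R" by (simp add: R_def)
  note R_add = F.subspace_add[OF R] and R_scale = F.subspace_scale[OF R] and R_sum = F.subspace_sum[OF R]
    and R_diff = F.subspace_diff[OF R]
  have KJ: "a \<in> fun_space J UNIV \<Longrightarrow> b \<in> fun_space J UNIV \<Longrightarrow> a + b \<in> fun_space J (UNIV :: 'k set)"
    "a \<in> fun_space J UNIV \<Longrightarrow> pointwise (*) x a \<in> fun_space J (UNIV :: 'k set)" for a b x
    using c.subspace_add[OF subspace_coords] c.subspace_scale[OF subspace_coords] by blast+
  note fD = linear_isoD[OF f, unfolded subspace_module_simps]
  note gD = linear_isoD[OF g, unfolded subspace_module_simps]
  have R1: "?s (v \<oplus>\<^bsub>V\<^esub> v', w) 1 - ?s (v, w) 1 - ?s (v', w) 1 \<in> R"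
    if "v \<in> carrier V" "v' \<in> carrier V" "w \<in> carrier W" for v v' w
    unfolding R_def tensor_relations_def using that by (intro F.span_base) blast
  have R2: "?s (v, w \<oplus>\<^bsub>W\<^esub> w') 1 - ?s (v, w) 1 - ?s (v, w') 1 \<in> R"
    if "v \<in> carrier V" "w \<in> carrier W" "w' \<in> carrier W" for v w w'
    unfolding R_def tensor_relations_def using that by (intro F.span_base) blast
  have R3: "?s (x \<odot>\<^bsub>V\<^esub> v, w) 1 - ?s (v, w) x \<in> R" if "v \<in> carrier V" "w \<in> carrier W" for x v w
    unfolding R_def tensor_relations_def using that by (intro F.span_base) blast
  have R4: "?s (v, x \<odot>\<^bsub>W\<^esub> w) 1 - ?s (v, w) x \<in> R" if "v \<in> carrier V" "w \<in> carrier W" for x v w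
    unfolding R_def tensor_relations_def using that by (intro F.span_base) blast
  define e where "e i = f (unit_fun i)" for i
  have unit: "unit_fun i \<in> fun_space J (UNIV :: 'k set)" if "i \<in> J" for i
    using that by (auto simp: fun_space_def unit_fun_def)
  have e: "e i \<in> carrier V" if "i \<in> J" for i using fD(1)[OF unit[OF that]] by (simp add: e_def)
  define T where "T u = (\<Sum>i\<in>J. ?s (e i, g (u i)) 1)" for u
  have uU: "u i \<in> U" if "u \<in> fun_space J U" "i \<in> J" for u i using that by (simp add: fun_space_def)
  have T_add: "T (u + u') - T u - T u' \<in> R" if "u \<in> fun_space J U" "u' \<in> fun_space J U" for u u'
    unfolding T_def sum_subtractf[symmetric] using that
    by (intro R_sum) (simp add: gD(2) uU R2 e gD(1))
  have T_scale: "T (pointwise s x u) - fscale x (T u) \<in> R" if "u \<in> fun_space J U" for x u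
    unfolding T_def F.scale_sum_right sum_subtractf[symmetric] using that
    by (intro R_sum) (simp add: pointwise_def gD(3) uU R4 e gD(1))
  define inv_f where "inv_f v = inv_into (fun_space J UNIV) f v" for v
  define inv_g where "inv_g w = inv_into U g w" for w
  note sub_coords = subspace_coords[where 'k = 'k]
  have f': "linear_iso inv_f V (coord_module J)"
    unfolding inv_f_def using linear_iso_subspace_inv[OF c.vector_space_axioms sub_coords f]
      by (simp add: fun_eq_iff)
  have g': "linear_iso inv_g W (subspace_module s U)"
    unfolding inv_g_def using linear_iso_subspace_inv[OF vs U g] by (simp add: fun_eq_iff)
  note f'D = linear_isoD[OF f', unfolded subspace_module_simps]
  note g'D = linear_isoD[OF g', unfolded subspace_module_simps]
  have bij_f: "inj_on f (fun_space J UNIV)" "f ` fun_space J UNIV = carrier V"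
    and bij_g: "inj_on g U" "g ` U = carrier W"
    using f g by (auto simp: linear_iso_iff bij_betw_def)
  have inv_f: "inv_f (f a) = a" if "a \<in> fun_space J UNIV" for a
    unfolding inv_f_def by (rule inv_into_f_f[OF bij_f(1) that])
  have inv_g: "inv_g (g x) = x" if "x \<in> U" for x
    unfolding inv_g_def by (rule inv_into_f_f[OF bij_g(1) that])
  \<comment> \<open>The \<open>i\<close>-th coordinate of a tensor,
    \<open>v \<otimes> w \<mapsto> v_i w\<close>. It kills the relations and recovers
    \<open>u i\<close> from \<open>T u\<close>, which yields injectivity.\<close>
  define \<tau> where "\<tau> i = extend_linear s (\<lambda>(v, w). if v \<in> carrier V \<and> w
      \<in> carrier W then s (inv_f v i) (inv_g w) else 0)" for i
  have \<tau>_add: "\<tau> i (p + q) = \<tau> i p + \<tau> i q" and \<tau>_diff: "\<tau> i (p - q) = \<tau> i p - \<tau> i q" for i p q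
    by (simp_all add: \<tau>_def u.extend_linear_add u.extend_linear_diff)
  have \<tau>_single: "\<tau> i (?s (v, w) x) = s (x * inv_f v i) (inv_g w)"
    if "v \<in> carrier V" "w \<in> carrier W" for i v w x
    using that by (simp add: \<tau>_def)
  have closed: "v \<oplus>\<^bsub>V\<^esub> v' \<in> carrier V" "x \<odot>\<^bsub>V\<^esub> v \<in> carrier V"
    if v: "v \<in> carrier V" "v' \<in> carrier V" for v v' x
  proof -
    obtain a b where ab: "a \<in> fun_space J UNIV" "b \<in> fun_space J UNIV" "v = f a" "v' = f b"
      using fD(5) v by metis
    show "v \<oplus>\<^bsub>V\<^esub> v' \<in> carrier V" unfolding ab(3,4) fD(2)[OF ab(1,2), symmetric] by (intro fD(1) KJ ab)
    show "x \<odot>\<^bsub>V\<^esub> v \<in> carrier V" unfolding ab(3) fD(3)[OF ab(1), symmetric] by (intro fD(1) KJ ab)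
  qed
  have closedW: "w \<oplus>\<^bsub>W\<^esub> w' \<in> carrier W" "x \<odot>\<^bsub>W\<^esub> w \<in> carrier W"
    if w: "w \<in> carrier W" "w' \<in> carrier W" for w w' x
  proof -
    obtain a b where ab: "a \<in> U" "b \<in> U" "w = g a" "w' = g b" using gD(5) w by metis
    show "w \<oplus>\<^bsub>W\<^esub> w' \<in> carrier W" unfolding ab(3,4) gD(2)[OF ab(1,2), symmetric]
      by (intro gD(1) u.subspace_add[OF U] ab)
    show "x \<odot>\<^bsub>W\<^esub> w \<in> carrier W" unfolding ab(3) gD(3)[OF ab(1), symmetric]
      by (intro gD(1) u.subspace_scale[OF U] ab)
  qed
  have \<tau>_R: "\<tau> i p = 0" if "p \<in> R" for i p
    unfolding \<tau>_def
  proof (rule u.extend_linear_span_zero[OF _ that[unfolded R_def]])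
    fix p assume "p \<in> tensor_relations V W"
    then have "\<tau> i p = 0"
      unfolding tensor_relations_def
      by (auto simp: \<tau>_diff \<tau>_single closed closedW f'D g'D u.scale_left_distrib
        u.scale_right_distrib pointwise_def mult.commute)
    then show "extend_linear s (\<lambda>(v, w). if v \<in> carrier V \<and> w
        \<in> carrier W then s (inv_f v i) (inv_g w) else 0) p = 0"
      by (simp add: \<tau>_def)
  qed
  have \<tau>_0: "\<tau> i 0 = 0" for i using \<tau>_add[of i 0 0] by simp
  have \<tau>_T: "\<tau> i (T u) = u i" if u: "u \<in> fun_space J U" and i: "i \<in> J" for u i
  proof -
    have "\<tau> i (\<Sum>j\<in>K. ?s (e j, g (u j)) 1) = (\<Sum>j\<in>K. \<tau> i (?s (e j, g (u j)) 1))" for K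
      by (induction K rule: infinite_finite_induct) (simp_all add: \<tau>_0 \<tau>_add)
    moreover have "\<tau> i (?s (e j, g (u j)) 1) = (if j = i then u j else 0)" if j: "j \<in> J" for j
    proof -
      have "inv_f (e j) = unit_fun j" unfolding e_def by (rule inv_f[OF unit[OF j]])
      then show ?thesis
        using \<tau>_single[OF e[OF j] gD(1)[OF uU[OF u j]]] inv_g[OF uU[OF u j]] by (simp add: unit_fun_def)
    qed
    ultimately have "\<tau> i (T u) = (\<Sum>j\<in>J. if j = i then u j else 0)" unfolding T_def by simp
    then show ?thesis using J i by simp
  qed
  \<comment> \<open>For surjectivity: modulo the relations, a vector in the first factor is expanded
    in the basis, one element of its support at a time.\<close>
  have expand: "finite K \<Longrightarrow> K \<subseteq> J \<Longrightarrow> a \<in> fun_space J UNIV \<Longrightarrow> (\<And>i. i \<notin> K \<Longrightarrow> a i = 0) \<Longrightarrow>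
      ?s (f a, w) 1 - (\<Sum>i\<in>K. ?s (e i, w) (a i)) \<in> R" if w: "w \<in> carrier W" for w a K
  proof (induction K arbitrary: a rule: finite_induct)
    case empty
    \<comment> \<open>With empty support \<open>a\<close> is zero, hence equal to its multiple by
      the scalar zero, and homogeneity kills the generator.\<close>
    have "pointwise (*) 0 a = a" using empty(3) by (auto simp: pointwise_def)
    then have "0 \<odot>\<^bsub>V\<^esub> f a = f a" using fD(3)[OF empty(2), of 0] by metis
    then show ?case using R3[OF fD(1)[OF empty(2)] w, of 0] by simp
  next
    case (insert i K)
    define b where "b = a(i := 0)"
    have i: "i \<in> J" using insert.prems by simp
    have b: "b \<in> fun_space J UNIV" using insert.prems by (auto simp: b_def fun_space_def)
    have a: "a = pointwise (*) (a i) (unit_fun i) + b"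
      by (auto simp: b_def pointwise_def unit_fun_def fun_eq_iff)
    have fa: "f a = (a i \<odot>\<^bsub>V\<^esub> e i) \<oplus>\<^bsub>V\<^esub> f b"
      by (subst a) (simp add: fD(2) KJ unit i b fD(3) e_def)
    have IH: "?s (f b, w) 1 - (\<Sum>j\<in>K. ?s (e j, w) (b j)) \<in> R"
    proof (rule insert.IH[OF _ b])
      show "K \<subseteq> J" using insert.prems by simp
      show "b j = 0" if "j \<notin> K" for j using insert.prems(3)[of j] that by (simp add: b_def)
    qed
    have "(\<Sum>j\<in>K. ?s (e j, w) (b j)) = (\<Sum>j\<in>K. ?s (e j, w) (a j))"
      using insert.hyps by (intro sum.cong) (auto simp: b_def)
    then have "?s (f a, w) 1 - (\<Sum>j\<in>insert i K. ?s (e j, w) (a j))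
      = (?s (f a, w) 1 - ?s (a i \<odot>\<^bsub>V\<^esub> e i, w) 1 - ?s (f b, w) 1)
        + (?s (a i \<odot>\<^bsub>V\<^esub> e i, w) 1 - ?s (e i, w) (a i)) + (?s (f b, w) 1 - (\<Sum>j\<in>K. ?s (e j, w) (b j)))"
      using insert.hyps by simp
    also have "\<dots> \<in> R" unfolding fa
      by (intro R_add R1 R3 IH closed(2) e i w fD(1) b) (rule e[OF i])
    finally show ?case .
  qed
  have T_0: "T 0 \<in> R"
    using F.subspace_neg[OF R T_add[of 0 0]] u.subspace_0[OF U] by (simp add: fun_space_def)
  have fs: "p.subspace (fun_space J U)" by (rule subspace_fun_space[OF vs U])
  have "\<exists>u\<in>fun_space J U. z - T u \<in> R" if "z \<in> free_on (carrier V \<times> carrier W)" for z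
    using that
  proof (induction z rule: free_on_induct)
    case zero
    have "0 - T 0 \<in> R" by (rule R_diff[OF F.subspace_0[OF R] T_0])
    then show ?case using p.subspace_0[OF fs] by blast
  next
    case (add z z')
    obtain u u' where u: "u \<in> fun_space J U" "u' \<in> fun_space J U" "z - T u \<in> R" "z' - T u' \<in> R"
      using add.IH by blast
    have "(z - T u) + (z' - T u') - (T (u + u') - T u - T u') \<in> R"
      by (intro R_diff R_add u T_add)
    then have "z + z' - T (u + u') \<in> R" by (simp add: algebra_simps)
    then show ?case using p.subspace_add[OF fs u(1,2)] by blast
  next
    case (single vw x)
    obtain v w where vw: "vw = (v, w)" "v \<in> carrier V" "w \<in> carrier W" using single by (cases vw) auto
    obtain a where a: "a \<in> fun_space J UNIV" "v = f a" using fD(5)[OF vw(2)] by auto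
    obtain w0 where w0: "w0 \<in> U" "w = g w0" using gD(5)[OF vw(3)] by auto
    define u where "u i = s (x * a i) w0" for i
    have u: "u \<in> fun_space J U"
      using a(1) w0(1) u.subspace_scale[OF U] by (auto simp: fun_space_def u_def)
    have "fscale x (?s (f a, w) 1 - (\<Sum>i\<in>J. ?s (e i, w) (a i))) \<in> R"
      using a(1) by (intro R_scale expand[OF vw(3) J]) (auto simp: fun_space_def)
    moreover have "(\<Sum>i\<in>J. ?s (e i, g (u i)) 1 - ?s (e i, w) (x * a i)) \<in> R"
      unfolding u_def gD(3)[OF w0(1)] w0(2) by (intro R_sum R4 e gD(1) w0(1))
    ultimately have "fscale x (?s (f a, w) 1 - (\<Sum>i\<in>J. ?s (e i, w) (a i)))
        - (\<Sum>i\<in>J. ?s (e i, g (u i)) 1 - ?s (e i, w) (x * a i)) \<in> R" by (rule R_diff)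
    then have "?s vw x - T u \<in> R"
      by (simp add: F.scale_right_diff_distrib F.scale_sum_right sum_subtractf T_def vw(1) a(2))
    then show ?case using u by blast
  qed
  then have "linear_iso (\<lambda>u. coset_of R (T u)) (subspace_module (pointwise s) (fun_space J U))
      (quotient_module fscale (free_on (carrier V \<times> carrier W)) R)"
  proof (intro linear_iso_quotient[OF F.vector_space_axioms p.vector_space_axioms fs R])
    fix u assume u: "u \<in> fun_space J U"
    show "T u \<in> free_on (carrier V \<times> carrier W)"
      unfolding T_def using u
      by (intro module.subspace_sum[OF F.module_axioms subspace_free_on] single_in_free_on) (simp
        add: e gD(1) uU)
    assume "T u \<in> R"
    then have "u i = 0" if "i \<in> J" for i using \<tau>_T[OF u that] \<tau>_R by simp
    then show "u = 0" using u by (auto simp: fun_space_def fun_eq_iff)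
  qed (use T_add T_scale in auto)
  then show ?thesis unfolding tensor_def R_def by blast
qed

text \<open>Indices of all degrees are kept in one family: the part of \<open>u\<close> with
  \<open>deg j = i\<close> gives the summand \<open>A i \<otimes> B (n - i)\<close>. Entries with
  \<open>deg j > n\<close> have no summand and are set to zero.\<close>

lemma graded_tensor_coords:
  fixes s :: "'k::field \<Rightarrow> 'u \<Rightarrow> 'u::ab_group_add" and deg :: "'j \<Rightarrow> nat"
  assumes vs: "vector_space s" and U: "\<And>m. module.subspace s (U m)" and I: "finite I"
    and f: "\<And>i. \<exists>f. linear_iso f (coord_module {j \<in> I. deg j = i}) (A i)"
    and g: "\<And>m. \<exists>g. linear_iso g (subspace_module s (U m)) (B m)"
  shows "\<exists>T. linear_iso T (subspace_module (pointwise s)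
     {u. (\<forall>j. j \<in> I \<and> deg j \<le> n \<longrightarrow> u j \<in> U (n - deg j)) \<and> (\<forall>j. \<not> (j \<in> I \<and> deg j \<le> n) \<longrightarrow> u j = 0)})
     (graded_tensor A B n)"
proof -
  interpret u: vector_space s by fact
  define J where "J i = {j \<in> I. deg j = i}" for i
  let ?Y = "{u. (\<forall>j. j \<in> I \<and> deg j \<le> n \<longrightarrow> u j \<in> U (n - deg j)) \<and> (\<forall>j. \<not> (j \<in> I \<and> deg j \<le> n) \<longrightarrow> u j = 0)}"
  define D where "D i = (tensor (A i) (B (n - i)) :: ('k, _) module)" for i
  have "\<exists>T. linear_iso T (subspace_module (pointwise s) (fun_space (J i) (U (n - i)))) (D i)" for i
  proof -
    obtain f' g' where "linear_iso f' (coord_module (J i)) (A i)"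
        "linear_iso g' (subspace_module s (U (n - i))) (B (n - i))"
      using f[of i] g[of "n - i"] unfolding J_def by blast
    moreover have "finite (J i)" using I by (simp add: J_def)
    ultimately show ?thesis unfolding D_def using tensor_coords[OF vs U] by blast
  qed
  then obtain T where T: "\<And>i. linear_iso (T i) (subspace_module (pointwise s) (fun_space (J i) (U (n
      - i)))) (D i)"
    by metis
  note TD = linear_isoD[OF T, unfolded subspace_module_simps]
  define R where "R i u j = (if j \<in> J i then u j else 0)" for i and u :: "'j \<Rightarrow> 'u" and j
  have R: "R i u \<in> fun_space (J i) (U (n - i))" if "u \<in> ?Y" "i \<le> n" for i u
    using that by (auto simp: R_def fun_space_def J_def)
  have R_add: "R i (u + u') = R i u + R i u'" and R_scale: "R i (pointwise s c u)
      = pointwise s c (R i u)" for i u u' c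
    by (auto simp: R_def fun_eq_iff pointwise_def)
  define F where "F u = (\<lambda>i\<in>{..n}. T i (R i u))" for u
  have carrier: "carrier (graded_tensor A B n) = (\<Pi>\<^sub>E i\<in>{..n}. carrier (D i))"
    and add: "x \<oplus>\<^bsub>graded_tensor A B n\<^esub> y = (\<lambda>i\<in>{..n}. x i \<oplus>\<^bsub>D i\<^esub> y i)"
    and smult: "c \<odot>\<^bsub>graded_tensor A B n\<^esub> x = (\<lambda>i\<in>{..n}. c \<odot>\<^bsub>D i\<^esub> x i)" for x y c
    by (simp_all add: graded_tensor_def Let_def D_def)
  have "inj_on F ?Y"
  proof (rule inj_onI)
    fix u v assume u: "u \<in> ?Y" and v: "v \<in> ?Y" and eq: "F u = F v"
    have "R i u = R i v" if "i \<le> n" for i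
    proof (rule TD(4)[OF R[OF u that] R[OF v that]])
      show "T i (R i u) = T i (R i v)" using fun_cong[OF eq, of i] that by (simp add: F_def)
    qed
    then have eq: "R (deg j) u j = R (deg j) v j" if "deg j \<le> n" for j using that by simp
    have "u j = v j" for j
    proof (cases "j \<in> I \<and> deg j \<le> n")
      case True
      then show ?thesis using eq[of j] by (simp add: R_def J_def)
    next
      case False
      then show ?thesis using u v by auto
    qed
    then show "u = v" by (rule HOL.ext)
  qed
  moreover have "F ` ?Y = (\<Pi>\<^sub>E i\<in>{..n}. carrier (D i))"
  proof (intro equalityI subsetI)
    fix x assume "x \<in> F ` ?Y"
    then obtain u where u: "u \<in> ?Y" "x = F u" by auto
    show "x \<in> (\<Pi>\<^sub>E i\<in>{..n}. carrier (D i))"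
      unfolding u(2) F_def by (rule restrict_PiE_iff[THEN iffD2]) (use R[OF u(1)] TD(1) in auto)
  next
    fix x assume x: "x \<in> (\<Pi>\<^sub>E i\<in>{..n}. carrier (D i))"
    have "\<exists>v\<in>fun_space (J i) (U (n - i)). x i = T i v" if "i \<le> n" for i
      using TD(5)[of "x i" i] x that by (auto simp: PiE_iff)
    then obtain v where v: "\<And>i. i \<le> n \<Longrightarrow> v i \<in> fun_space (J i) (U (n - i)) \<and> x i = T i (v i)" by metis
    define w where "w j = (if j \<in> I \<and> deg j \<le> n then v (deg j) j else 0)" for j
    have "w \<in> ?Y" using v by (auto simp: w_def fun_space_def J_def)
    moreover have "F w = x"
    proof
      fix i
      show "F w i = x i"
      proof (cases "i \<le> n")
        case True
        have "R i w = v i"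
          using v[OF True] True by (auto simp: R_def w_def J_def fun_space_def fun_eq_iff)
        then show ?thesis using v[OF True] True by (simp add: F_def)
      next
        case False
        then show ?thesis using x by (auto simp: F_def PiE_iff extensional_def)
      qed
    qed
    ultimately show "x \<in> F ` ?Y" by blast
  qed
  ultimately have "linear_iso F (subspace_module (pointwise s) ?Y) (graded_tensor A B n)"
    unfolding linear_iso_iff carrier add smult subspace_module_simps bij_betw_def
    using R TD(2,3) by (auto simp: F_def R_add R_scale fun_eq_iff)
  then show ?thesis by blast
qed

section \<open>Exterior powers through their pairing with alternating forms\<close>

context vector_space
begin

text \<open>Used to prove membership in a span of relations: no functional that vanishes on the
  relations may detect the vector.\<close>

lemma separating_functional:
  assumes B: "subspace B" and v: "v \<notin> B"
  shows "\<exists>\<psi>. Vector_Spaces.linear scale (*) \<psi> \<and> (\<forall>b\<in>B. \<psi> b = 0) \<and> \<psi> v \<noteq> (0 :: 'a)"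
proof -
  interpret vector_space_pair scale "(*) :: 'a \<Rightarrow> 'a \<Rightarrow> 'a"
    by (intro vector_space_pair.intro vector_space_axioms vector_space_field)
  obtain b where b: "b \<subseteq> B" "independent b" "B \<subseteq> span b" using maximal_independent_subset by blast
  have sb: "span b = B" using b span_minimal[OF b(1) B] by auto
  then have "independent (insert v b)" using b(2) v by (simp add: independent_insert)
  then obtain \<psi> where \<psi>: "Vector_Spaces.linear scale (*) \<psi>"
      "\<forall>x\<in>insert v b. \<psi> x = (if x = v then 1 else 0 :: 'a)"
    using linear_independent_extend[of "insert v b" "\<lambda>x. if x = v then 1 else 0"] by blast
  have vb: "v \<notin> b" using b(1) v by auto
  have "\<psi> x = 0" if "x \<in> B" for x
  proof (rule span_induct[of x b])
    show "x \<in> span b" using that sb by simp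
    show "subspace {x. \<psi> x = 0}" using \<psi>(1) by (auto simp: subspace_def Vector_Spaces.linear_iff)
        (metis \<psi>(1) linear_0)
    show "\<psi> y = 0" if "y \<in> b" for y using \<psi>(2) that vb by auto
  qed
  then show ?thesis using \<psi> by (intro exI[of _ \<psi>]) auto
qed

text \<open>One half of the duality between alternating forms and functionals on the exterior power;
  the other half is \<open>functional_cochain\<close>.\<close>

lemma extend_linear_cochain_relations:
  assumes F: "F \<in> cochains scale (*) D r" and D: "subspace D"
    and p: "p \<in> module.span fscale (exterior_relations r (subspace_module scale D))"
  shows "extend_linear (*) F p = (0 :: 'a)"
proof -
  interpret k: vector_space "(*) :: 'a \<Rightarrow> 'a \<Rightarrow> 'a" by (rule vector_space_field)
  show ?thesis
  proof (rule k.extend_linear_span_zero[OF _ p])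
    fix q assume "q \<in> exterior_relations r (subspace_module scale D)"
    then consider (a) xs i v w
        where "q = Poly_Mapping.single (xs[i := v + w]) 1 - Poly_Mapping.single (xs[i := v]) 1
        - Poly_Mapping.single (xs[i := w]) 1" "xs \<in> tuples r D" "i < r" "v \<in> D" "w \<in> D"
      | (b) xs i c v where "q = Poly_Mapping.single (xs[i := scale c v]) 1 - Poly_Mapping.single (xs[i := v]) c"
         "xs \<in> tuples r D" "i < r" "v \<in> D"
      | (c) xs i j where "q = Poly_Mapping.single xs 1" "xs \<in> tuples r D" "i < j" "j < r"
          "xs ! i = xs ! j"
      unfolding exterior_relations_def subspace_module_simps by blast
    then show "extend_linear (*) F q = 0"
    proof cases
      case a
      then have "F (xs[i := v + w]) = F (xs[i := v]) + F (xs[i := w])"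
        using F by (simp add: cochains_def)
      then show ?thesis by (simp add: a(1) k.extend_linear_diff)
    next
      case b
      then have "F (xs[i := scale c v]) = c * F (xs[i := v])" using F by (simp add: cochains_def)
      then show ?thesis by (simp add: b(1) k.extend_linear_diff)
    next
      case c
      then have "F xs = 0" using F by (auto simp: cochains_def)
      then show ?thesis by (simp add: c(1))
    qed
  qed
qed

lemma functional_cochain:
  assumes D: "subspace D" and \<psi>: "Vector_Spaces.linear fscale (*) (\<psi> :: _ \<Rightarrow> 'a)"
    and rel: "\<And>p. p \<in> exterior_relations r (subspace_module scale D) \<Longrightarrow> \<psi> p = 0"
  shows "(\<lambda>xs. if xs \<in> tuples r D then \<psi> (Poly_Mapping.single xs 1) else 0) \<in> cochains scale (*) D r"
proof -
  let ?s = "Poly_Mapping.single :: 'b list \<Rightarrow> 'a \<Rightarrow> _"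
  have add: "\<psi> (p + q) = \<psi> p + \<psi> q" and sc: "\<psi> (fscale c p) = c * \<psi> p" for p q c
    using \<psi> by (auto simp: Vector_Spaces.linear_iff)
  have diff: "\<psi> (p - q) = \<psi> p - \<psi> q" for p q using add[of "p - q" q] by simp
  have "\<psi> (?s (xs[i := v + w]) 1) = \<psi> (?s (xs[i := v]) 1) + \<psi> (?s (xs[i := w]) 1)"
    if "xs \<in> tuples r D" "i < r" "v \<in> D" "w \<in> D" for xs i v w
  proof -
    have "?s (xs[i := v + w]) 1 - ?s (xs[i := v]) 1 - ?s (xs[i := w]) 1
        \<in> exterior_relations r (subspace_module scale D)"
      unfolding exterior_relations_def subspace_module_simps using that by blast
    from rel[OF this] show ?thesis unfolding diff by (simp add: algebra_simps)
  qed
  moreover have "\<psi> (?s (xs[i := scale c v]) 1) = c * \<psi> (?s (xs[i := v]) 1)"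
    if "xs \<in> tuples r D" "i < r" "v \<in> D" for xs i v c
  proof -
    have "?s (xs[i := scale c v]) 1 - ?s (xs[i := v]) c \<in> exterior_relations r (subspace_module scale D)"
      unfolding exterior_relations_def subspace_module_simps using that by blast
    moreover have "?s (xs[i := v]) c = fscale c (?s (xs[i := v]) 1)" by simp
    ultimately show ?thesis using rel diff sc by (metis eq_iff_diff_eq_0)
  qed
  moreover have "\<psi> (?s xs 1) = 0" if "xs \<in> tuples r D" "i < j" "j < r" "xs ! i = xs ! j" for xs i j
  proof -
    have "?s xs 1 \<in> exterior_relations r (subspace_module scale D)"
      unfolding exterior_relations_def subspace_module_simps using that by blast
    then show ?thesis by (rule rel)
  qed
  ultimately show ?thesis
    unfolding cochains_def using subspace_add[OF D] subspace_scale[OF D] by (auto simp: tuples_update)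
qed

text \<open>For a subsequence \<open>A\<close> of length \<open>r\<close>, \<open>\<omega> A\<close>
  is the wedge product of the coordinate forms of its entries.\<close>

lemma exists_dual_forms:
  assumes es: "distinct es" "independent (set es)"
  shows "\<exists>\<omega>. \<forall>A. \<omega> A \<in> cochains scale (*) (span (set es)) r \<and>
    (\<forall>B\<in>set (subseqs es). length B = r \<longrightarrow> \<omega> A B = (if B = A then 1 else 0 :: 'a))"
  using alternating_form_exists[OF es, of r "\<lambda>B. if B = _ then 1 else 0"] by metis

text \<open>Both sides agree on the increasing basis tuples, which determine an alternating
  form.\<close>

lemma cochain_expansion:
  fixes \<omega> :: "'b list \<Rightarrow> 'b list \<Rightarrow> 'a"
  assumes es: "distinct es" "independent (set es)"
    and \<omega>: "\<And>A. \<omega> A \<in> cochains scale (*) (span (set es)) r"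
       "\<And>A B. \<lbrakk>B \<in> set (subseqs es); length B = r\<rbrakk> \<Longrightarrow> \<omega> A B = (if B = A then 1 else 0)"
    and F: "F \<in> cochains scale (*) (span (set es)) r"
  shows "F = (\<lambda>xs. \<Sum>A\<in>{A \<in> set (subseqs es). length A = r}. F A * \<omega> A xs)"
proof -
  let ?J = "{A \<in> set (subseqs es). length A = r}"
  let ?D = "span (set es)"
  interpret lie_module_torus scale "\<lambda>_ _. 0" "(*) :: 'a \<Rightarrow> 'a \<Rightarrow> 'a" "\<lambda>_ _. 0" UNIV "{0}"
    by (rule lie_module_torus_trivial)
  note bracket_0 [simp del] act_0 [simp del]
  define G where "G = (\<Sum>A\<in>?J. pointwise (*) (F A) (\<omega> A))"
  have "G \<in> C ?D r" unfolding G_def by (intro W.subspace_sum[OF subspace_C] C_scale \<omega>(1))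
  then have FG: "F - G \<in> C ?D r" using F by (rule C_diff[rotated])
  have G: "G xs = (\<Sum>A\<in>?J. F A * \<omega> A xs)" for xs by (simp add: G_def sum_fun_apply pointwise_def)
  have "F - G = 0"
  proof (rule alternating_form_unique[OF es FG])
    fix B assume B: "B \<in> set (subseqs es)" "length B = r"
    have "(\<Sum>A\<in>?J. F A * \<omega> A B) = (\<Sum>A\<in>?J. if A = B then F A else 0)"
      using \<omega>(2)[OF B] by (intro sum.cong) auto
    also have "\<dots> = F B" using B by simp
    finally show "(F - G) B = 0" by (simp add: G)
  qed
  then have "F = G" by (rule eq_iff_diff_eq_0[THEN iffD2])
  then show ?thesis using G by (intro HOL.ext) metis
qed

text \<open>The dual forms show that wedges of increasing tuples are independent. That they span is
  shown by duality as well, which avoids reordering arbitrary wedge products.\<close>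

lemma exterior_power_coords:
  assumes es: "distinct es" "independent (set es)"
  shows "\<exists>T. linear_iso T (coord_module {A \<in> set (subseqs es). length A = r})
     (exterior_power (subspace_module scale (span (set es))) r)"
proof -
  interpret k: vector_space "(*) :: 'a \<Rightarrow> 'a \<Rightarrow> 'a" by (rule vector_space_field)
  interpret c: vector_space "pointwise (*) :: 'a \<Rightarrow> ('b list \<Rightarrow> 'a) \<Rightarrow> 'b list \<Rightarrow> 'a"
    by (rule vector_space_pointwise) (rule vector_space_field)
  interpret F: vector_space "fscale :: 'a \<Rightarrow> ('b list \<Rightarrow>\<^sub>0 'a) \<Rightarrow> _" by (rule vector_space_fscale)
  let ?s = "Poly_Mapping.single :: 'b list \<Rightarrow> 'a \<Rightarrow> _"
  let ?J = "{A \<in> set (subseqs es). length A = r}"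
  let ?D = "span (set es)"
  define R where "R = F.span (exterior_relations r (subspace_module scale ?D))"
  have R: "F.subspace R" by (simp add: R_def)
  obtain \<omega> where \<omega>: "\<And>A. \<omega> A \<in> cochains scale (*) ?D r"
      "\<And>A B. \<lbrakk>B \<in> set (subseqs es); length B = r\<rbrakk> \<Longrightarrow> \<omega> A B = (if B = A then 1 else 0 :: 'a)"
    using exists_dual_forms[OF es, of r] by auto
  define T where "T c = (\<Sum>A\<in>?J. ?s A (c A))" for c
  have JD: "A \<in> tuples r ?D" if "A \<in> ?J" for A
    using that subseqs_powset[of es] by (auto simp: tuples_def intro!: span_base)
  have \<omega>_sum: "extend_linear (*) (\<omega> B) (sum h K) = (\<Sum>A\<in>K. extend_linear (*) (\<omega> B) (h A))"
    for B h and K :: "'b list set"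
    by (induction K rule: infinite_finite_induct) (simp_all add: k.extend_linear_add)
  have \<omega>_T: "extend_linear (*) (\<omega> B) (T c) = c B" if "B \<in> ?J" for B c
  proof -
    have "extend_linear (*) (\<omega> B) (T c) = (\<Sum>A\<in>?J. if A = B then c A else 0)"
      unfolding T_def \<omega>_sum using \<omega>(2) by (intro sum.cong) auto
    then show ?thesis using that by simp
  qed
  have "linear_iso (\<lambda>c. coset_of R (T c)) (coord_module ?J) (quotient_module fscale (free_on (tuples r ?D)) R)"
  proof (intro linear_iso_quotient[OF F.vector_space_axioms c.vector_space_axioms subspace_coords R])
    fix c assume c: "c \<in> fun_space ?J (UNIV :: 'a set)"
    show "T c \<in> free_on (tuples r ?D)"
      unfolding T_def by (intro module.subspace_sum[OF F.module_axioms subspace_free_on] single_in_free_on JD)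
    show "T (pointwise (*) x c) - fscale x (T c) \<in> R" for x
      by (simp add: T_def F.scale_sum_right pointwise_def F.subspace_0[OF R])
    show "T (c + c') - T c - T c' \<in> R" for c'
      by (simp add: T_def single_add sum.distrib F.subspace_0[OF R])
    assume "T c \<in> R"
    then have "c B = 0" if "B \<in> ?J" for B
      using \<omega>_T[OF that, of c] extend_linear_cochain_relations[OF \<omega>(1) subspace_span]
        by (simp add: R_def)
    then show "c = 0" using c by (auto simp: fun_space_def fun_eq_iff)
  next
    fix z :: "'b list \<Rightarrow>\<^sub>0 'a" assume z: "z \<in> free_on (tuples r ?D)"
    \<comment> \<open>The only possible coefficients, read off by pairing with the dual
      forms.\<close>
    define c where "c A = (if A \<in> ?J then extend_linear (*) (\<omega> A) z else 0)" for A
    have "z - T c \<in> R"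
    proof (rule ccontr)
      assume "z - T c \<notin> R"
      \<comment> \<open>A functional separating the difference from the relations is an alternating
        form \<open>G\<close>; expanding \<open>G\<close> in the dual forms makes
        \<open>\<psi>\<close> vanish on that very difference.\<close>
      then obtain \<psi> where \<psi>: "Vector_Spaces.linear fscale (*) \<psi>" "\<And>b. b \<in> R \<Longrightarrow> \<psi> b = 0"
          "\<psi> (z - T c) \<noteq> (0 :: 'a)"
        using F.separating_functional[OF R] by blast
      have \<psi>_add: "\<psi> (p + q) = \<psi> p + \<psi> q" and \<psi>_sc: "\<psi> (fscale x p) = x * \<psi> p" for p q x
        using \<psi>(1) by (auto simp: Vector_Spaces.linear_iff)
      have \<psi>_0: "\<psi> 0 = 0" using \<psi>_sc[of 0 0] by simp
      have \<psi>_diff: "\<psi> (p - q) = \<psi> p - \<psi> q" for p q using \<psi>_add[of "p - q" q] by simp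
      have \<psi>_single: "\<psi> (?s xs x) = x * \<psi> (?s xs 1)" for xs x using \<psi>_sc[of x "?s xs 1"] by simp
      have \<psi>_sum: "\<psi> (sum h K) = (\<Sum>A\<in>K. \<psi> (h A))" for h and K :: "'b list set"
        by (induction K rule: infinite_finite_induct) (simp_all add: \<psi>_0 \<psi>_add)
      define G where "G = (\<lambda>xs. if xs \<in> tuples r ?D then \<psi> (?s xs 1) else 0)"
      have G: "G \<in> cochains scale (*) ?D r"
        unfolding G_def by (rule functional_cochain[OF subspace_span \<psi>(1)]) (auto simp: R_def
            F.span_base intro!: \<psi>(2))
      note exp = cochain_expansion[OF es \<omega> G]
      have "\<psi> p = (\<Sum>A\<in>?J. G A * extend_linear (*) (\<omega> A) p)" if "p \<in> free_on (tuples r ?D)" for p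
        using that
      proof (induction p rule: free_on_induct)
        case (single xs x)
        have 1: "\<psi> (?s xs 1) = (\<Sum>A\<in>?J. G A * \<omega> A xs)"
          using fun_cong[OF exp, of xs] single unfolding G_def by (simp only: if_True)
        show ?case
          unfolding \<psi>_single[of xs x] 1 sum_distrib_left k.extend_linear_single
            by (simp only: mult.left_commute)
      qed (simp_all add: \<psi>_0 \<psi>_add k.extend_linear_add distrib_left sum.distrib)
      then have "\<psi> z = (\<Sum>A\<in>?J. G A * c A)" using z by (auto simp: c_def intro!: sum.cong)
      moreover have "\<psi> (T c) = (\<Sum>A\<in>?J. c A * \<psi> (?s A 1))"
        unfolding T_def \<psi>_sum by (intro sum.cong refl \<psi>_single)
      moreover have "\<dots> = (\<Sum>A\<in>?J. G A * c A)" using JD by (auto simp: G_def intro!: sum.cong)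
      ultimately show False using \<psi>(3) \<psi>_diff by simp
    qed
    moreover have "c \<in> fun_space ?J UNIV" by (auto simp: c_def fun_space_def)
    ultimately show "\<exists>y\<in>fun_space ?J UNIV. z - T y \<in> R" by blast
  qed
  then show ?thesis unfolding exterior_power_def R_def subspace_module_simps by blast
qed

end

lemma coord_module_reindex:
  assumes "bij_betw \<gamma> J' J"
  shows "linear_iso (\<lambda>c j. if j \<in> J' then c (\<gamma> j) else 0) (coord_module J :: ('k::field, _) module)
      (coord_module J')"
proof -
  let ?f = "\<lambda>(c :: _ \<Rightarrow> 'k) j. if j \<in> J' then c (\<gamma> j) else 0"
  have \<gamma>: "inj_on \<gamma> J'" "\<gamma> ` J' = J" using assms by (auto simp: bij_betw_def)
  have "inj_on ?f (fun_space J UNIV)"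
  proof (rule inj_onI)
    fix c c' assume c: "c \<in> fun_space J (UNIV :: 'k set)" "c' \<in> fun_space J UNIV" and eq: "?f c = ?f c'"
    have "c j = c' j" for j
    proof (cases "j \<in> J")
      case True
      then obtain i where "i \<in> J'" "j = \<gamma> i" using \<gamma> by auto
      then show ?thesis using fun_cong[OF eq, of i] by simp
    next
      case False
      then show ?thesis using c by (simp add: fun_space_def)
    qed
    then show "c = c'" by (rule HOL.ext)
  qed
  moreover have "?f ` fun_space J UNIV = fun_space J' UNIV"
  proof (intro equalityI subsetI)
    fix x assume "x \<in> ?f ` fun_space J UNIV"
    then show "x \<in> fun_space J' UNIV" by (auto simp: fun_space_def)
  next
    fix c assume c: "c \<in> fun_space J' (UNIV :: 'k set)"
    let ?b = "\<lambda>j. if j \<in> J then c (inv_into J' \<gamma> j) else 0"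
    have b: "?b \<in> fun_space J UNIV" by (simp add: fun_space_def)
    have "c j = ?f ?b j" for j
      using c \<gamma> by (cases "j \<in> J'") (auto simp: fun_space_def)
    then have "c = ?f ?b" by (rule HOL.ext)
    then show "c \<in> ?f ` fun_space J UNIV" using b by (rule image_eqI)
  qed
  ultimately show ?thesis
    by (auto simp: linear_iso_iff bij_betw_def pointwise_def fun_eq_iff)
qed

lemma set_subseqs_map: "set (subseqs (map f xs)) = map f ` set (subseqs xs)"
  by (induction xs) (simp_all add: Let_def image_Un image_image)

section \<open>Complements, bases and dual spaces\<close>

context vector_space
begin

text \<open>A basis of \<open>A \<inter> B\<close> is extended to one of \<open>A\<close>, and
  \<open>U\<close> is spanned by the added vectors; \<open>g\<close> is the projection to
  \<open>U\<close> along \<open>A \<inter> B\<close>.\<close>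

lemma exists_complement:
  assumes A: "subspace A" and B: "subspace B"
  shows "\<exists>U. subspace U \<and> U \<subseteq> A \<and> U \<inter> B = {0} \<and> (\<forall>a\<in>A. \<exists>u\<in>U. a - u \<in> B)"
proof -
  interpret vector_space_pair scale scale by (intro vector_space_pair.intro vector_space_axioms)
  have AB: "subspace (A \<inter> B)" using A B by (rule subspace_inter)
  obtain b where b: "b \<subseteq> A \<inter> B" "independent b" "A \<inter> B \<subseteq> span b"
    using maximal_independent_subset by blast
  have sb: "span b = A \<inter> B" using b span_minimal[OF b(1) AB] by auto
  have bA: "b \<subseteq> A" using b(1) by auto
  obtain b' where b': "b \<subseteq> b'" "b' \<subseteq> A" "independent b'" "A \<subseteq> span b'"
    using maximal_independent_subset_extend[OF bA b(2)] by metis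
  obtain g where g: "Vector_Spaces.linear scale scale g" "\<forall>x\<in>b'. g x = (if x \<in> b then 0 else x)"
    using linear_independent_extend[OF b'(3), of "\<lambda>x. if x \<in> b then 0 else x"] by blast
  have gl: "g (x + y) = g x + g y" "g (scale c x) = scale c (g x)" for x y c
    using g(1) by (auto simp: Vector_Spaces.linear_iff)
  have g0: "g 0 = 0" using gl(2)[of 0 0] by simp
  let ?U = "span (b' - b)"
  have g_id: "g x = x" if "x \<in> ?U" for x
    by (rule span_induct[OF that]) (use g(2) gl g0 in \<open>auto simp: subspace_def\<close>)
  have g_b: "g x = 0" if "x \<in> A \<inter> B" for x
    using that unfolding sb[symmetric]
    by (rule span_induct) (use g(2) gl g0 b'(1) in \<open>auto simp: subspace_def\<close>)
  have g_A: "g x \<in> ?U \<and> x - g x \<in> A \<inter> B" if "x \<in> span b'" for x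
  proof (rule span_induct[OF that])
    show "subspace {x. g x \<in> ?U \<and> x - g x \<in> A \<inter> B}"
    proof (rule subspaceI)
      show "0 \<in> {x. g x \<in> ?U \<and> x - g x \<in> A \<inter> B}" using subspace_0[OF AB] by (simp add: g0 span_zero)
    next
      fix x y assume "x \<in> {x. g x \<in> ?U \<and> x - g x \<in> A \<inter> B}" "y \<in> {x. g x \<in> ?U \<and> x - g x \<in> A \<inter> B}"
      then have "g x + g y \<in> ?U" "(x - g x) + (y - g y) \<in> A \<inter> B"
        using span_add subspace_add[OF AB] by blast+
      moreover have "(x - g x) + (y - g y) = (x + y) - g (x + y)" by (simp add: gl)
      ultimately show "x + y \<in> {x. g x \<in> ?U \<and> x - g x \<in> A \<inter> B}" by (simp add: gl)
    next
      fix c x assume x: "x \<in> {x. g x \<in> ?U \<and> x - g x \<in> A \<inter> B}"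
      then have "scale c (x - g x) \<in> A \<inter> B" using subspace_scale[OF AB] by blast
      then show "scale c x \<in> {x. g x \<in> ?U \<and> x - g x \<in> A \<inter> B}"
        using x by (simp add: gl span_scale scale_right_diff_distrib)
    qed
    fix x assume x: "x \<in> b'"
    show "g x \<in> ?U \<and> x - g x \<in> A \<inter> B"
    proof (cases "x \<in> b")
      case True
      then show ?thesis using g(2) x b(1) by (auto intro: span_zero)
    next
      case False
      then show ?thesis using g(2) x subspace_0[OF AB] by (auto intro: span_base)
    qed
  qed
  have UA: "?U \<subseteq> A" by (rule span_minimal[OF _ A]) (use b'(2) in auto)
  moreover have "x = 0" if "x \<in> ?U" "x \<in> B" for x
    using g_id[OF that(1)] g_b[of x] that UA by auto
  then have "?U \<inter> B = {0}" using subspace_0[OF B] span_zero by auto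
  moreover have "\<exists>u\<in>?U. a - u \<in> B" if "a \<in> A" for a using g_A[of a] that b'(4) by blast
  ultimately show ?thesis using subspace_span by blast
qed

lemma subspace_basis:
  assumes "finite B0" "span B0 = UNIV" "subspace S"
  shows "\<exists>hs. distinct hs \<and> independent (set hs) \<and> span (set hs) = S"
proof -
  obtain b where b: "b \<subseteq> S" "independent b" "S \<subseteq> span b" using maximal_independent_subset[of S] by blast
  have "finite b" using independent_span_bound[OF assms(1) b(2)] assms(2) by auto
  then obtain hs where "set hs = b" "distinct hs" using finite_distinct_list by blast
  then show ?thesis using b span_minimal[OF b(1) assms(3)] by blast
qed

text \<open>The coordinate functionals of \<open>hs\<close> form a basis of the dual space, so
  \<open>exterior_power_coords\<close> applies to them; the index set is then pulled back from lists
  of functionals to lists over \<open>hs\<close>.\<close>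

lemma exterior_power_dual_coords:
  assumes hs: "distinct hs" "independent (set hs)"
  shows "\<exists>T. linear_iso T (coord_module {A \<in> set (subseqs hs). length A = r})
     (exterior_power (dual_space scale (span (set hs))) r)"
proof -
  let ?p = "pointwise (*) :: 'a \<Rightarrow> ('b \<Rightarrow> 'a) \<Rightarrow> 'b \<Rightarrow> 'a"
  interpret p: vector_space ?p by (rule vector_space_pointwise) (rule vector_space_field)
  let ?H = "span (set hs)"
  define \<phi> where "\<phi> b x = (if x \<in> ?H then representation (set hs) x b else 0)" for b x
  have \<phi>_basis: "\<phi> b b' = (if b = b' then 1 else 0)" if "b' \<in> set hs" for b b'
    using representation_basis[OF hs(2) that] that by (auto simp: \<phi>_def span_base)
  have inj: "inj_on \<phi> (set hs)"
  proof (rule inj_onI)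
    fix b b' assume b: "b \<in> set hs" "b' \<in> set hs" and eq: "\<phi> b = \<phi> b'"
    from fun_cong[OF eq, of b'] show "b = b'" using \<phi>_basis[OF b(2), of b] \<phi>_basis[OF b(2), of b']
      by (auto split: if_splits)
  qed
  let ?es = "map \<phi> hs"
  have es: "distinct ?es" using hs(1) inj by (simp add: distinct_map)
  have ind: "p.independent (set ?es)"
  proof
    assume "p.dependent (set ?es)"
    then obtain u v where u: "v \<in> set ?es" "u v \<noteq> 0" "(\<Sum>v\<in>set ?es. ?p (u v) v) = 0"
      using p.dependent_finite[of "set ?es"] by auto
    obtain b where b: "b \<in> set hs" "v = \<phi> b" using u(1) by auto
    have "(\<Sum>v\<in>set ?es. ?p (u v) v) b = (\<Sum>b'\<in>set hs. u (\<phi> b') * \<phi> b' b)"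
      unfolding sum_fun_apply by (simp add: sum.reindex[OF inj] pointwise_def)
    also have "\<dots> = (\<Sum>b'\<in>set hs. if b' = b then u (\<phi> b) else 0)"
      by (intro sum.cong refl) (simp add: \<phi>_basis[OF b(1)])
    also have "\<dots> = u v" using b by simp
    finally show False using u(2,3) by simp
  qed
  let ?D = "{f. (\<forall>x\<in>?H. \<forall>y\<in>?H. f (x + y) = f x + f y) \<and> (\<forall>c. \<forall>x\<in>?H. f (scale c x) = c * f x) \<and> (\<forall>x.
      x \<notin> ?H \<longrightarrow> f x = 0)}"
  have D_sub: "p.subspace ?D"
    by (auto simp: p.subspace_def pointwise_def algebra_simps)
  have "\<phi> b \<in> ?D" if "b \<in> set hs" for b
    unfolding \<phi>_def using representation_add[OF hs(2)] representation_scale[OF hs(2)]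
    by (auto simp: span_add span_scale)
  then have "p.span (set ?es) \<subseteq> ?D" by (intro p.span_minimal[OF _ D_sub]) auto
  moreover have "f \<in> p.span (set ?es)" if f: "f \<in> ?D" for f
  proof -
    have f_sum: "f (\<Sum>b\<in>K. scale (c b) b) = (\<Sum>b\<in>K. c b * f b)" if "K \<subseteq> set hs" "finite K" for c K
      using that(2,1)
    proof (induction K rule: finite_induct)
      case empty
      have "f (scale 0 0) = 0 * f 0" using f span_zero by blast
      then show ?case by simp
    next
      case (insert b K)
      have "b \<in> ?H" "scale (c b) b \<in> ?H" using insert.prems by (simp_all add: span_base span_scale)
      moreover have "(\<Sum>b\<in>K. scale (c b) b) \<in> ?H"
        by (rule span_sum, rule span_scale, rule span_base) (use insert.prems in auto)
      ultimately have "scale (c b) b \<in> ?H" "b \<in> ?H" "(\<Sum>b\<in>K. scale (c b) b) \<in> ?H" by auto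
      then show ?case using f insert by simp
    qed
    have "f x = (\<Sum>b\<in>set hs. ?p (f b) (\<phi> b)) x" for x
    proof (cases "x \<in> ?H")
      case True
      have "x = (\<Sum>b\<in>set hs. scale (representation (set hs) x b) b)"
        by (rule sum_representation_eq[symmetric, OF hs(2) True]) auto
      then have "f x = f (\<Sum>b\<in>set hs. scale (representation (set hs) x b) b)" by (rule arg_cong)
      also have "\<dots> = (\<Sum>b\<in>set hs. representation (set hs) x b * f b)" by (rule f_sum) auto
      finally show ?thesis using True by (simp add: sum_fun_apply pointwise_def \<phi>_def mult.commute)
    next
      case False
      then have "f x = 0" using f by blast
      then show ?thesis using False by (simp add: sum_fun_apply pointwise_def \<phi>_def)
    qed
    then have "f = (\<Sum>b\<in>set hs. ?p (f b) (\<phi> b))" by (rule HOL.ext)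
    moreover have "(\<Sum>b\<in>set hs. ?p (f b) (\<phi> b)) \<in> p.span (set ?es)"
      by (intro p.span_sum p.span_scale p.span_base) auto
    ultimately show ?thesis by metis
  qed
  ultimately have D: "dual_space scale ?H = subspace_module ?p (p.span (set ?es))"
    unfolding dual_space_def by (intro arg_cong[of _ _ "subspace_module ?p"]) blast
  let ?J = "{A \<in> set (subseqs hs). length A = r}" and ?J' = "{A \<in> set (subseqs ?es). length A = r}"
  have "inj_on (map \<phi>) ?J"
  proof (rule inj_on_subset)
    show "inj_on (map \<phi>) (lists (set hs))" using inj by (rule inj_on_map_lists)
    show "?J \<subseteq> lists (set hs)" using subseqs_powset[of hs] by (auto simp: lists_eq_set)
  qed
  moreover have "map \<phi> ` ?J = ?J'" unfolding set_subseqs_map by auto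
  ultimately have "bij_betw (inv_into ?J (map \<phi>)) ?J' ?J"
    by (intro bij_betw_inv_into) (simp add: bij_betw_def)
  from coord_module_reindex[OF this] obtain f
      where "linear_iso f (coord_module ?J :: ('a, _) module) (coord_module ?J')" by blast
  moreover obtain T where "linear_iso T (coord_module ?J') (exterior_power (dual_space scale ?H) r)"
    using p.exterior_power_coords[OF es ind, of r] unfolding D by blast
  ultimately show ?thesis using linear_iso_trans by blast
qed

end

context lie_algebra
begin

text \<open>Zero bracket and trivial action make the differential vanish, so the cohomology is the
  space of alternating forms itself, with the dual forms as basis.\<close>

lemma abelian_cohomology_coords:
  assumes ab: "abelian H" and hs: "distinct hs" "independent (set hs)" "span (set hs) = H"
  shows "\<exists>T. linear_iso T (coord_module {A \<in> set (subseqs hs). length A = r})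
     (cohomology scale bracket (*) (\<lambda>_ _. 0) H r)"
proof -
  interpret k: vector_space "(*) :: 'k \<Rightarrow> 'k \<Rightarrow> 'k" by (rule vector_space_field)
  interpret c: vector_space "pointwise (*) :: 'k \<Rightarrow> ('g list \<Rightarrow> 'k) \<Rightarrow> 'g list \<Rightarrow> 'k"
    by (rule vector_space_pointwise) (rule vector_space_field)
  have lm: "lie_module scale bracket ((*) :: 'k \<Rightarrow> 'k \<Rightarrow> 'k) (\<lambda>_ _. 0)"
    by (intro lie_module.intro lie_module_axioms.intro lie_algebra_axioms vector_space_field) simp_all
  let ?C = "cochains scale ((*) :: 'k \<Rightarrow> 'k \<Rightarrow> 'k) H"
  let ?d = "differential bracket ((*) :: 'k \<Rightarrow> 'k \<Rightarrow> 'k) (\<lambda>_ _. 0) H"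
  let ?J = "{A \<in> set (subseqs hs). length A = r}"
  have C_sub: "c.subspace (?C n)" for n by (rule lie_module.subspace_C[OF lm])
  have H: "subspace H" using hs(3) subspace_span by metis
  have d0: "?d n F = 0" if F: "F \<in> ?C n" for n F
  proof
    fix xs
    have "F (bracket (xs ! i) (xs ! j) # zs) = 0" if "xs \<in> tuples (Suc n) H" "i < j" "j \<le> n" for i j zs
    proof -
      have "bracket (xs ! i) (xs ! j) = 0"
        using ab tuples_nth[OF that(1)] that(2,3) by (simp add: abelian_def)
      then show ?thesis using lie_module.C_zero_entry[OF lm F H] by simp
    qed
    then show "?d n F xs = 0 xs" by (simp add: differential_def)
  qed
  have cob: "coboundaries scale bracket (*) (\<lambda>_ _. 0) H r = {0 :: 'g list \<Rightarrow> 'k}"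
  proof (cases r)
    case (Suc m)
    have "?C m \<noteq> {}" using c.subspace_0[OF C_sub] by blast
    then have "?d m ` ?C m = {0}" using d0[of _ m] by (auto simp: image_def)
    then show ?thesis using Suc by simp
  qed simp
  have coc: "cocycles scale bracket (*) (\<lambda>_ _. 0) H r = ?C r" using d0 by (auto simp: cocycles_def)
  obtain \<omega> where \<omega>: "\<And>A. \<omega> A \<in> ?C r"
      "\<And>A B. \<lbrakk>B \<in> set (subseqs hs); length B = r\<rbrakk> \<Longrightarrow> \<omega> A B = (if B = A then 1 else 0)"
    using exists_dual_forms[OF hs(1,2), of r] unfolding hs(3) by auto
  define T where "T c = (\<Sum>A\<in>?J. pointwise (*) (c A) (\<omega> A))" for c
  have T_app: "T c xs = (\<Sum>A\<in>?J. c A * \<omega> A xs)" for c xs by (simp add: T_def sum_fun_apply pointwise_def)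
  have sub0: "c.subspace {0}" by (rule c.subspace_single_0)
  have "linear_iso (\<lambda>c. coset_of {0} (T c)) (coord_module ?J) (quotient_module (pointwise (*)) (?C r) {0})"
  proof (intro linear_iso_quotient[OF c.vector_space_axioms c.vector_space_axioms subspace_coords sub0])
    fix c :: "'g list \<Rightarrow> 'k" assume c: "c \<in> fun_space ?J UNIV"
    show "T c \<in> ?C r" unfolding T_def
      by (intro c.subspace_sum[OF C_sub] c.subspace_scale[OF C_sub] \<omega>(1))
    have "T (pointwise (*) x c) = pointwise (*) x (T c)" for x
      by (rule HOL.ext) (simp only: T_app pointwise_def sum_distrib_left mult.assoc)
    then show "T (pointwise (*) x c) - pointwise (*) x (T c) \<in> {0}" for x by simp
    have "T (c + c') = T c + T c'" for c'
      by (rule HOL.ext) (simp only: T_app plus_fun_apply distrib_right sum.distrib)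
    then show "T (c + c') - T c - T c' \<in> {0}" for c' by simp
    assume Tc: "T c \<in> {0}"
    have "c B = 0" if B: "B \<in> ?J" for B
    proof -
      have "T c B = (\<Sum>A\<in>?J. if A = B then c A else 0)"
        unfolding T_app using \<omega>(2)[of B] B by (intro sum.cong) auto
      also have "\<dots> = c B" using B by simp
      finally show ?thesis using Tc by simp
    qed
    then show "c = 0" using c by (auto simp: fun_space_def fun_eq_iff)
  next
    fix F assume F: "F \<in> ?C r"
    define c where "c A = (if A \<in> ?J then F A else 0)" for A
    have "F = T c"
    proof
      fix xs
      have "F xs = (\<Sum>A\<in>?J. F A * \<omega> A xs)"
        by (rule fun_cong[OF cochain_expansion[OF hs(1,2), unfolded hs(3), OF \<omega> F]])
      also have "\<dots> = T c xs" unfolding T_app by (intro sum.cong) (auto simp: c_def)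
      finally show "F xs = T c xs" .
    qed
    moreover have "c \<in> fun_space ?J UNIV" by (simp add: c_def fun_space_def)
    ultimately show "\<exists>c\<in>fun_space ?J UNIV. F - T c \<in> {0}" by auto
  qed
  then show ?thesis unfolding cohomology_def cob coc by blast
qed

end

section \<open>Invariant cochains compute the cohomology\<close>

context lie_module_torus
begin

abbreviation "Z \<equiv> cocycles scale bracket mscale act"
abbreviation "B \<equiv> coboundaries scale bracket mscale act"

text \<open>\<open>Z0\<close> consists of the cocycles with invariant class. That \<open>B \<subseteq> Z\<close> is
  never used.\<close>

definition Z0 :: "'b set \<Rightarrow> nat \<Rightarrow> ('b list \<Rightarrow> 'c) set" where
  "Z0 S n = {F \<in> Z S n. \<forall>h\<in>H. \<theta> S n h F \<in> B S n}"

definition ZI :: "'b set \<Rightarrow> nat \<Rightarrow> ('b list \<Rightarrow> 'c) set" where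
  "ZI S n = {F \<in> CI S n. d S n F = 0}"

definition BI :: "'b set \<Rightarrow> nat \<Rightarrow> ('b list \<Rightarrow> 'c) set" where
  "BI S n = B S n \<inter> CI S n"

lemma subspace_Z: "W.subspace (Z S n)"
  using subspace_C[of S n] unfolding W.subspace_def cocycles_def
  by (auto simp: d_add d_scale W.scale_zero_right)

lemma subspace_B: "W.subspace (B S n)"
proof (cases n)
  case (Suc m)
  have "W.subspace (d S m ` C S m)"
  proof (rule W.subspaceI)
    show "0 \<in> d S m ` C S m" using C_zero[of S m] d_0[of S m] by (metis image_eqI)
    fix x y assume "x \<in> d S m ` C S m" "y \<in> d S m ` C S m"
    then obtain F G where FG: "F \<in> C S m" "G \<in> C S m" "x = d S m F" "y = d S m G" by auto
    have "x + y = d S m (F + G)" by (simp only: FG d_add)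
    then show "x + y \<in> d S m ` C S m" using C_add[OF FG(1,2)] by (rule image_eqI)
  next
    fix c x assume "x \<in> d S m ` C S m"
    then obtain F where F: "F \<in> C S m" "x = d S m F" by auto
    have "pointwise mscale c x = d S m (pointwise mscale c F)" by (simp only: F d_scale)
    then show "pointwise mscale c x \<in> d S m ` C S m" using C_scale[OF F(1)] by (rule image_eqI)
  qed
  then show ?thesis using Suc by simp
qed (simp add: W.subspace_single_0)

lemma subspace_ZI: "W.subspace (ZI S n)"
  using subspace_CI[of S n] unfolding W.subspace_def ZI_def
  by (auto simp: d_add d_scale W.scale_zero_right)

lemma subspace_BI: "W.subspace (BI S n)"
  unfolding BI_def by (rule W.subspace_inter[OF subspace_B subspace_CI])

text \<open>\<open>S\<close> will be the whole algebra or \<open>\<kk>\<close>, and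
  \<open>hs\<close> a basis of \<open>\<hh>\<close>. The hypothesis \<open>ss\<close> is the shape
  in which torality is used; it will be applied to subspaces \<open>Y\<close> built along the
  way.\<close>

context
  fixes S :: "'b set" and hs :: "'b list"
  assumes S: "lie_subalgebra S" and H_S: "\<And>h x. \<lbrakk>h \<in> H; x \<in> S\<rbrakk> \<Longrightarrow> bracket h x \<in> S"
    and hs: "span (set hs) = H"
    and ss: "\<And>h F n Y. \<lbrakk>h \<in> H; F \<in> C S n; W.subspace Y; \<And>G. G \<in> Y \<Longrightarrow> \<theta> S n h G \<in> Y;
        \<theta> S n h (\<theta> S n h F) \<in> Y\<rbrakk>
       \<Longrightarrow> \<theta> S n h F \<in> Y"
begin

lemmas S_sub = lie_subalgebraD(1)[OF S]

lemma hs_H: "set hs \<subseteq> H"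
  using hs span_superset by metis

lemma \<theta>_zero_left: "F \<in> C S n \<Longrightarrow> \<theta> S n 0 F = 0"
proof
  fix xs
  assume F: "F \<in> C S n"
  have "F (xs[i := 0]) = 0" if "xs \<in> tuples n S" "i < n" for i
    using that by (intro C_zero_entry[OF F S_sub] set_update_memI) (simp add: tuples_def)
  then show "\<theta> S n 0 F xs = 0 xs" by (simp add: cochain_action_def)
qed

lemma CI_iff: "F \<in> CI S n \<longleftrightarrow> F \<in> C S n \<and> (\<forall>h\<in>set hs. \<theta> S n h F = 0)"
proof
  assume "F \<in> CI S n"
  then show "F \<in> C S n \<and> (\<forall>h\<in>set hs. \<theta> S n h F = 0)" using hs_H by (auto simp: CI_def)
next
  assume F: "F \<in> C S n \<and> (\<forall>h\<in>set hs. \<theta> S n h F = 0)"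
  note lin = \<theta>_linear_left[OF S_sub conjunct1[OF F] H_S H_S]
  have "h \<in> H \<and> \<theta> S n h F = 0" if "h \<in> span (set hs)" for h
  proof (rule span_induct[OF that])
    have sub: "subspace H" using hs subspace_span by metis
    have "\<theta> S n 0 F = 0" using F by (intro \<theta>_zero_left) blast
    then show "subspace {h. h \<in> H \<and> \<theta> S n h F = 0}"
      using subspace_0[OF sub] subspace_add[OF sub] subspace_scale[OF sub] lin
      by (intro subspaceI) (auto simp: W.scale_zero_right)
  qed (use F hs_H in auto)
  then show "F \<in> CI S n" using F hs by (auto simp: CI_def)
qed

lemma \<theta>_commute: "\<lbrakk>F \<in> C S n; h \<in> H; k \<in> H\<rbrakk> \<Longrightarrow> \<theta> S n h (\<theta> S n k F) = \<theta> S n k (\<theta> S n h F)"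
proof -
  assume F: "F \<in> C S n" and h: "h \<in> H" and k: "k \<in> H"
  have "\<theta> S n h (\<theta> S n k F) - \<theta> S n k (\<theta> S n h F) = \<theta> S n (bracket h k) F"
    using h k by (intro \<theta>_commutator[OF S_sub _ _ F] H_S)
  also have "\<dots> = 0" using \<theta>_zero_left[OF F] H_abelian[OF h k] by simp
  finally show ?thesis by (rule eq_iff_diff_eq_0[THEN iffD2])
qed

lemma \<theta>_kernel_image:
  assumes "h \<in> H" "F \<in> C S n" "\<theta> S n h (\<theta> S n h F) = 0"
  shows "\<theta> S n h F = 0"
proof -
  have "\<theta> S n h F \<in> {0}" by (rule ss[OF assms(1,2) W.subspace_single_0]) (use assms(3) in simp_all)
  then show ?thesis by simp
qed

text \<open>\<open>Y\<close> is the sum of the kernel and the image of \<open>\<theta>_h\<close> on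
  it: \<open>ss\<close> for the stable subspace \<open>\<theta>_h \<theta>_h Y\<close> gives
  \<open>\<theta>_h F = \<theta>_h \<theta>_h u\<close>.\<close>

lemma kernel_part:
  assumes h: "h \<in> H" and Y: "W.subspace Y" "Y \<subseteq> C S n" "\<And>G. G \<in> Y \<Longrightarrow> \<theta> S n h G \<in> Y" and F: "F \<in> Y"
  shows "\<exists>u\<in>Y. \<theta> S n h (F - \<theta> S n h u) = 0"
proof -
  let ?t = "\<theta> S n h"
  have "?t F \<in> (\<lambda>u. ?t (?t u)) ` Y"
  proof (rule ss[OF h])
    show "F \<in> C S n" using F Y by auto
    show "W.subspace ((\<lambda>u. ?t (?t u)) ` Y)"
    proof (rule W.subspaceI)
      show "0 \<in> (\<lambda>u. ?t (?t u)) ` Y" using W.subspace_0[OF Y(1)] \<theta>_0 by (metis image_eqI)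
      fix x y assume "x \<in> (\<lambda>u. ?t (?t u)) ` Y" "y \<in> (\<lambda>u. ?t (?t u)) ` Y"
      then obtain a b where ab: "a \<in> Y" "b \<in> Y" "x = ?t (?t a)" "y = ?t (?t b)" by auto
      have "x + y = ?t (?t (a + b))" by (simp only: ab \<theta>_add)
      then show "x + y \<in> (\<lambda>u. ?t (?t u)) ` Y" using W.subspace_add[OF Y(1) ab(1,2)] by (rule image_eqI)
    next
      fix c x assume "x \<in> (\<lambda>u. ?t (?t u)) ` Y"
      then obtain a where a: "a \<in> Y" "x = ?t (?t a)" by auto
      have "pointwise mscale c x = ?t (?t (pointwise mscale c a))" by (simp only: a \<theta>_scale)
      then show "pointwise mscale c x \<in> (\<lambda>u. ?t (?t u)) ` Y"
        using W.subspace_scale[OF Y(1) a(1)] by (rule image_eqI)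
    qed
    show "?t G \<in> (\<lambda>u. ?t (?t u)) ` Y" if "G \<in> (\<lambda>u. ?t (?t u)) ` Y" for G using that Y(3) by auto
    show "?t (?t F) \<in> (\<lambda>u. ?t (?t u)) ` Y" using F by blast
  qed
  then obtain u where u: "u \<in> Y" "?t F = ?t (?t u)" by auto
  have "?t (F - ?t u) = 0" by (simp add: \<theta>_diff u(2))
  then show ?thesis using u(1) by blast
qed

text \<open>The invariant part is split off one basis vector of \<open>H\<close> at a time; \<open>Q\<close> collects what is
  removed.\<close>

lemma invariant_part:
  assumes Y: "W.subspace Y" "Y \<subseteq> C S n" "\<And>h G. \<lbrakk>h \<in> H; G \<in> Y\<rbrakk> \<Longrightarrow> \<theta> S n h G \<in> Y"
    and Q: "W.subspace Q" "\<And>h u. \<lbrakk>h \<in> H; u \<in> Y\<rbrakk> \<Longrightarrow> \<theta> S n h u \<in> Q"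
    and z: "z \<in> Y" and ks: "set ks \<subseteq> H"
  shows "\<exists>z0\<in>Y. (\<forall>h\<in>set ks. \<theta> S n h z0 = 0) \<and> z - z0 \<in> Q"
  using ks
proof (induction ks)
  case Nil
  have "z - z \<in> Q" unfolding diff_self by (rule W.subspace_0[OF Q(1)])
  then show ?case unfolding list.set using z by blast
next
  case (Cons k ks)
  have k: "k \<in> H" and ks: "set ks \<subseteq> H" using Cons.prems by auto
  obtain z1 where z1: "z1 \<in> Y" "\<forall>h\<in>set ks. \<theta> S n h z1 = 0" "z - z1 \<in> Q" using Cons.IH[OF ks] by blast
  \<comment> \<open>The next correction is taken among the vectors already annihilated by
    \<open>ks\<close>. They form a \<open>\<theta>_k\<close>-stable space because the operators
    commute, so earlier annihilation is preserved.\<close>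
  define Y1 where "Y1 = {F \<in> Y. \<forall>h\<in>set ks. \<theta> S n h F = 0}"
  have Y1: "W.subspace Y1"
    unfolding Y1_def using W.subspace_0[OF Y(1)] W.subspace_add[OF Y(1)] W.subspace_scale[OF Y(1)]
    by (intro W.subspaceI) (auto simp: \<theta>_add \<theta>_scale W.scale_zero_right)
  have \<theta>Y1: "\<theta> S n k G \<in> Y1" if G: "G \<in> Y1" for G
  proof -
    have "\<theta> S n h (\<theta> S n k G) = 0" if "h \<in> set ks" for h
      using \<theta>_commute[of G n h k] G that Y(2) k ks by (auto simp: Y1_def)
    then show ?thesis using G Y(3)[OF k] by (simp add: Y1_def)
  qed
  have "Y1 \<subseteq> C S n" "z1 \<in> Y1" using Y(2) z1 by (auto simp: Y1_def)
  then obtain u where u: "u \<in> Y1" "\<theta> S n k (z1 - \<theta> S n k u) = 0"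
    using kernel_part[OF k Y1 _ \<theta>Y1] by blast
  have uk: "\<theta> S n k u \<in> Y1" using u(1) by (rule \<theta>Y1)
  let ?z = "z1 - \<theta> S n k u"
  have "?z \<in> Y1" using z1 uk by (intro W.subspace_diff[OF Y1]) (auto simp: Y1_def)
  then have "?z \<in> Y" "\<forall>h\<in>set (k # ks). \<theta> S n h ?z = 0" using u(2) unfolding Y1_def list.set by blast+
  moreover have "(z - z1) + \<theta> S n k u \<in> Q"
    using u(1) by (intro W.subspace_add[OF Q(1)] z1 Q(2) k) (simp add: Y1_def)
  then have "z - ?z \<in> Q" by (simp add: algebra_simps)
  ultimately show ?case by blast
qed

lemma \<theta>_B:
  assumes h: "h \<in> H" and b: "b \<in> B S n"
  shows "\<theta> S n h b \<in> B S n"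
proof (cases n)
  case 0
  then show ?thesis using b by simp
next
  case (Suc m)
  then obtain c where c: "c \<in> C S m" "b = d S m c" using b by auto
  have "\<theta> S n h b = d S m (\<theta> S m h c)" unfolding c(2) Suc by (rule \<theta>_d_commute[OF S H_S[OF h] c(1)])
  then show ?thesis unfolding Suc coboundaries.simps
    using \<theta>_C[OF S_sub H_S[OF h] c(1)] by (rule image_eqI)
qed

lemma \<theta>_Z:
  assumes h: "h \<in> H" and z: "z \<in> Z S n"
  shows "\<theta> S n h z \<in> Z S n"
proof -
  have z': "z \<in> C S n" "d S n z = 0" using z by (auto simp: cocycles_def)
  have "d S n (\<theta> S n h z) = \<theta> S (Suc n) h 0"
    unfolding z'(2)[symmetric] by (rule \<theta>_d_commute[OF S H_S[OF h] z'(1), symmetric])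
  then show ?thesis using \<theta>_C[OF S_sub H_S[OF h] z'(1)] by (simp add: cocycles_def)
qed

lemma ZI_Z0: "ZI S n \<subseteq> Z0 S n"
  using W.subspace_0[OF subspace_B] by (auto simp: ZI_def Z0_def CI_def cocycles_def)

lemma subspace_Z0: "W.subspace (Z0 S n)"
  unfolding Z0_def using W.subspace_0[OF subspace_Z] W.subspace_add[OF subspace_Z]
      W.subspace_scale[OF subspace_Z]
    W.subspace_0[OF subspace_B] W.subspace_add[OF subspace_B] W.subspace_scale[OF subspace_B]
  by (intro W.subspaceI) (auto simp: \<theta>_add \<theta>_scale)

text \<open>On \<open>Z0\<close> the action lands in the coboundaries, so splitting off the
  invariant part leaves the class unchanged.\<close>

lemma Z0_invariant:
  assumes "z \<in> Z0 S n"
  shows "\<exists>z0\<in>ZI S n. z - z0 \<in> B S n"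
proof -
  have "\<exists>z0\<in>Z0 S n. (\<forall>h\<in>set hs. \<theta> S n h z0 = 0) \<and> z - z0 \<in> B S n"
  proof (rule invariant_part[OF subspace_Z0 _ _ subspace_B _ assms hs_H])
    show "Z0 S n \<subseteq> C S n" by (auto simp: Z0_def cocycles_def)
    fix h G assume h: "h \<in> H" and G: "G \<in> Z0 S n"
    show "\<theta> S n h G \<in> B S n" using h G by (simp add: Z0_def)
    show "\<theta> S n h G \<in> Z0 S n" using \<theta>_Z[OF h] \<theta>_B h G by (simp add: Z0_def)
  qed
  then show ?thesis by (auto simp: ZI_def CI_iff Z0_def cocycles_def)
qed

text \<open>A primitive of an invariant coboundary is made invariant one basis vector at a time, and
  each correction leaves its differential unchanged.\<close>

lemma BI_Suc: "BI S (Suc m) = d S m ` CI S m"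
proof (intro equalityI subsetI)
  fix b assume "b \<in> d S m ` CI S m"
  then obtain c where c: "c \<in> CI S m" "b = d S m c" by auto
  have "\<theta> S (Suc m) h b = 0" if "h \<in> H" for h
    using \<theta>_d_commute[OF S H_S[OF that] CI_D(1)[OF c(1)]] CI_D(2)[OF c(1) that] unfolding c(2) by simp
  then show "b \<in> BI S (Suc m)"
    using d_C[OF S CI_D(1)[OF c(1)]] CI_D(1)[OF c(1)] c(2) by (auto simp: BI_def CI_def)
next
  fix b assume b: "b \<in> BI S (Suc m)"
  have "\<exists>c\<in>C S m. (\<forall>h\<in>set ks. \<theta> S m h c = 0) \<and> d S m c = b" if "set ks \<subseteq> H" for ks
    using that
  proof (induction ks)
    case Nil
    then show ?case using b by (auto simp: BI_def)
  next
    case (Cons k ks)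
    have k: "k \<in> H" and ks: "set ks \<subseteq> H" using Cons.prems by auto
    obtain c where c: "c \<in> C S m" "\<forall>h\<in>set ks. \<theta> S m h c = 0" "d S m c = b" using Cons.IH[OF ks] by blast
    define Y where "Y = {F \<in> C S m. \<forall>h\<in>set ks. \<theta> S m h F = 0}"
    have Y: "W.subspace Y"
      unfolding Y_def using C_zero C_add C_scale
      by (intro W.subspaceI) (auto simp: \<theta>_add \<theta>_scale W.scale_zero_right)
    have \<theta>Y: "\<theta> S m k G \<in> Y" if G: "G \<in> Y" for G
    proof -
      have "\<theta> S m h (\<theta> S m k G) = 0" if "h \<in> set ks" for h
        using \<theta>_commute[of G m h k] G that k ks by (auto simp: Y_def)
      then show ?thesis using G \<theta>_C[OF S_sub H_S[OF k]] by (simp add: Y_def)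
    qed
    have "Y \<subseteq> C S m" "c \<in> Y" using c by (auto simp: Y_def)
    then obtain u where u: "u \<in> Y" "\<theta> S m k (c - \<theta> S m k u) = 0"
      using kernel_part[OF k Y _ \<theta>Y] by blast
    let ?c = "c - \<theta> S m k u"
    have uC: "u \<in> C S m" using u(1) by (simp add: Y_def)
    have cY: "?c \<in> Y" using c by (intro W.subspace_diff[OF Y] \<theta>Y u(1)) (simp add: Y_def)
    then have cC: "?c \<in> C S m" by (simp add: Y_def)
    have dth: "d S m (\<theta> S m k u) = \<theta> S (Suc m) k (d S m u)"
      by (rule \<theta>_d_commute[OF S H_S[OF k] uC, symmetric])
    have "\<theta> S (Suc m) k (d S m ?c) = d S m (\<theta> S m k ?c)" by (rule \<theta>_d_commute[OF S H_S[OF k] cC])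
    then have "\<theta> S (Suc m) k (d S m ?c) = 0" using u(2) by simp
    moreover have "\<theta> S (Suc m) k b = 0" using b k by (simp add: BI_def CI_def)
    \<comment> \<open>Both \<open>b = d c\<close> and the differential of the corrected cochain are
      annihilated by \<open>\<theta>_k\<close>; hence so is their difference
      \<open>\<theta>_k (d u)\<close>, and \<open>\<theta>_kernel_image\<close> shows that it is
      zero.\<close>
    ultimately have "\<theta> S (Suc m) k (\<theta> S (Suc m) k (d S m u)) = 0"
      unfolding d_diff c(3) dth \<theta>_diff by simp
    then have "\<theta> S (Suc m) k (d S m u) = 0" by (rule \<theta>_kernel_image[OF k d_C[OF S uC]])
    then have "d S m ?c = b" unfolding d_diff c(3) dth by simp
    moreover have "\<forall>h\<in>set (k # ks). \<theta> S m h ?c = 0" using cY u(2) unfolding Y_def list.set by blast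
    ultimately show ?case using cC by blast
  qed
  from this[OF hs_H] obtain c where "c \<in> C S m" "\<forall>h\<in>set hs. \<theta> S m h c = 0" "d S m c = b" by blast
  then show "b \<in> d S m ` CI S m" using CI_iff by blast
qed

lemma Z0_eq_Z: "H \<subseteq> S \<Longrightarrow> Z0 S n = Z S n"
proof (intro equalityI subsetI)
  fix z assume HS: "H \<subseteq> S" and z: "z \<in> Z S n"
  have z': "z \<in> C S n" "d S n z = 0" using z by (auto simp: cocycles_def)
  have "\<theta> S n h z \<in> B S n" if h: "h \<in> H" for h
  proof -
    have hS: "h \<in> S" using h HS by auto
    have "\<theta> S n h z = (if n = 0 then 0 else d S (n - 1) (ins h z))"
      using ins_d_normalized[OF S z'(1) hS] z'(2) by simp
    then show ?thesis using C_ins[of z S "n - 1" h] z'(1) hS by (cases n) auto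
  qed
  then show "z \<in> Z0 S n" using z by (simp add: Z0_def)
qed (simp add: Z0_def)

text \<open>Here \<open>Z0 = ZI + B\<close> and \<open>ZI = U + BI\<close>, so \<open>U\<close>
  meets every class; it meets \<open>B\<close> only in zero because its elements are invariant and
  would lie in \<open>BI\<close>.\<close>

lemma quotient_Z0_coords:
  assumes U: "W.subspace U" "U \<subseteq> ZI S n" "U \<inter> BI S n = {0}" "\<And>z. z \<in> ZI S n \<Longrightarrow> \<exists>u\<in>U. z - u \<in> BI S n"
  shows "linear_iso (\<lambda>u. coset_of (B S n) u) (subspace_module (pointwise mscale) U)
     (quotient_module (pointwise mscale) (Z0 S n) (B S n))"
proof (rule linear_iso_quotient[OF W.vector_space_axioms W.vector_space_axioms U(1) subspace_B])
  fix u assume u: "u \<in> U"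
  show "u \<in> Z0 S n" using u U(2) ZI_Z0 by blast
  show "pointwise mscale c u - pointwise mscale c u \<in> B S n"
    for c using W.subspace_0[OF subspace_B] by simp
  show "u + u' - u - u' \<in> B S n" for u' using W.subspace_0[OF subspace_B] by simp
  assume "u \<in> B S n"
  then show "u = 0" using u U(2,3) by (auto simp: BI_def ZI_def)
next
  fix z assume "z \<in> Z0 S n"
  then obtain z0 where z0: "z0 \<in> ZI S n" "z - z0 \<in> B S n" using Z0_invariant by blast
  obtain u where u: "u \<in> U" "z0 - u \<in> BI S n" using U(4)[OF z0(1)] by blast
  have "(z - z0) + (z0 - u) \<in> B S n"
    using u(2) by (intro W.subspace_add[OF subspace_B] z0(2)) (simp add: BI_def)
  then show "\<exists>y\<in>U. z - y \<in> B S n" using u(1) by auto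
qed

text \<open>A class is annihilated by \<open>h\<close> exactly when \<open>\<theta>_h\<close> sends
  a representative to a coboundary, which is the condition in \<open>Z0\<close>.\<close>

lemma weight_zero_cohomology_eq:
  "weight_zero_cohomology scale bracket mscale act H S n
    = quotient_module (pointwise mscale) (Z0 S n) (B S n)"
proof -
  have ind: "induced (B S n) (\<theta> S n h) (coset_of (B S n) z) = coset_of (B S n) (\<theta> S n h z)"
    if "h \<in> H" for h z
    by (rule W.induced_coset_of[OF subspace_B])
      (use \<theta>_B[OF that] W.subspace_0[OF subspace_B] in \<open>simp_all add: \<theta>_add\<close>)
  have zero: "coset_of (B S n) z = B S n \<longleftrightarrow> z \<in> B S n" for z
    using W.coset_of_eq_iff[OF subspace_B, of S n z 0] by (simp add: coset_of_def)
  have "(\<forall>h\<in>H. induced (B S n) (\<theta> S n h) (coset_of (B S n) z) = B S n) \<longleftrightarrow> (\<forall>h\<in>H. \<theta> S n h z \<in> B S n)"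
    for z
    using ind zero by metis
  then have "{A \<in> coset_of (B S n) ` Z S n. \<forall>h\<in>H. induced (B S n) (\<theta> S n h) A = B S n}
      = coset_of (B S n) ` Z0 S n"
    unfolding Z0_def by blast
  then show ?thesis
    by (simp add: weight_zero_cohomology_def cohomology_def quotient_module_def)
qed

end

end

section \<open>The cohomology of the semidirect product\<close>

context lie_module_torus
begin

lemma comp_linear:
  "comp A n (F + G) = comp A n F + comp A n G" "comp A n (F - G) = comp A n F - comp A n G"
  "comp A n (pointwise mscale c F) = pointwise mscale c (comp A n F)" "comp A n 0 = 0"
  by (auto simp: comp_def restr_def fun_eq_iff pointwise_def)

lemma lie_subalgebra_UNIV: "lie_subalgebra UNIV"
  by (simp add: lie_subalgebra_def)

context
  fixes hs :: "'b list"
  assumes ind: "indep_mod hs" and hs: "span (set hs) = H" and full: "ext_by hs = UNIV"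
begin

lemma subseqs_in: "A \<in> set (subseqs hs) \<Longrightarrow> set A \<subseteq> UNIV \<inter> H"
  using subseqs_set[of A hs] hs span_superset by blast

lemma eq_if_comps_eq:
  assumes F: "F \<in> C UNIV n" and G: "G \<in> C UNIV n"
    and eq: "\<And>A. \<lbrakk>A \<in> set (subseqs hs); length A \<le> n\<rbrakk> \<Longrightarrow> comp A n F = comp A n G"
  shows "F = G"
proof -
  have FG: "F - G \<in> C (ext_by hs) n" unfolding full using F G by (rule C_diff)
  have hsH: "set hs \<subseteq> H" using hs span_superset by metis
  have "F - G = 0"
  proof (rule eq_0_if_components[OF hsH ind FG])
    fix A xs assume A: "A \<in> set (subseqs hs)" and xs: "set xs \<subseteq> K"
    show "(F - G) (A @ xs) = 0"
    proof (cases "length (A @ xs) = n")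
      case True
      then have "xs \<in> tuples (n - length A) K" using xs by (auto simp: tuples_def)
      then show ?thesis using fun_cong[OF eq[OF A], of xs] True by (simp add: comp_def restr_def)
    next
      case False
      then show ?thesis using C_off[OF FG] by (simp add: tuples_def)
    qed
  qed
  then show ?thesis by (rule eq_iff_diff_eq_0[THEN iffD2])
qed

lemma comps_exist:
  assumes "\<And>A. \<lbrakk>A \<in> set (subseqs hs); length A \<le> n\<rbrakk> \<Longrightarrow> u A \<in> CI K (n - length A)"
  shows "\<exists>F. F \<in> CI UNIV n \<and> (\<forall>A\<in>set (subseqs hs). length A \<le> n \<longrightarrow> comp A n F = u A)"
proof -
  have hsH: "set hs \<subseteq> H" using hs span_superset by metis
  obtain F where F: "F \<in> CI UNIV n"
      "\<And>A xs. \<lbrakk>A \<in> set (subseqs hs); length A \<le> n; set xs \<subseteq> K\<rbrakk> \<Longrightarrow> F (A @ xs) = u A xs"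
    using exists_components[OF hsH ind, of n u] assms unfolding full by blast
  have "comp A n F = u A" if A: "A \<in> set (subseqs hs)" "length A \<le> n" for A
  proof
    fix xs
    show "comp A n F xs = u A xs"
      using F(2)[OF A, of xs] C_off[OF CI_D(1)[OF assms[OF A]], of xs]
      by (cases "xs \<in> tuples (n - length A) K") (auto simp: comp_def restr_def tuples_def)
  qed
  then show ?thesis using F(1) by blast
qed

lemma comp_ZI:
  assumes F: "F \<in> ZI UNIV n" and A: "A \<in> set (subseqs hs)" "length A \<le> n"
  shows "comp A n F \<in> ZI K (n - length A)"
proof -
  have F': "F \<in> CI UNIV n" "d UNIV n F = 0" using F by (auto simp: ZI_def)
  have "pointwise mscale ((- 1) ^ length A) (d K (n - length A) (comp A n F)) = 0"
    using comp_d[OF lie_subalgebra_UNIV subset_UNIV F'(1) A(2) subseqs_in[OF A(1)]] F'(2) comp_linear(4) by simp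
  then have "d K (n - length A) (comp A n F) = 0" by (simp add: W.scale_eq_0_iff)
  then show ?thesis
    using comp_CI[OF lie_subalgebra_UNIV subset_UNIV F'(1) A(2) subseqs_in[OF A(1)]]
      by (simp add: ZI_def)
qed

text \<open>Besides the components indexed as for \<open>F\<close>, \<open>d F\<close> has those of
  length \<open>n + 1\<close>; these vanish by \<open>comp_d_top\<close>.\<close>

lemma ZI_if_comps_ZI:
  assumes F: "F \<in> CI UNIV n" and comps: "\<And>A. \<lbrakk>A \<in> set (subseqs hs);
      length A \<le> n\<rbrakk> \<Longrightarrow> comp A n F \<in> ZI K (n - length A)"
  shows "F \<in> ZI UNIV n"
proof -
  have "d UNIV n F = 0"
  proof (rule eq_if_comps_eq[OF d_C[OF lie_subalgebra_UNIV CI_D(1)[OF F]] C_zero])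
    fix A assume A: "A \<in> set (subseqs hs)" "length A \<le> Suc n"
    show "comp A (Suc n) (d UNIV n F) = comp A (Suc n) 0"
    proof (cases "length A \<le> n")
      case True
      then show ?thesis
        using comp_d[OF lie_subalgebra_UNIV subset_UNIV F True subseqs_in[OF A(1)]] comps[OF A(1) True]
        unfolding comp_linear(4) by (simp add: ZI_def W.scale_zero_right)
    next
      case False
      then show ?thesis
        unfolding comp_linear(4)
          using comp_d_top[OF lie_subalgebra_UNIV subset_UNIV F _ subseqs_in[OF A(1)]]
        by (auto simp: comp_def restr_def)
    qed
  qed
  then show ?thesis using F by (simp add: ZI_def)
qed

lemma comp_d_signed:
  assumes c: "c \<in> CI UNIV m" and A: "A \<in> set (subseqs hs)" "length A \<le> Suc m"
  shows "comp A (Suc m) (d UNIV m c) = (if length A \<le> m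
     then pointwise mscale ((- 1) ^ length A) (d K (m - length A) (comp A m c)) else 0)"
  using comp_d[OF lie_subalgebra_UNIV subset_UNIV c _ subseqs_in[OF A(1)]]
    comp_d_top[OF lie_subalgebra_UNIV subset_UNIV c _ subseqs_in[OF A(1)]]
  by (auto simp: comp_def restr_def)

text \<open>On invariant cochains the differential acts on each component by the differential of \<open>K\<close>, up
  to a sign.\<close>

lemma BI_iff_comps:
  assumes BI: "\<And>m. BI UNIV (Suc m) = d UNIV m ` CI UNIV m" "\<And>m. BI K (Suc m) = d K m ` CI K m"
    and F: "F \<in> CI UNIV n"
  shows "F \<in> BI UNIV n \<longleftrightarrow> (\<forall>A\<in>set (subseqs hs). length A \<le> n \<longrightarrow> comp A n F \<in> BI K (n - length A))"
proof (cases n)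
  case 0
  have BI0: "BI S 0 = {0}" for S using W.subspace_0[OF subspace_CI] by (auto simp: BI_def)
  have "F = 0 \<longleftrightarrow> (\<forall>A\<in>set (subseqs hs). length A \<le> n \<longrightarrow> comp A n F = 0)"
    using eq_if_comps_eq[OF CI_D(1)[OF F] C_zero] comp_linear(4) by metis
  then show ?thesis using 0 BI0 by simp
next
  case (Suc m)
  show ?thesis
  proof
    assume "F \<in> BI UNIV n"
    then obtain c where c: "c \<in> CI UNIV m" "F = d UNIV m c" unfolding Suc BI by auto
    show "\<forall>A\<in>set (subseqs hs). length A \<le> n \<longrightarrow> comp A n F \<in> BI K (n - length A)"
    proof (intro ballI impI)
      fix A assume A: "A \<in> set (subseqs hs)" "length A \<le> n"
      show "comp A n F \<in> BI K (n - length A)"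
      proof (cases "length A \<le> m")
        case True
        have "comp A m c \<in> CI K (m - length A)"
          by (rule comp_CI[OF lie_subalgebra_UNIV subset_UNIV c(1) True subseqs_in[OF A(1)]])
        then have "d K (m - length A) (comp A m c) \<in> BI K (n - length A)"
          unfolding Suc Suc_diff_le[OF True] BI(2) by (rule imageI)
        then show ?thesis
          using comp_d_signed[OF c(1) A[unfolded Suc]] True W.subspace_scale[OF subspace_BI]
          unfolding c(2) Suc by simp
      next
        case False
        then show ?thesis
          using comp_d_signed[OF c(1) A[unfolded Suc]] W.subspace_0[OF subspace_BI]
            unfolding c(2) Suc by simp
      qed
    qed
  next
    assume comps: "\<forall>A\<in>set (subseqs hs). length A \<le> n \<longrightarrow> comp A n F \<in> BI K (n - length A)"
    have "\<exists>e\<in>CI K (m - length A). comp A n F = d K (m - length A) e"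
      if "A \<in> set (subseqs hs)" "length A \<le> m" for A
    proof -
      have "comp A n F \<in> BI K (Suc (m - length A))" using comps that Suc by (auto simp: Suc_diff_le)
      then show ?thesis unfolding BI by auto
    qed
    then obtain e where e: "\<And>A. \<lbrakk>A \<in> set (subseqs hs); length A \<le> m\<rbrakk> \<Longrightarrow>
        e A \<in> CI K (m - length A) \<and> comp A n F = d K (m - length A) (e A)" by metis
    \<comment> \<open>The sign cancels the one that the differential acquires on the component
      \<open>A\<close>.\<close>
    define v where "v A = pointwise mscale ((- 1) ^ length A) (e A)" for A
    have "v A \<in> CI K (m - length A)" if "A \<in> set (subseqs hs)" "length A \<le> m" for A
      unfolding v_def using e[OF that] by (intro W.subspace_scale[OF subspace_CI]) blast
    then obtain c where c: "c \<in> CI UNIV m" "\<And>A. \<lbrakk>A \<in> set (subseqs hs); length A \<le> m\<rbrakk> \<Longrightarrow> comp A m c = v A"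
      using comps_exist[of m v] by blast
    have sq: "(- 1) ^ k * (- 1) ^ k = (1 :: 'a)" for k by (simp flip: power_mult_distrib)
    have "F = d UNIV m c"
    proof (rule eq_if_comps_eq)
      show "F \<in> C UNIV (Suc m)" using CI_D(1)[OF F] Suc by simp
      show "d UNIV m c \<in> C UNIV (Suc m)" by (rule d_C[OF lie_subalgebra_UNIV CI_D(1)[OF c(1)]])
      fix A assume A: "A \<in> set (subseqs hs)" "length A \<le> Suc m"
      show "comp A (Suc m) F = comp A (Suc m) (d UNIV m c)"
      proof (cases "length A \<le> m")
        case True
        have "comp A (Suc m) (d UNIV m c) = pointwise mscale ((- 1) ^ length A * (- 1) ^ length A)
            (d K (m - length A) (e A))"
          using True c(2)[OF A(1) True] by (simp add: comp_d_signed[OF c(1) A] v_def d_scale)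
        also have "\<dots> = comp A n F" using e[OF A(1) True] by (simp add: sq W.scale_one)
        finally show ?thesis by (simp add: Suc)
      next
        \<comment> \<open>Here \<open>length A = m + 1 = n\<close>: the component lies in
          \<open>BI K 0\<close>, which is zero, and the differential has zero component at this
          length.\<close>
        case False
        then have "n - length A = 0" using Suc by simp
        then have "comp A n F \<in> BI K 0" using comps A Suc by metis
        then have "comp A (Suc m) F = 0" by (simp add: BI_def Suc)
        then show ?thesis using False by (simp add: comp_d_signed[OF c(1) A])
      qed
    qed
    then show "F \<in> BI UNIV n" unfolding Suc BI using c(1) by (rule image_eqI)
  qed
qed

text \<open>A family \<open>u\<close> of representatives determines the invariant cocycle with
  components \<open>u A\<close>; injectivity and surjectivity modulo coboundaries are checked
  component by component.\<close>

lemma cohomology_coords: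
  assumes BI: "\<And>m. BI UNIV (Suc m) = d UNIV m ` CI UNIV m" "\<And>m. BI K (Suc m) = d K m ` CI K m"
    and Z0: "\<And>z. z \<in> Z UNIV n \<Longrightarrow> \<exists>z0\<in>ZI UNIV n. z - z0 \<in> B UNIV n"
    and U: "\<And>m. W.subspace (U m)" "\<And>m. U m \<subseteq> ZI K m" "\<And>m. U m \<inter> BI K m = {0}"
      "\<And>m z. z \<in> ZI K m \<Longrightarrow> \<exists>u\<in>U m. z - u \<in> BI K m"
  shows "\<exists>T. linear_iso T (subspace_module (pointwise (pointwise mscale))
     {u. (\<forall>A. A \<in> set (subseqs hs) \<and> length A \<le> n \<longrightarrow> u A \<in> U (n - length A)) \<and>
         (\<forall>A. \<not> (A \<in> set (subseqs hs) \<and> length A \<le> n) \<longrightarrow> u A = 0)})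
     (cohomology scale bracket mscale act UNIV n)"
proof -
  let ?I = "set (subseqs hs)"
  let ?Y = "{u. (\<forall>A. A \<in> ?I \<and> length A \<le> n \<longrightarrow> u A \<in> U (n - length A)) \<and> (\<forall>A. \<not> (A \<in> ?I \<and> length A
      \<le> n) \<longrightarrow> u A = 0)}"
  let ?pp = "pointwise (pointwise mscale) :: 'a \<Rightarrow> ('b list \<Rightarrow> 'b list \<Rightarrow> 'c) \<Rightarrow> _"
  interpret P: vector_space ?pp by (intro vector_space_pointwise W.vector_space_axioms)
  have UZ: "u A \<in> ZI K (n - length A)" "u A \<in> CI K (n - length A)"
    if "u \<in> ?Y" "A \<in> ?I" "length A \<le> n" for u A
    using that U(2)[of "n - length A"] by (auto simp: ZI_def)
  \<comment> \<open>Chosen by existence alone; linearity follows from uniqueness of the cochain with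
    given components.\<close>
  define T where "T u = (SOME F. F \<in> CI UNIV n \<and> (\<forall>A\<in>?I. length A \<le> n \<longrightarrow> comp A n F = u A))" for u
  have T: "T u \<in> CI UNIV n" "\<And>A. \<lbrakk>A \<in> ?I; length A \<le> n\<rbrakk> \<Longrightarrow> comp A n (T u) = u A" if "u \<in> ?Y" for u
    using someI_ex[OF comps_exist[of n u], OF UZ(2)[OF that]] unfolding T_def[symmetric] by blast+
  have TC: "T u \<in> C UNIV n" if "u \<in> ?Y" for u using CI_D(1) T(1) that by blast
  have T_unique: "F = T u"
    if "u \<in> ?Y" "F \<in> C UNIV n" "\<And>A. \<lbrakk>A \<in> ?I; length A \<le> n\<rbrakk> \<Longrightarrow> comp A n F = u A" for F u
    by (rule eq_if_comps_eq[OF that(2) CI_D(1)[OF T(1)[OF that(1)]]]) (simp add: T(2)[OF that(1)] that(3))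
  have Y: "P.subspace ?Y"
    using W.subspace_0[OF U(1)] W.subspace_add[OF U(1)] W.subspace_scale[OF U(1)]
    by (intro P.subspaceI) (auto simp: pointwise_def[of "pointwise mscale"] W.scale_zero_right)
  have B0: "0 \<in> B UNIV n" by (rule W.subspace_0[OF subspace_B])
  have "linear_iso (\<lambda>u. coset_of (B UNIV n) (T u)) (subspace_module ?pp ?Y)
      (quotient_module (pointwise mscale) (Z UNIV n) (B UNIV n))"
  proof (rule linear_iso_quotient[OF W.vector_space_axioms P.vector_space_axioms Y subspace_B])
    fix u assume u: "u \<in> ?Y"
    have "T u \<in> ZI UNIV n" by (rule ZI_if_comps_ZI[OF T(1)[OF u]]) (simp add: T(2)[OF u] UZ(1)[OF u])
    then show "T u \<in> Z UNIV n" by (auto simp: ZI_def CI_def cocycles_def)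
    show "T (u + u') - T u - T u' \<in> B UNIV n" if u': "u' \<in> ?Y" for u'
    proof -
      have "T u + T u' = T (u + u')"
        by (rule T_unique[OF P.subspace_add[OF Y u u']])
          (use C_add[OF TC[OF u] TC[OF u']] in \<open>simp_all add: comp_linear T(2)[OF u] T(2)[OF u']\<close>)
      then have "T (u + u') - T u - T u' = 0" by (simp add: algebra_simps)
      then show ?thesis using B0 by simp
    qed
    show "T (?pp c u) - pointwise mscale c (T u) \<in> B UNIV n" for c
    proof -
      have "pointwise mscale c (T u) = T (?pp c u)"
        by (rule T_unique[OF P.subspace_scale[OF Y u]])
          (use C_scale[OF TC[OF u]] in \<open>simp_all add: comp_linear T(2)[OF u] pointwise_def[of
              "pointwise mscale"]\<close>)
      then show ?thesis using B0 by simp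
    qed
    assume "T u \<in> B UNIV n"
    then have "T u \<in> BI UNIV n" using T(1)[OF u] by (simp add: BI_def)
    then have "u A \<in> BI K (n - length A)" if "A \<in> ?I" "length A \<le> n" for A
      using BI_iff_comps[OF BI T(1)[OF u]] T(2)[OF u that] that by metis
    then have "u A = 0" if "A \<in> ?I" "length A \<le> n" for A
      using u that U(3)[of "n - length A"] by blast
    then have "u A = 0" for A using u by (cases "A \<in> ?I \<and> length A \<le> n") auto
    then show "u = 0" by (intro HOL.ext) simp
  next
    fix z assume "z \<in> Z UNIV n"
    then obtain z0 where z0: "z0 \<in> ZI UNIV n" "z - z0 \<in> B UNIV n" using Z0 by blast
    have "\<exists>x. x \<in> U (n - length A) \<and> comp A n z0 - x \<in> BI K (n - length A)"
      if "A \<in> ?I" "length A \<le> n" for A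
      using U(4)[OF comp_ZI[OF z0(1) that]] by blast
    then obtain x where x: "\<And>A. \<lbrakk>A \<in> ?I; length A \<le> n\<rbrakk> \<Longrightarrow> x A \<in> U (n - length A) \<and> comp A n z0 - x A
        \<in> BI K (n - length A)"
      by metis
    define u where "u A = (if A \<in> ?I \<and> length A \<le> n then x A else 0)" for A
    have u: "u \<in> ?Y" using x by (simp add: u_def)
    have "z0 - T u \<in> CI UNIV n"
      using z0(1) by (intro W.subspace_diff[OF subspace_CI] T(1)[OF u]) (simp add: ZI_def)
    then have "z0 - T u \<in> BI UNIV n"
      using x by (subst BI_iff_comps[OF BI]) (auto simp: comp_linear T(2)[OF u] u_def)
    then have "(z - z0) + (z0 - T u) \<in> B UNIV n"
      by (intro W.subspace_add[OF subspace_B] z0(2)) (simp add: BI_def)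
    then have "z - T u \<in> B UNIV n" by simp
    then show "\<exists>u\<in>?Y. z - T u \<in> B UNIV n" using u by blast
  qed
  then show ?thesis unfolding cohomology_def by blast
qed

end

end

theorem theorem4:
  fixes scale :: "'k::field \<Rightarrow> 'g::ab_group_add \<Rightarrow> 'g"
    and bracket :: "'g \<Rightarrow> 'g \<Rightarrow> 'g"
    and mscale :: "'k \<Rightarrow> 'm::ab_group_add \<Rightarrow> 'm"
    and act :: "'g \<Rightarrow> 'm \<Rightarrow> 'm"
    and \<hh> \<kk> :: "'g set"
  assumes "lie_algebra scale bracket"
    and "lie_algebra.finite_dimensional scale"
    and "lie_algebra.semidirect_product scale bracket \<hh> \<kk>"
    and "lie_algebra.abelian bracket \<hh>"
    and "lie_module scale bracket mscale act"
    and "acts_torally scale \<hh> bracket"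
    and "acts_torally mscale \<hh> act"
  shows "graded_isomorphic
      (cohomology scale bracket mscale act UNIV)
      (graded_tensor (exterior_power (dual_space scale \<hh>))
        (weight_zero_cohomology scale bracket mscale act \<hh> \<kk>))
    \<and> graded_isomorphic
      (exterior_power (dual_space scale \<hh>))
      (cohomology scale bracket ((*) :: 'k \<Rightarrow> 'k \<Rightarrow> 'k) (\<lambda>_ _. 0) \<hh>)
    \<and> graded_isomorphic
      (graded_tensor (exterior_power (dual_space scale \<hh>))
        (weight_zero_cohomology scale bracket mscale act \<hh> \<kk>))
      (graded_tensor (cohomology scale bracket ((*) :: 'k \<Rightarrow> 'k \<Rightarrow> 'k) (\<lambda>_ _. 0) \<hh>)
        (weight_zero_cohomology scale bracket mscale act \<hh> \<kk>))"
proof -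
  interpret lie_module scale bracket mscale act by fact
  have h: "lie_subalgebra \<hh>" and k: "lie_ideal \<kk>" and hk: "\<hh> \<inter> \<kk> = {0}"
    and sum: "{a + b | a b. a \<in> \<hh> \<and> b \<in> \<kk>} = UNIV"
    using assms(3) by (auto simp: semidirect_product_def)
  have k': "lie_subalgebra \<kk>" using k by (simp add: lie_ideal_def lie_subalgebra_def)
  interpret lie_module_torus scale bracket mscale act \<hh> \<kk>
    by unfold_locales (use assms(4) k k' in \<open>auto simp: abelian_def lie_ideal_def\<close>)
  obtain B0 where fd: "finite B0" "span B0 = UNIV" using assms(2) by (auto simp: finite_dimensional_def)
  obtain hs where hs: "distinct hs" "independent (set hs)" "span (set hs) = \<hh>"
    using subspace_basis[OF fd lie_subalgebraD(1)[OF h]] by blast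
  \<comment> \<open>Independence inside \<open>\<hh>\<close> becomes independence modulo
    \<open>\<kk>\<close> because the two meet only in zero.\<close>
  have "indep_mod gs" if "distinct gs" "independent (set gs)" "set gs \<subseteq> \<hh>" for gs
    using that
  proof (induction gs)
    case (Cons g gs)
    have "g \<notin> ext_by gs"
    proof
      assume "g \<in> ext_by gs"
      then obtain a b where ab: "g = a + b" "a \<in> span (set gs)" "b \<in> span \<kk>"
        by (auto simp: ext_by_def span_Un)
      have "a \<in> \<hh>" using ab(2) span_minimal[OF _ lie_subalgebraD(1)[OF h], of "set gs"] Cons.prems(3) by auto
      then have "g - a \<in> \<hh>" using Cons.prems(3)
        by (intro subspace_diff[OF lie_subalgebraD(1)[OF h]]) auto
      moreover have "b \<in> \<kk>" using ab(3) K_sub by (simp add: span_eq_iff[THEN iffD2])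
      ultimately have "b \<in> \<hh> \<inter> \<kk>" using ab(1) by simp
      then have "b = 0" using hk by blast
      then show False using ab Cons.prems(1,2) by (simp add: independent_insert)
    qed
    moreover have "independent (set gs)" using Cons.prems(2) by (rule independent_mono) auto
    ultimately show ?case using Cons by simp
  qed simp
  then have ind: "indep_mod hs" using hs span_superset by metis
  have full: "ext_by hs = UNIV"
  proof -
    have "x \<in> ext_by hs" for x
    proof -
      obtain a b where "x = a + b" "a \<in> \<hh>" "b \<in> \<kk>" using sum by blast
      moreover have "\<hh> \<subseteq> ext_by hs" unfolding hs(3)[symmetric] ext_by_def by (rule span_mono) auto
      ultimately show ?thesis using K_subset_ext_by[of hs] subspace_add[OF subspace_ext_by] by blast
    qed
    then show ?thesis by blast
  qed
  \<comment> \<open>Torality enters here: it makes each cochain a sum of eigenvectors over the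
    closure, and \<open>stable_subspace_eigvecs\<close> descends to the ground field. The statement
    serves both \<open>UNIV\<close> and \<open>\<kk>\<close>.\<close>
  have ss: "\<theta> S n h F \<in> Y"
    if "subspace S" "\<And>x. x \<in> S \<Longrightarrow> bracket h x \<in> S" "h \<in> \<hh>" "F \<in> C S n" "W.subspace Y"
        "\<And>G. G \<in> Y \<Longrightarrow> \<theta> S n h G \<in> Y" "\<theta> S n h (\<theta> S n h F) \<in> Y"
    for S n h F Y
  proof (rule we.stable_subspace_eigvecs[OF linear_op_\<theta> _ that(5-7)])
    show "unit_ext (pointwise mscale) F \<in> E.span (E.eigvecs (emap (\<theta> S n h)))"
      using assms(6,7) that by (intro \<theta>_eigvecs[OF that(1,2) fd]) (auto simp: acts_torally_def)
  qed
  note ssG = ss[OF subspace_UNIV UNIV_I]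
  note ssK = ss[OF K_sub H_K]
  have "\<exists>U. W.subspace U \<and> U \<subseteq> ZI \<kk> m \<and> U \<inter> BI \<kk> m = {0} \<and> (\<forall>z\<in>ZI \<kk> m. \<exists>u\<in>U. z - u \<in> BI \<kk> m)" for m
    by (rule W.exists_complement[OF subspace_ZI subspace_BI])
  then obtain U where U: "\<And>m. W.subspace (U m)" "\<And>m. U m \<subseteq> ZI \<kk> m" "\<And>m. U m \<inter> BI \<kk> m = {0}"
      "\<And>m z. z \<in> ZI \<kk> m \<Longrightarrow> \<exists>u\<in>U m. z - u \<in> BI \<kk> m" by metis
  let ?W = "weight_zero_cohomology scale bracket mscale act \<hh> \<kk>"
  let ?E = "exterior_power (dual_space scale \<hh>)"
  let ?A = "cohomology scale bracket ((*) :: 'k \<Rightarrow> 'k \<Rightarrow> 'k) (\<lambda>_ _. 0) \<hh>"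
  define Y where "Y n = {u. (\<forall>A. A \<in> set (subseqs hs) \<and> length A \<le> n \<longrightarrow> u A \<in> U (n - length A)) \<and>
      (\<forall>A. \<not> (A \<in> set (subseqs hs) \<and> length A \<le> n) \<longrightarrow> u A = 0)}" for n
  let ?Y = "\<lambda>n. subspace_module (pointwise (pointwise mscale)) (Y n)"
  have weq: "?W m = quotient_module (pointwise mscale) (Z0 \<kk> m) (B \<kk> m)" for m
    by (rule weight_zero_cohomology_eq[OF K H_K hs(3) ssK])
  have W: "\<exists>g. linear_iso g (subspace_module (pointwise mscale) (U m)) (?W m)" for m
    unfolding weq by (rule exI, rule quotient_Z0_coords[OF K H_K hs(3) ssK U])
  have E: "\<exists>f. linear_iso f (coord_module {A \<in> set (subseqs hs). length A = r}) (?E r)" for r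
    using exterior_power_dual_coords[OF hs(1,2)] unfolding hs(3) .
  have A: "\<exists>f. linear_iso f (coord_module {A \<in> set (subseqs hs). length A = r}) (?A r)" for r
    by (rule abelian_cohomology_coords[OF assms(4) hs])
  have YE: "\<exists>T. linear_iso T (?Y n) (graded_tensor ?E ?W n)" for n
    unfolding Y_def by (rule graded_tensor_coords[OF W.vector_space_axioms U(1) finite_set E W])
  have YA: "\<exists>T. linear_iso T (?Y n) (graded_tensor ?A ?W n)" for n
    unfolding Y_def by (rule graded_tensor_coords[OF W.vector_space_axioms U(1) finite_set A W])
  have YG: "\<exists>T. linear_iso T (?Y n) (cohomology scale bracket mscale act UNIV n)" for n
    unfolding Y_def
  proof (rule cohomology_coords[OF ind hs(3) full _ _ _ U])
    show "BI UNIV (Suc m) = d UNIV m ` CI UNIV m" for m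
      by (rule BI_Suc[OF lie_subalgebra_UNIV UNIV_I hs(3) ssG])
    show "BI \<kk> (Suc m) = d \<kk> m ` CI \<kk> m" for m
      by (rule BI_Suc[OF K H_K hs(3) ssK])
    have Z: "Z0 UNIV n = Z UNIV n"
      by (rule Z0_eq_Z[OF lie_subalgebra_UNIV UNIV_I hs(3) ssG subset_UNIV])
    show "\<exists>z0\<in>ZI UNIV n. z - z0 \<in> B UNIV n" if z: "z \<in> Z UNIV n" for z
    proof (rule Z0_invariant[OF lie_subalgebra_UNIV UNIV_I hs(3) ssG])
      show "z \<in> Z0 UNIV n" using z unfolding Z .
    qed
  qed
  interpret P: vector_space "pointwise (pointwise mscale) :: 'k \<Rightarrow> ('g list \<Rightarrow> 'g list \<Rightarrow> 'm) \<Rightarrow> _"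
    by (intro vector_space_pointwise W.vector_space_axioms)
  have subY: "P.subspace (Y n)" for n
    unfolding Y_def using W.subspace_0[OF U(1)] W.subspace_add[OF U(1)] W.subspace_scale[OF U(1)]
    by (intro P.subspaceI) (auto simp: pointwise_def[of "pointwise mscale"] W.scale_zero_right)
  \<comment> \<open>Each comparison goes through a common source: the families \<open>Y n\<close>
    for the first and third, the coordinate space of increasing tuples for the second.\<close>
  note sym = linear_iso_common_source
  show ?thesis
    unfolding graded_isomorphic_def
    using sym[OF YG YE P.vector_space_axioms subY] sym[OF YE YA P.vector_space_axioms subY]
      sym[OF E A vector_space_pointwise[OF vector_space_field] subspace_coords] by blast
qed

end
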